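(* Let $X,Y,c,y_0,Z,Q,b$ be as in the context, let $\mu,\nu$ be Borel probability measures on $X$ and $Y$, and let $\alpha=Q_\#\mu$. Suppose $c$ is twisted, i.e. for every $x\in X$ the map $y\mapsto D_xc(x,y)$ is injective on $\overline Y$, and suppose $\mu$ does not charge sets of Hausdorff dimension $m-1$. Let $F:X\to Y$ be the optimal map for the Monge problem with cost $c$ and marginals $\mu,\nu$. Then there exists a map $T:Z\to Y$ such that $F=T\circ Q$ $\mu$-almost everywhere. Moreover, $T$ solves the Monge optimal transportation problem on $Z\times Y$ with cost function $b$ and marginals $\alpha$ and $\nu$.
   Context: Let $m\ge n$, and let $X$ and $Y$ be smooth manifolds of dimensions $m$ and $n$, with $Y$ connected, smoothly embedded in larger manifolds in which their closures are compact. Let $c\in C^4(\overline X\times\overline Y)$ be such that the map $D^2_{xy}c(x,y):T_yY\to T^*_xX$, $\frac{\partial}{\partial y^i}\mapsto \frac{\partial^2c(x,y)}{\partial y^i\partial x^j}dx^j$, is injective for all $x\in X,y\in Y$. $D_xc(x,y)\in T^*_xX$ and $D_yc(x,y)\in T^*_yY$ denote the differentials of $c$ in $x$ and $y$. Assume that for every $x\in X$ the level set $L_x(y):=\{\overline x\in X: D_yc(\overline x,y)=D_yc(x,y)\}$ is connected and independent of $y\in Y$; write it $L_x$. Let $Z=X/\!\sim$, where $x\sim\overline x$ iff $\overline x\in L_x$, with quotient map $Q:X\to Z$. Fix $y_0\in Y$. The map $x\mapsto D_yc(x,y_0)$ has the same level sets as $Q$ and is open, so $Z$ is identified with the open subset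 $D_yc(X,y_0)\subseteq T^*_{y_0}Y$ and $Q$ with $x\mapsto D_yc(x,y_0)$. The function $b:Z\times Y\to\mathbb R$ is defined uniquely by $D_yb(z,y)=D_yc(x,y)$ for $x\in Q^{-1}(z)$, $y\in Y$, together with $b(z,y_0)=0$. Monge problem with cost $c$ and marginals $\mu,\nu$: among Borel maps $F:X\to Y$ pushing $\mu$ forward to $\nu$ (i.e. $\nu(A)=\mu(F^{-1}(A))$ for all Borel $A\subseteq Y$), minimize $\int_Xc(x,F(x))\,d\mu$; a minimizer is called an optimal map. If $c$ is twisted (for every $x\in X$ the map $y\mapsto D_xc(x,y)$ is injective on $\overline Y$) and $\mu(A)=0$ for all Borel sets $A\subseteq X$ of Hausdorff dimension less than or equal to $m-1$, then an optimal map exists and is unique ($\mu$-a.e.). The problem on $Z\times Y$ with cost $b$ and marginals $\alpha,\nu$ is defined in the same way. *)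

theory Defs
  imports "HOL-Probability.Probability"
begin

section \<open>Functions of class \<open>C\<^sup>k\<close> on open subsets of Euclidean spaces\<close>

text \<open>Only meant for open \<open>S\<close>.\<close>

primrec Ck_on :: "nat \<Rightarrow> 'e::euclidean_space set \<Rightarrow> ('e \<Rightarrow> 'f::real_normed_vector) \<Rightarrow> bool" where
  "Ck_on 0 S f \<longleftrightarrow> continuous_on S f"
| "Ck_on (Suc k) S f \<longleftrightarrow>
     (\<forall>x\<in>S. f differentiable (at x)) \<and>
     (\<forall>v. Ck_on k S (\<lambda>x. frechet_derivative f (at x) v))"

definition smooth_on :: "'e::euclidean_space set \<Rightarrow> ('e \<Rightarrow> 'f::real_normed_vector) \<Rightarrow> bool" where
  "smooth_on S f \<longleftrightarrow> (\<forall>k. Ck_on k S f)"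


section \<open>Smooth manifolds\<close>

text \<open>
  An ambient manifold is a second countable Hausdorff space, given as a type \<open>'a\<close>, together with a
  smooth atlas modelled on \<open>'e\<close>. A chart is a pair \<open>(U, \<phi>)\<close>; the values of \<open>\<phi>\<close> outside \<open>U\<close> are
  irrelevant.
\<close>

type_synonym ('a, 'e) chart = "'a set \<times> ('a \<Rightarrow> 'e)"

definition is_chart :: "('a::topological_space, 'e::euclidean_space) chart \<Rightarrow> bool" where
  "is_chart = (\<lambda>(U, \<phi>). open U \<and> open (\<phi> ` U) \<and> homeomorphism U (\<phi> ` U) \<phi> (inv_into U \<phi>))"

definition compatible_charts ::
  "('a::topological_space, 'e::euclidean_space) chart \<Rightarrow> ('a, 'e) chart \<Rightarrow> bool" where
  "compatible_charts = (\<lambda>(U, \<phi>) (V, \<psi>).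
     smooth_on (\<phi> ` (U \<inter> V)) (\<psi> \<circ> inv_into U \<phi>) \<and>
     smooth_on (\<psi> ` (U \<inter> V)) (\<phi> \<circ> inv_into V \<psi>))"

definition smooth_atlas :: "('a::topological_space, 'e::euclidean_space) chart set \<Rightarrow> bool" where
  "smooth_atlas A \<longleftrightarrow>
     (\<forall>\<kappa>\<in>A. is_chart \<kappa>) \<and> (\<forall>\<kappa>\<in>A. \<forall>\<kappa>'\<in>A. compatible_charts \<kappa> \<kappa>') \<and> (\<Union>\<kappa>\<in>A. fst \<kappa>) = UNIV"

text \<open>The maximal atlas determined by \<open>A\<close>.\<close>

definition charts ::
  "('a::topological_space, 'e::euclidean_space) chart set \<Rightarrow> ('a, 'e) chart set" where
  "charts A = {\<kappa>. is_chart \<kappa> \<and> (\<forall>\<kappa>'\<in>A. compatible_charts \<kappa> \<kappa>')}"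

definition prod_atlas ::
  "('a::topological_space, 'e::euclidean_space) chart set \<Rightarrow>
   ('b::topological_space, 'f::euclidean_space) chart set \<Rightarrow> ('a \<times> 'b, 'e \<times> 'f) chart set" where
  "prod_atlas A B = {(U \<times> V, map_prod \<phi> \<psi>) | U \<phi> V \<psi>. (U, \<phi>) \<in> A \<and> (V, \<psi>) \<in> B}"

text \<open>
  Smoothly embedded submanifolds of dimension \<open>d\<close>: around each point there is a slice chart,
  i.e.\ a chart of the ambient manifold taking \<open>S\<close> to a \<open>d\<close>-dimensional linear subspace.
\<close>

definition embedded_submanifold ::
  "nat \<Rightarrow> ('a::topological_space, 'e::euclidean_space) chart set \<Rightarrow> 'a set \<Rightarrow> bool" where
  "embedded_submanifold d A S \<longleftrightarrow>
     (\<forall>p\<in>S. \<exists>(U, \<phi>)\<in>charts A. \<exists>V. p \<in> U \<and> subspace V \<and> dim V = d \<and> \<phi> ` (U \<inter> S) = \<phi> ` U \<inter> V)"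

text \<open>\<open>C\<^sup>k\<close> functions on an open subset \<open>W\<close> of a manifold.\<close>

definition Ck_open ::
  "nat \<Rightarrow> ('a::topological_space, 'e::euclidean_space) chart set \<Rightarrow> 'a set \<Rightarrow> ('a \<Rightarrow> real) \<Rightarrow> bool"
  where
  "Ck_open k A W f \<longleftrightarrow>
     open W \<and> (\<forall>(U, \<phi>)\<in>charts A. Ck_on k (\<phi> ` (U \<inter> W)) (f \<circ> inv_into U \<phi>))"

text \<open>\<open>C\<^sup>k\<close> functions on an arbitrary subset of a manifold: those having local \<open>C\<^sup>k\<close> extensions.\<close>

definition Ck ::
  "nat \<Rightarrow> ('a::topological_space, 'e::euclidean_space) chart set \<Rightarrow> 'a set \<Rightarrow> ('a \<Rightarrow> real) \<Rightarrow> bool"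
  where
  "Ck k A S f \<longleftrightarrow> (\<forall>p\<in>S. \<exists>W g. p \<in> W \<and> Ck_open k A W g \<and> (\<forall>q\<in>S \<inter> W. g q = f q))"


section \<open>Tangent spaces and differentials\<close>

text \<open>
  Tangent vectors of a submanifold \<open>S\<close> at \<open>p\<close> are velocities of smooth curves in \<open>S\<close> through \<open>p\<close>:
  classes of curves which have the same velocity at time 0 in every chart. A curve is a total
  function on the reals of which only the germ at 0 matters.
\<close>

definition curves ::
  "('a::topological_space, 'e::euclidean_space) chart set \<Rightarrow> 'a set \<Rightarrow> 'a \<Rightarrow> (real \<Rightarrow> 'a) set" where
  "curves A S p = {\<gamma>. \<gamma> 0 = p \<and>
     (\<exists>e>0. \<gamma> ` {-e<..<e} \<subseteq> S \<and> continuous_on {-e<..<e} \<gamma> \<and>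
        (\<forall>(U, \<phi>)\<in>charts A. smooth_on ({-e<..<e} \<inter> \<gamma> -` U) (\<phi> \<circ> \<gamma>)))}"

definition same_velocity ::
  "('a::topological_space, 'e::euclidean_space) chart set \<Rightarrow> 'a set \<Rightarrow> 'a \<Rightarrow>
   ((real \<Rightarrow> 'a) \<times> (real \<Rightarrow> 'a)) set" where
  "same_velocity A S p = {(\<gamma>, \<eta>). \<gamma> \<in> curves A S p \<and> \<eta> \<in> curves A S p \<and>
     (\<forall>(U, \<phi>)\<in>charts A. p \<in> U \<longrightarrow>
        vector_derivative (\<phi> \<circ> \<gamma>) (at 0) = vector_derivative (\<phi> \<circ> \<eta>) (at 0))}"

definition tangent_space ::
  "('a::topological_space, 'e::euclidean_space) chart set \<Rightarrow> 'a set \<Rightarrow> 'a \<Rightarrow> (real \<Rightarrow> 'a) set set"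
  where
  "tangent_space A S p = curves A S p // same_velocity A S p"

text \<open>
  The differential at \<open>p\<close> of a function \<open>f\<close> on \<open>S\<close>, as a function on \<open>T\<^sub>pS\<close>: it maps the class of a
  curve \<open>\<gamma>\<close> to the derivative of \<open>f \<circ> \<gamma>\<close> at 0. It is made \<open>undefined\<close> off the tangent space, so
  that equality of covectors is equality of functions.
\<close>

definition differential ::
  "('a::topological_space, 'e::euclidean_space) chart set \<Rightarrow> 'a set \<Rightarrow> 'a \<Rightarrow> ('a \<Rightarrow> real) \<Rightarrow>
   (real \<Rightarrow> 'a) set \<Rightarrow> real" where
  "differential A S p f =
     (\<lambda>v\<in>tangent_space A S p. THE d. \<forall>\<gamma>\<in>v. ((\<lambda>t. f (\<gamma> t)) has_real_derivative d) (at 0))"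

text \<open>
  \<open>D\<^sup>2\<^sub>x\<^sub>yc(x,y)\<close>, as a map from \<open>T\<^sub>yY\<close> to the dual of \<open>T\<^sub>xX\<close>; in coordinates it sends \<open>\<partial>/\<partial>y\<^sup>i\<close> to the
  differential in \<open>x\<close> of \<open>\<partial>c/\<partial>y\<^sup>i\<close>.
\<close>

definition mixed_differential ::
  "('a::topological_space, 'e::euclidean_space) chart set \<Rightarrow>
   ('b::topological_space, 'f::euclidean_space) chart set \<Rightarrow> 'a set \<Rightarrow> 'b set \<Rightarrow>
   ('a \<Rightarrow> 'b \<Rightarrow> real) \<Rightarrow> 'a \<Rightarrow> 'b \<Rightarrow> (real \<Rightarrow> 'b) set \<Rightarrow> (real \<Rightarrow> 'a) set \<Rightarrow> real" where
  "mixed_differential A B X Y c x y =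
     (\<lambda>w\<in>tangent_space B Y y. differential A X x (\<lambda>x'. differential B Y y (c x') w))"


section \<open>Level sets of \<open>D\<^sub>yc\<close> and the quotient \<open>Z\<close>\<close>

definition level_set ::
  "('b::topological_space, 'f::euclidean_space) chart set \<Rightarrow> 'a set \<Rightarrow> 'b set \<Rightarrow>
   ('a \<Rightarrow> 'b \<Rightarrow> real) \<Rightarrow> 'a \<Rightarrow> 'b \<Rightarrow> 'a set" where
  "level_set B X Y c x y = {x'\<in>X. differential B Y y (c x') = differential B Y y (c x)}"

text \<open>
  In the intended setting the level sets do not depend on the point of \<open>Y\<close>, so that \<open>L\<^sub>x\<close> may be
  computed at the base point \<open>y\<^sub>0\<close>.
\<close>

definition level_rel ::
  "('b::topological_space, 'f::euclidean_space) chart set \<Rightarrow> 'a set \<Rightarrow> 'b set \<Rightarrow>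
   ('a \<Rightarrow> 'b \<Rightarrow> real) \<Rightarrow> 'b \<Rightarrow> ('a \<times> 'a) set" where
  "level_rel B X Y c y0 = {(x, x'). x \<in> X \<and> x' \<in> level_set B X Y c x y0}"

definition quotient_map_of :: "('a \<times> 'a) set \<Rightarrow> 'a \<Rightarrow> 'a set" where
  "quotient_map_of r x = r `` {x}"

text \<open>The Borel \<open>\<sigma>\<close>-algebra of the quotient topology on \<open>X // r\<close>.\<close>

definition quotient_borel :: "'a::topological_space set \<Rightarrow> ('a \<times> 'a) set \<Rightarrow> 'a set measure" where
  "quotient_borel X r = sigma (X // r)
     {W. W \<subseteq> X // r \<and> openin (top_of_set X) {x\<in>X. quotient_map_of r x \<in> W}}"

text \<open>
  The conditions determining \<open>b\<close>. The requirement that \<open>b(z,\<cdot>)\<close> be \<open>C\<^sup>1\<close> gives \<open>D\<^sub>yb\<close> a meaning.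
\<close>

definition reduced_cost ::
  "('b::topological_space, 'f::euclidean_space) chart set \<Rightarrow> 'a set \<Rightarrow> 'b set \<Rightarrow>
   ('a \<Rightarrow> 'b \<Rightarrow> real) \<Rightarrow> 'b \<Rightarrow> ('a set \<Rightarrow> 'b \<Rightarrow> real) \<Rightarrow> bool" where
  "reduced_cost B X Y c y0 b \<longleftrightarrow>
     (\<forall>z\<in>X // level_rel B X Y c y0. Ck 1 B Y (b z) \<and> b z y0 = 0 \<and>
        (\<forall>x\<in>X. quotient_map_of (level_rel B X Y c y0) x = z \<longrightarrow>
           (\<forall>y\<in>Y. differential B Y y (b z) = differential B Y y (c x))))"


section \<open>Twist condition\<close>

text \<open>\<open>S\<close> is the set of target points, the closure of \<open>Y\<close> in the application.\<close>

definition twisted ::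
  "('a::topological_space, 'e::euclidean_space) chart set \<Rightarrow> 'a set \<Rightarrow> 'b set \<Rightarrow>
   ('a \<Rightarrow> 'b \<Rightarrow> real) \<Rightarrow> bool" where
  "twisted A X S c \<longleftrightarrow> (\<forall>x\<in>X. inj_on (\<lambda>y. differential A X x (\<lambda>x'. c x' y)) S)"


section \<open>Hausdorff dimension\<close>

definition hausdorff_premeasure :: "real \<Rightarrow> real \<Rightarrow> 'e::metric_space set \<Rightarrow> ennreal" where
  "hausdorff_premeasure \<delta> s A =
     (INF U\<in>{U :: nat \<Rightarrow> 'e set. A \<subseteq> (\<Union>i. U i) \<and> (\<forall>i. bounded (U i) \<and> diameter (U i) \<le> \<delta>)}.
        \<Sum>i. ennreal (diameter (U i) powr s))"

definition hausdorff_measure :: "real \<Rightarrow> 'e::metric_space set \<Rightarrow> ennreal" where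
  "hausdorff_measure s A = (SUP \<delta>\<in>{0<..}. hausdorff_premeasure \<delta> s A)"

text \<open>
  The exponent \<open>s = 0\<close> is left out because of the convention \<open>0 powr 0 = 0\<close>; this does not affect
  the infimum. The empty set gets dimension 0.
\<close>

definition hausdorff_dim :: "'e::metric_space set \<Rightarrow> ereal" where
  "hausdorff_dim A = (INF s\<in>{s. 0 < s \<and> hausdorff_measure s A = 0}. ereal s)"

text \<open>
  Charts are locally bi-Lipschitz and Hausdorff dimension is countably stable, so the Hausdorff
  dimension of a subset of a manifold is measured in charts.
\<close>

definition manifold_hausdorff_dim ::
  "('a::topological_space, 'e::euclidean_space) chart set \<Rightarrow> 'a set \<Rightarrow> ereal" where
  "manifold_hausdorff_dim A S = (SUP (U, \<phi>)\<in>charts A. hausdorff_dim (\<phi> ` (U \<inter> S)))"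


section \<open>The Monge problem\<close>

text \<open>
  Admissible maps are measurable maps pushing the first marginal forward to the second one; they map
  \<open>space \<mu>\<close> to \<open>space \<nu>\<close>. The definition is meant for costs such that \<open>k x (F x)\<close> is integrable for
  every admissible \<open>F\<close>, e.g.\ bounded measurable costs and probability marginals; otherwise the
  Bochner integral is 0 by convention.
\<close>

definition transport_map :: "'x measure \<Rightarrow> 'y measure \<Rightarrow> ('x \<Rightarrow> 'y) \<Rightarrow> bool" where
  "transport_map \<mu> \<nu> F \<longleftrightarrow> F \<in> measurable \<mu> \<nu> \<and> distr \<mu> \<nu> F = \<nu>"

definition optimal_map ::
  "('x \<Rightarrow> 'y \<Rightarrow> real) \<Rightarrow> 'x measure \<Rightarrow> 'y measure \<Rightarrow> ('x \<Rightarrow> 'y) \<Rightarrow> bool" where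
  "optimal_map k \<mu> \<nu> F \<longleftrightarrow> transport_map \<mu> \<nu> F \<and>
     (\<forall>G. transport_map \<mu> \<nu> G \<longrightarrow> (LINT x|\<mu>. k x (F x)) \<le> (LINT x|\<mu>. k x (G x)))"

end

theory Submission
  imports Defs
begin

text \<open>
  Write \<open>v\<^sup>c(x)\<close> for the minimum of \<open>c(x,y) - v(y)\<close> over \<open>y\<close> in the closure of \<open>Y\<close>. Since
  \<open>c(x,y) = b(Q x,y) + c(x,y\<^sub>0)\<close>, the set of minimisers depends on \<open>Q x\<close> only. If \<open>v\<close> maximises
  \<open>\<integral>v\<^sup>cd\<mu> + \<integral>vd\<nu>\<close>, then by the first variation (Gangbo's argument) the map sending \<open>x\<close> to its
  minimiser, if that is unique \<open>\<mu>\<close>-almost everywhere, pushes \<open>\<mu>\<close> to \<open>\<nu>\<close>; hence it is optimal, there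
  is no duality gap, and \<open>F(x)\<close> is the minimiser for almost every \<open>x\<close>. So \<open>F\<close> factors through \<open>Q\<close>,
  and optimality of the factor for \<open>b\<close> follows from that of \<open>F\<close> for \<open>c\<close>.

  Uniqueness almost everywhere is a consequence of the twist condition: if \<open>y\<^sub>1\<close> and \<open>y\<^sub>2\<close> are two
  minimisers at \<open>x\<close>, then \<open>D\<^sub>xc(x,y\<^sub>1) - D\<^sub>xc(x,y\<^sub>2)\<close> is nonzero on some tangent vector, and near \<open>x\<close> the
  points having minimisers close to both \<open>y\<^sub>1\<close> and \<open>y\<^sub>2\<close> form a Lipschitz graph over the kernel of
  that covector. Countably many such graphs cover all points with several minimisers, which hence have
  Hausdorff dimension at most \<open>m - 1\<close>.
\<close>

section \<open>Calculus of \<open>C\<^sup>k\<close> functions\<close>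

text \<open>The identity \<open>c x y = b (Q x) y + c x y0\<close> holds because \<open>c x\<close>
  and \<open>b (Q x)\<close> have the same differential along the connected set \<open>Y\<close> and
  \<open>b z y0 = 0\<close>. The integral of its last term does not depend on the map, so the two
  Monge problems rank maps of the form \<open>G \<circ> Q\<close> alike. Two obstacles shape the
  rest. Minimisers are only guaranteed on the compact closure of \<open>Y\<close>, while
  \<open>b\<close> is controlled on \<open>Y\<close> alone; hence their dependence on
  \<open>Q x\<close> only is carried to the closure by continuity of \<open>c\<close>, and the twist
  condition is used there. Moreover, the ambient spaces are just Hausdorff and second countable:
  compactness and countable bases do the work of a metric, in the equicontinuity of the potentials,
  in the comparison of measures and in the measurable choice of minimisers. On \<open>Z\<close>,
  measurability is read off from sets whose preimages under \<open>Q\<close> are relatively closed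
  in \<open>X\<close>. No transport plans occur: a maximiser of the dual problem yields the map
  directly.\<close>

lemma frechet_derivative_cong_open:
  assumes "open S" "x \<in> S" "\<And>y. y \<in> S \<Longrightarrow> f y = g y"
  shows "frechet_derivative f (at x) = frechet_derivative g (at x)"
proof -
  have "(f has_derivative d) (at x) \<longleftrightarrow> (g has_derivative d) (at x)" for d
    using assms has_derivative_transform_within_open[of _ d x UNIV S] by metis
  then show ?thesis
    unfolding frechet_derivative_def by simp
qed

lemma differentiable_cong_open:
  assumes "open S" "x \<in> S" "\<And>y. y \<in> S \<Longrightarrow> f y = g y" "f differentiable (at x)"
  shows "g differentiable (at x)"
  using assms has_derivative_transform_within_open[of f _ x UNIV S g]
  unfolding differentiable_def by blast

lemma Ck_on_cong:
  assumes "open S" "\<And>x. x \<in> S \<Longrightarrow> f x = g x" "Ck_on k S f"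
  shows "Ck_on k S g"
  using assms(2,3)
proof (induction k arbitrary: f g)
  case 0
  then show ?case using continuous_on_cong[of S S f g] by simp
next
  case (Suc k)
  have "Ck_on k S (\<lambda>x. frechet_derivative g (at x) v)" for v
  proof (rule Suc.IH[of "\<lambda>x. frechet_derivative f (at x) v"])
    show "frechet_derivative f (at x) v = frechet_derivative g (at x) v" if "x \<in> S" for x
      using frechet_derivative_cong_open[of S x f g] assms(1) that Suc.prems(1) by metis
    show "Ck_on k S (\<lambda>x. frechet_derivative f (at x) v)" using Suc.prems(2) by simp
  qed
  moreover have "g differentiable (at x)" if "x \<in> S" for x
    using differentiable_cong_open[of S x f g] assms(1) that Suc.prems by (metis Ck_on.simps(2))
  ultimately show ?case by simp
qed

lemma Ck_on_subset: "Ck_on k S f \<Longrightarrow> T \<subseteq> S \<Longrightarrow> Ck_on k T f"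
proof (induction k arbitrary: f)
  case 0
  then show ?case by (auto intro: continuous_on_subset)
next
  case (Suc k)
  then show ?case by (auto simp: subset_iff)
qed

lemma Ck_on_local:
  assumes "\<And>x. x \<in> S \<Longrightarrow> \<exists>T. open T \<and> x \<in> T \<and> T \<subseteq> S \<and> Ck_on k T f"
  shows "Ck_on k S f"
  using assms
proof (induction k arbitrary: f)
  case 0
  have "continuous (at x) f" if "x \<in> S" for x
    using 0[OF that] continuous_on_eq_continuous_at by (metis Ck_on.simps(1))
  then show ?case by (simp add: continuous_at_imp_continuous_on)
next
  case (Suc k)
  have "f differentiable (at x)" if "x \<in> S" for x
    using Suc.prems[OF that] by auto
  moreover have "Ck_on k S (\<lambda>x. frechet_derivative f (at x) v)" for v
  proof (rule Suc.IH)
    fix x assume "x \<in> S"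
    from Suc.prems[OF this]
    show "\<exists>T. open T \<and> x \<in> T \<and> T \<subseteq> S \<and> Ck_on k T (\<lambda>x. frechet_derivative f (at x) v)" by auto
  qed
  ultimately show ?case by auto
qed

lemma Ck_on_Suc_imp_continuous: "Ck_on k S f \<Longrightarrow> continuous_on S f"
  by (cases k) (auto intro!: continuous_at_imp_continuous_on dest: differentiable_imp_continuous_within)

lemma Ck_on_SucD: "Ck_on (Suc k) S f \<Longrightarrow> Ck_on k S f"
proof (induction k arbitrary: f)
  case 0
  then show ?case using Ck_on_Suc_imp_continuous[of "Suc 0"] by (simp del: Ck_on.simps(2))
next
  case (Suc k)
  have 1: "f differentiable (at x)" if "x \<in> S" for x
    using Suc.prems that by simp
  have "Ck_on k S (\<lambda>x. frechet_derivative f (at x) v)" for v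
  proof (rule Suc.IH)
    show "Ck_on (Suc k) S (\<lambda>x. frechet_derivative f (at x) v)"
      using Suc.prems unfolding Ck_on.simps(2)[of "Suc k"] by blast
  qed
  with 1 show ?case by simp
qed

lemma Ck_on_mono: "Ck_on k S f \<Longrightarrow> j \<le> k \<Longrightarrow> Ck_on j S f"
proof (induction k)
  case (Suc k)
  then show ?case using Ck_on_SucD[of k S f] by (cases "j = Suc k") (auto simp del: Ck_on.simps)
qed simp

text \<open>\<open>Ck_on\<close> refers to \<open>frechet_derivative\<close>; uniqueness of
  derivatives lets the calculus rules supply an explicit \<open>f'\<close> instead.\<close>

lemma Ck_on_Suc_intro:
  assumes "open S" "\<And>x. x \<in> S \<Longrightarrow> (f has_derivative f' x) (at x)" "\<And>v. Ck_on k S (\<lambda>x. f' x v)"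
  shows "Ck_on (Suc k) S f"
proof -
  have "frechet_derivative f (at x) = f' x" if "x \<in> S" for x
    using frechet_derivative_at[OF assms(2)[OF that]] by simp
  then have "Ck_on k S (\<lambda>x. frechet_derivative f (at x) v)" for v
    by (intro Ck_on_cong[OF assms(1) _ assms(3)[of v]]) simp
  with assms(2) show ?thesis
    unfolding Ck_on.simps by (auto simp: differentiable_def)
qed

lemma Ck_on_SucE:
  assumes "Ck_on (Suc k) S f"
  obtains f' where "\<And>x. x \<in> S \<Longrightarrow> (f has_derivative f' x) (at x)" "\<And>v. Ck_on k S (\<lambda>x. f' x v)"
proof (rule that)
  show "(f has_derivative frechet_derivative f (at x)) (at x)" if "x \<in> S" for x
    using assms that by (simp add: frechet_derivative_works)
  show "Ck_on k S (\<lambda>x. frechet_derivative f (at x) v)" for v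
    using assms by simp
qed

lemma Ck_on_const: "Ck_on k S (\<lambda>x. a)"
  by (induction k arbitrary: a) simp_all

lemma Ck_on_add:
  assumes "open S"
  shows "Ck_on k S f \<Longrightarrow> Ck_on k S g \<Longrightarrow> Ck_on k S (\<lambda>x. f x + g x)"
proof (induction k arbitrary: f g)
  case 0
  then show ?case by (auto intro: continuous_intros)
next
  case (Suc k)
  obtain f' where f: "\<And>x. x \<in> S \<Longrightarrow> (f has_derivative f' x) (at x)" "\<And>v. Ck_on k S (\<lambda>x. f' x v)"
    using Ck_on_SucE[OF Suc.prems(1)] by metis
  obtain g' where g: "\<And>x. x \<in> S \<Longrightarrow> (g has_derivative g' x) (at x)" "\<And>v. Ck_on k S (\<lambda>x. g' x v)"
    using Ck_on_SucE[OF Suc.prems(2)] by metis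
  show ?case
    using f g assms by (intro Ck_on_Suc_intro[where f' = "\<lambda>x v. f' x v + g' x v"])
      (auto intro!: derivative_intros Suc.IH)
qed

lemma Ck_on_sum:
  assumes "open S" "finite I" "\<And>i. i \<in> I \<Longrightarrow> Ck_on k S (f i)"
  shows "Ck_on k S (\<lambda>x. \<Sum>i\<in>I. f i x)"
  using assms(2,3) by (induction I rule: finite_induct) (simp_all add: Ck_on_const Ck_on_add[OF
    assms(1)])

lemma Ck_on_scaleR:
  assumes "open S"
  shows "Ck_on k S f \<Longrightarrow> Ck_on k S g \<Longrightarrow> Ck_on k S (\<lambda>x. f x *\<^sub>R g x)"
proof (induction k arbitrary: f g)
  case 0
  then show ?case by (auto intro: continuous_intros)
next
  case (Suc k)
  obtain f' where f: "\<And>x. x \<in> S \<Longrightarrow> (f has_derivative f' x) (at x)" "\<And>v. Ck_on k S (\<lambda>x. f' x v)"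
    using Ck_on_SucE[OF Suc.prems(1)] by metis
  obtain g' where g: "\<And>x. x \<in> S \<Longrightarrow> (g has_derivative g' x) (at x)" "\<And>v. Ck_on k S (\<lambda>x. g' x v)"
    using Ck_on_SucE[OF Suc.prems(2)] by metis
  note fk = Ck_on_SucD[OF Suc.prems(1)] Ck_on_SucD[OF Suc.prems(2)]
  show ?case
    using f g assms fk
    by (intro Ck_on_Suc_intro[where f' = "\<lambda>x v. f x *\<^sub>R g' x v + f' x v *\<^sub>R g x"])
      (auto intro!: derivative_intros Ck_on_add Suc.IH)
qed

lemma Ck_on_bounded_linear:
  assumes "open S" "bounded_linear L"
  shows "Ck_on k S f \<Longrightarrow> Ck_on k S (\<lambda>x. L (f x))"
proof (induction k arbitrary: f)
  case 0
  then show ?case using assms(2) by (simp add: bounded_linear.continuous_on)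
next
  case (Suc k)
  obtain f' where f: "\<And>x. x \<in> S \<Longrightarrow> (f has_derivative f' x) (at x)" "\<And>v. Ck_on k S (\<lambda>x. f' x v)"
    using Ck_on_SucE[OF Suc.prems(1)] by metis
  show ?case
  proof (rule Ck_on_Suc_intro[OF assms(1)])
    show "((\<lambda>x. L (f x)) has_derivative (\<lambda>v. L (f' x v))) (at x)" if "x \<in> S" for x
      by (rule bounded_linear.has_derivative[OF assms(2) f(1)[OF that]])
    show "Ck_on k S (\<lambda>x. L (f' x v))" for v by (rule Suc.IH[OF f(2)])
  qed
qed

lemma Ck_on_linear:
  assumes "open S" "bounded_linear L"
  shows "Ck_on k S L"
proof (cases k)
  case 0
  then show ?thesis using assms by (auto intro: bounded_linear.continuous_on continuous_on_id)
next
  case (Suc j)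
  show ?thesis unfolding Suc
    using assms by (intro Ck_on_Suc_intro[where f' = "\<lambda>x. L"])
      (auto intro: bounded_linear_imp_has_derivative Ck_on_const)
qed

lemma Ck_on_compose:
  fixes f :: "'e::euclidean_space \<Rightarrow> 'f::euclidean_space" and g :: "'f \<Rightarrow> 'g::real_normed_vector"
  assumes "open S" "open T" "f ` S \<subseteq> T"
  shows "Ck_on k S f \<Longrightarrow> Ck_on k T g \<Longrightarrow> Ck_on k S (g \<circ> f)"
proof (induction k arbitrary: g)
  case 0
  then show ?case using assms(3) by (auto intro!: continuous_on_compose elim: continuous_on_subset
    simp del: o_apply)
next
  case (Suc k)
  obtain f' where f: "\<And>x. x \<in> S \<Longrightarrow> (f has_derivative f' x) (at x)" "\<And>v. Ck_on k S (\<lambda>x. f' x v)"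
    using Ck_on_SucE[OF Suc.prems(1)] by metis
  obtain g' where g: "\<And>x. x \<in> T \<Longrightarrow> (g has_derivative g' x) (at x)" "\<And>v. Ck_on k T (\<lambda>x. g' x v)"
    using Ck_on_SucE[OF Suc.prems(2)] by metis
  note fk = Ck_on_SucD[OF Suc.prems(1)]
  show ?case
  proof (rule Ck_on_Suc_intro[OF assms(1)])
    fix x assume "x \<in> S"
    then show "(g \<circ> f has_derivative g' (f x) \<circ> f' x) (at x)"
      using f(1) g(1) assms(3) by (intro diff_chain_at) auto
  next
    fix v
    \<comment> \<open>The direction \<open>f' x v\<close> moves with \<open>x\<close>, whereas
      \<open>g'\<close> is known to be regular in fixed directions only. Expanding it in the basis
      leaves sums of products to which the induction hypothesis applies.\<close>
    have eq: "(\<Sum>i\<in>Basis. (f' x v \<bullet> i) *\<^sub>R g' (f x) i) = (g' (f x) \<circ> f' x) v" if "x \<in> S" for x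
    proof -
      have "f x \<in> T" using that assms(3) by auto
      then interpret bounded_linear "g' (f x)" using g(1) has_derivative_bounded_linear by blast
      have "g' (f x) (f' x v) = g' (f x) (\<Sum>i\<in>Basis. (f' x v \<bullet> i) *\<^sub>R i)"
        by (simp add: euclidean_representation)
      then show ?thesis by (simp add: sum scale)
    qed
    have "Ck_on k S (\<lambda>x. \<Sum>i\<in>Basis. (f' x v \<bullet> i) *\<^sub>R g' (f x) i)"
    proof (intro Ck_on_sum Ck_on_scaleR assms finite_Basis)
      fix i :: 'f assume "i \<in> Basis"
      show "Ck_on k S (\<lambda>x. f' x v \<bullet> i)"
        using Ck_on_bounded_linear[OF assms(1) bounded_linear_inner_left f(2)] .
      show "Ck_on k S (\<lambda>x. g' (f x) i)"
        using Suc.IH[OF fk g(2)[of i]] by (simp add: o_def)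
    qed
    then show "Ck_on k S (\<lambda>x. (g' (f x) \<circ> f' x) v)"
      by (rule Ck_on_cong[OF assms(1), of "\<lambda>x. \<Sum>i\<in>Basis. (f' x v \<bullet> i) *\<^sub>R g' (f x) i", rotated])
        (rule eq)
  qed
qed

lemma Ck_on_Pair:
  assumes "open S" "Ck_on k S f" "Ck_on k S g"
  shows "Ck_on k S (\<lambda>x. (f x, g x))"
proof -
  have "Ck_on k S (\<lambda>x. (f x, 0) + (0, g x))"
    using assms
    by (intro Ck_on_add Ck_on_bounded_linear[where L = "\<lambda>x. (x, 0)"]
        Ck_on_bounded_linear[where L = "\<lambda>x. (0, x)"])
      (auto intro: bounded_linear_Pair bounded_linear_ident bounded_linear_zero)
  then show ?thesis by simp
qed

lemma Ck_on_map_prod: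
  fixes f :: "'e::euclidean_space \<Rightarrow> 'e2::euclidean_space"
    and g :: "'f::euclidean_space \<Rightarrow> 'f2::euclidean_space"
  assumes "open S" "open T" "Ck_on k S f" "Ck_on k T g"
  shows "Ck_on k (S \<times> T) (map_prod f g)"
proof -
  have o: "open (S \<times> T)" using assms open_Times by blast
  have "Ck_on k (S \<times> T) (f \<circ> fst)"
    by (rule Ck_on_compose[OF o assms(1) _ Ck_on_linear[OF o bounded_linear_fst] assms(3)]) auto
  moreover have "Ck_on k (S \<times> T) (g \<circ> snd)"
    by (rule Ck_on_compose[OF o assms(2) _ Ck_on_linear[OF o bounded_linear_snd] assms(4)]) auto
  ultimately have "Ck_on k (S \<times> T) (\<lambda>x. ((f \<circ> fst) x, (g \<circ> snd) x))"
    by (rule Ck_on_Pair[OF o])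
  then show ?thesis by (simp add: map_prod_def case_prod_unfold o_def)
qed

text \<open>Plain differentiability compares a moving point with \<open>x\<close>; here both points
  move. The mean value inequality for \<open>f\<close> minus its linearisation at \<open>x\<close>
  gives the estimate.\<close>

lemma C1_strictly_differentiable:
  fixes f :: "'e::euclidean_space \<Rightarrow> 'g::real_normed_vector"
  assumes "open S" "Ck_on (Suc 0) S f" "x \<in> S"
  obtains f' where "(f has_derivative f') (at x)"
    "\<And>\<epsilon>. \<epsilon> > 0 \<Longrightarrow> \<exists>r>0. ball x r \<subseteq> S \<and> (\<forall>y\<in>ball x r. \<forall>z\<in>ball x r. norm (f z - f y - f' (z - y)) \<le> \<epsilon> *
      norm (z - y))"
proof -
  obtain f' where f: "\<And>x. x \<in> S \<Longrightarrow> (f has_derivative f' x) (at x)" "\<And>v. continuous_on S (\<lambda>x. f' x v)"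
    by (rule Ck_on_SucE[OF assms(2)]) (simp only: Ck_on.simps, rule that)
  have "\<exists>r>0. ball x r \<subseteq> S \<and> (\<forall>y\<in>ball x r. \<forall>z\<in>ball x r. norm (f z - f y - f' x (z - y)) \<le> \<epsilon> * norm
    (z - y))"
    if "\<epsilon> > 0" for \<epsilon>
  proof -
    \<comment> \<open>\<open>Ck_on\<close> gives continuity of \<open>f' y v\<close> for each fixed
      \<open>v\<close> only. Closeness within \<open>e\<close> on all basis vectors bounds the
      operator norm of the difference by the dimension times \<open>e\<close>, which is
      \<open>\<epsilon>\<close>.\<close>
    define e where "e = \<epsilon> / real (DIM('e))"
    have e: "e > 0" using that by (simp add: e_def)
    have "eventually (\<lambda>y. y \<in> S \<and> (\<forall>i\<in>Basis. dist (f' y i) (f' x i) < e)) (nhds x)"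
    proof (intro eventually_conj eventually_ball_finite finite_Basis ballI)
      show "eventually (\<lambda>y. y \<in> S) (nhds x)" using assms eventually_nhds by blast
      fix i :: 'e
      have "continuous (at x) (\<lambda>x. f' x i)" using f(2) assms continuous_on_eq_continuous_at by blast
      then have "((\<lambda>x. f' x i) \<longlongrightarrow> f' x i) (nhds x)"
        unfolding continuous_at using tendsto_at_iff_tendsto_nhds[of "\<lambda>x. f' x i" x] by blast
      then show "eventually (\<lambda>y. dist (f' y i) (f' x i) < e) (nhds x)" using e tendstoD by blast
    qed
    then obtain r where r: "r > 0" "\<And>y. dist y x < r \<Longrightarrow> y \<in> S \<and> (\<forall>i\<in>Basis. dist (f' y i) (f' x i) < e)"
      unfolding eventually_nhds_metric by blast
    have bl: "bounded_linear (f' y)" if "y \<in> S" for y using f(1)[OF that]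
      has_derivative_bounded_linear by blast
    have on: "onorm (\<lambda>v. f' y v - f' x v) \<le> \<epsilon>" if y: "dist y x < r" for y
    proof (rule onorm_bound)
      fix v
      interpret D: bounded_linear "\<lambda>v. f' y v - f' x v"
        using bl r(2)[OF y] assms(3) by (intro bounded_linear_sub) auto
      have "norm (f' y v - f' x v) = norm (f' y (\<Sum>i\<in>Basis. (v \<bullet> i) *\<^sub>R i) - f' x (\<Sum>i\<in>Basis. (v \<bullet> i)
        *\<^sub>R i))"
        by (simp add: euclidean_representation)
      also have "\<dots> = norm (\<Sum>i\<in>Basis. (v \<bullet> i) *\<^sub>R (f' y i - f' x i))"
        by (subst D.sum) (simp add: D.scale[symmetric] del: D.scale)
      also have "\<dots> \<le> (\<Sum>i\<in>Basis. norm ((v \<bullet> i) *\<^sub>R (f' y i - f' x i)))" by (rule norm_sum)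
      also have "\<dots> \<le> (\<Sum>i\<in>(Basis::'e set). norm v * e)"
      proof (rule sum_mono)
        fix i :: 'e assume "i \<in> Basis"
        moreover from this have "norm (f' y i - f' x i) \<le> e"
          using r(2)[OF y] by (auto simp: dist_norm intro: less_imp_le)
        ultimately show "norm ((v \<bullet> i) *\<^sub>R (f' y i - f' x i)) \<le> norm v * e"
          by (auto simp: Basis_le_norm intro!: mult_mono)
      qed
      also have "\<dots> = \<epsilon> * norm v" by (simp add: e_def)
      finally show "norm (f' y v - f' x v) \<le> \<epsilon> * norm v" .
    qed (use \<open>\<epsilon> > 0\<close> in simp)
    show ?thesis
    proof (intro exI[of _ r] conjI ballI r(1))
      show "ball x r \<subseteq> S" using r(2) by (auto simp: dist_commute)
      fix y z assume yz: "y \<in> ball x r" "z \<in> ball x r"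
      have lx: "bounded_linear (f' x)" using bl assms(3) by blast
      have "norm ((f z - f' x z) - (f y - f' x y)) \<le> \<epsilon> * norm (z - y)"
      proof (rule differentiable_bound[of "ball x r" _ "\<lambda>y v. f' y v - f' x v"])
        fix w assume "w \<in> ball x r"
        then have w: "dist w x < r" by (simp add: dist_commute)
        show "((\<lambda>y. f y - f' x y) has_derivative (\<lambda>v. f' w v - f' x v)) (at w within ball x r)"
        proof (rule has_derivative_diff; rule has_derivative_at_withinI)
          show "(f has_derivative f' w) (at w)" by (rule f(1)[OF conjunct1[OF r(2)[OF w]]])
          show "(f' x has_derivative f' x) (at w)" using lx by (rule bounded_linear_imp_has_derivative)
        qed
        show "onorm (\<lambda>v. f' w v - f' x v) \<le> \<epsilon>" using on[OF w] .
      qed (use yz in simp_all)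
      moreover have "f' x (z - y) = f' x z - f' x y"
        using linear_diff[OF bounded_linear.linear[OF lx]] .
      moreover have "f z - f y - (f' x z - f' x y) = (f z - f' x z) - (f y - f' x y)" by simp
      ultimately show "norm (f z - f y - f' x (z - y)) \<le> \<epsilon> * norm (z - y)" by (simp only:)
    qed
  qed
  then show ?thesis by (rule that[OF f(1)[OF assms(3)]])
qed


section \<open>Hausdorff null sets\<close>

lemma hausdorff_null_iff_covers:
  "hausdorff_measure s P = 0 \<longleftrightarrow>
    (\<forall>\<delta>>0. \<forall>\<epsilon>>0. \<exists>U :: nat \<Rightarrow> 'e::metric_space set. P \<subseteq> (\<Union>i. U i) \<and>
      (\<forall>i. bounded (U i) \<and> diameter (U i) \<le> \<delta>) \<and> (\<Sum>i. ennreal (diameter (U i) powr s)) \<le> ennreal \<epsilon>)"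
  (is "?L \<longleftrightarrow> ?R")
proof
  assume ?L
  show ?R
  proof (intro allI impI)
    fix \<delta> \<epsilon> :: real assume "\<delta> > 0" "\<epsilon> > 0"
    have "hausdorff_premeasure \<delta> s P \<le> hausdorff_measure s P"
      unfolding hausdorff_measure_def using \<open>\<delta> > 0\<close> by (intro SUP_upper) auto
    then have "hausdorff_premeasure \<delta> s P < ennreal \<epsilon>" using \<open>?L\<close> \<open>\<epsilon> > 0\<close> by simp
    then show "\<exists>U :: nat \<Rightarrow> 'e set. P \<subseteq> (\<Union>i. U i) \<and> (\<forall>i. bounded (U i) \<and> diameter (U i) \<le> \<delta>) \<and>
        (\<Sum>i. ennreal (diameter (U i) powr s)) \<le> ennreal \<epsilon>"
      unfolding hausdorff_premeasure_def by (auto simp: INF_less_iff intro: less_imp_le)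
  qed
next
  assume R: ?R
  have "hausdorff_premeasure \<delta> s P \<le> 0" if "\<delta> > 0" for \<delta>
  proof (rule ennreal_le_epsilon)
    fix \<epsilon> :: real assume "\<epsilon> > 0"
    with R \<open>\<delta> > 0\<close> obtain U :: "nat \<Rightarrow> 'e set" where "P \<subseteq> (\<Union>i. U i)"
      "\<forall>i. bounded (U i) \<and> diameter (U i) \<le> \<delta>" "(\<Sum>i. ennreal (diameter (U i) powr s)) \<le> ennreal \<epsilon>"
      by blast
    then show "hausdorff_premeasure \<delta> s P \<le> 0 + ennreal \<epsilon>"
      unfolding hausdorff_premeasure_def by (intro INF_lower2[of U]) auto
  qed
  then show ?L unfolding hausdorff_measure_def by (auto intro!: antisym SUP_least)
qed

lemma hausdorff_null_countable_UN:
  fixes P :: "nat \<Rightarrow> 'e::metric_space set"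
  assumes "\<And>n. hausdorff_measure s (P n) = 0" "Q \<subseteq> (\<Union>n. P n)"
  shows "hausdorff_measure s Q = 0"
  unfolding hausdorff_null_iff_covers
proof (intro allI impI)
  fix \<delta> \<epsilon> :: real assume de: "\<delta> > 0" "\<epsilon> > 0"
  have "\<exists>U :: nat \<Rightarrow> 'e set. P n \<subseteq> (\<Union>i. U i) \<and> (\<forall>i. bounded (U i) \<and> diameter (U i) \<le> \<delta>) \<and>
        (\<Sum>i. ennreal (diameter (U i) powr s)) \<le> ennreal (\<epsilon> * (1/2) ^ Suc n)" for n
  proof -
    have "\<epsilon> * (1/2) ^ Suc n > 0" using de by simp
    with de(1) assms(1)[of n] show ?thesis unfolding hausdorff_null_iff_covers by blast
  qed
  then obtain U :: "nat \<Rightarrow> nat \<Rightarrow> 'e set" where U: "\<And>n. P n \<subseteq> (\<Union>i. U n i)"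
    "\<And>n i. bounded (U n i)" "\<And>n i. diameter (U n i) \<le> \<delta>"
    "\<And>n. (\<Sum>i. ennreal (diameter (U n i) powr s)) \<le> ennreal (\<epsilon> * (1/2) ^ Suc n)"
    by metis
  \<comment> \<open>The covers of all \<open>P n\<close> are merged into one sequence; their budgets
    \<open>\<epsilon> * (1/2) ^ Suc n\<close> add up to \<open>\<epsilon>\<close>.\<close>
  define W where "W = (\<lambda>k. case_prod U (prod_decode k))"
  show "\<exists>U :: nat \<Rightarrow> 'e set. Q \<subseteq> (\<Union>i. U i) \<and> (\<forall>i. bounded (U i) \<and> diameter (U i) \<le> \<delta>) \<and>
        (\<Sum>i. ennreal (diameter (U i) powr s)) \<le> ennreal \<epsilon>"
  proof (intro exI[of _ W] conjI allI)
    show "Q \<subseteq> (\<Union>i. W i)"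
    proof
      fix x assume "x \<in> Q"
      then obtain n i where "x \<in> U n i" using assms(2) U(1) by blast
      then have "x \<in> W (prod_encode (n, i))" by (simp add: W_def)
      then show "x \<in> (\<Union>i. W i)" by blast
    qed
    show "bounded (W k)" "diameter (W k) \<le> \<delta>" for k
      using U by (auto simp: W_def split: prod.split)
    have "(\<Sum>k. ennreal (diameter (W k) powr s)) =
        (\<Sum>k. (\<lambda>(n, i). ennreal (diameter (U n i) powr s)) (prod_decode k))"
      by (simp add: W_def case_prod_unfold)
    also have "\<dots> = (\<Sum>n. \<Sum>i. ennreal (diameter (U n i) powr s))"
      by (rule suminf_ennreal_2dimen) simp
    also have "\<dots> \<le> (\<Sum>n. ennreal (\<epsilon> * (1/2) ^ Suc n))"
      by (intro suminf_le U(4) allI summableI)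
    also have "\<dots> = ennreal \<epsilon>"
      using de sums_mult[OF power_half_series, of \<epsilon>]
      by (intro suminf_ennreal_eq) auto
    finally show "(\<Sum>k. ennreal (diameter (W k) powr s)) \<le> ennreal \<epsilon>" .
  qed
qed

lemma floor_mult_eq_imp_dist_le:
  fixes a b :: real
  assumes "floor (a * k) = floor (b * k)" "k > 0"
  shows "\<bar>a - b\<bar> \<le> 1 / k"
proof -
  have "\<bar>a * k - b * k\<bar> \<le> 1" using assms(1) by linarith
  moreover have "\<bar>a * k - b * k\<bar> = \<bar>a - b\<bar> * k"
    using assms(2) by (simp add: left_diff_distrib[symmetric] abs_mult)
  ultimately show ?thesis using assms(2) by (simp add: field_simps)
qed

text \<open>On \<open>P\<close> the map \<open>f\<close> has a Lipschitz inverse. Cutting the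
  bounded part of \<open>H\<close> into cubes of side \<open>1 / k\<close> gives of the order of
  \<open>k ^ dim H\<close> pieces whose preimages have diameter of order \<open>1 / k\<close>. The
  sum of the powers with exponent \<open>s\<close> is then of order
  \<open>k powr (dim H - s)\<close>, which tends to 0.\<close>

lemma hausdorff_null_of_expanding_into_subspace:
  fixes P :: "'e::metric_space set" and f :: "'e \<Rightarrow> 'g::euclidean_space"
  assumes H: "subspace H" "f ` P \<subseteq> H" and bdd: "bounded (f ` P)"
    and exp: "\<And>p q. p \<in> P \<Longrightarrow> q \<in> P \<Longrightarrow> dist p q \<le> C * norm (f p - f q)"
    and s: "real (dim H) < s"
  shows "hausdorff_measure s P = 0"
  unfolding hausdorff_null_iff_covers
proof (intro allI impI)
  fix \<delta> \<epsilon> :: real assume de: "\<delta> > 0" "\<epsilon> > 0"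
  obtain B where B: "B \<subseteq> H" "pairwise orthogonal B" "\<And>x. x \<in> B \<Longrightarrow> norm x = 1"
     "independent B" "card B = dim H" "span B = H"
    using orthonormal_basis_subspace[OF H(1)] by metis
  have fB: "finite B" using B(4) independent_imp_finite by blast
  define d where "d = dim H"
  have s0: "s > 0" using s by linarith
  \<comment> \<open>Points of one cube differ by at most \<open>1 / k\<close> in each of
    \<open>d\<close> orthonormal coordinates, so their preimages lie within \<open>D / k\<close> of
    each other. The absolute value allows for a negative \<open>C\<close>.\<close>
  define D where "D = \<bar>C\<bar> * (real d + 1)"
  have D0: "D \<ge> 0" by (simp add: D_def)
  obtain R0 where R0: "\<And>p. p \<in> P \<Longrightarrow> norm (f p) \<le> R0" using bdd unfolding bounded_iff by auto
  define R where "R = nat \<lceil>\<bar>R0\<bar>\<rceil> + 1"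
  have R: "norm (f p) \<le> real R" if "p \<in> P" for p
    using R0[OF that] unfolding R_def by linarith
  have lim: "(\<lambda>n. real (2 * R + 1) ^ d * (D powr s) * real (Suc n) powr (real d - s)) \<longlonglongrightarrow> 0"
    using s by (intro tendsto_mult_right_zero tendsto_neg_powr filterlim_compose[OF
      filterlim_real_sequentially filterlim_Suc]) (simp add: d_def)
  have lim2: "(\<lambda>n. D * inverse (real (Suc n))) \<longlonglongrightarrow> 0"
    using tendsto_mult_right_zero[OF LIMSEQ_inverse_real_of_nat] .
  have "eventually (\<lambda>n. real (2 * R + 1) ^ d * (D powr s) * real (Suc n) powr (real d - s) < \<epsilon> \<and>
    D * inverse (real (Suc n)) < \<delta>) sequentially"
    using order_tendstoD(2)[OF lim de(2)] order_tendstoD(2)[OF lim2 de(1)] by eventually_elim simp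
  then obtain n where n: "real (2 * R + 1) ^ d * (D powr s) * real (Suc n) powr (real d - s) < \<epsilon>" "D
    * inverse (real (Suc n)) < \<delta>"
    unfolding eventually_sequentially by blast
  define k where "k = real (Suc n)"
  have k: "k \<ge> 1" by (simp add: k_def)
  \<comment> \<open>\<open>code p\<close> is the index of the cube containing \<open>f p\<close>.
    Since \<open>norm (f p) \<le> R\<close>, each coordinate of the index lies in \<open>I\<close>,
    which has \<open>2 * R * Suc n + 1\<close> elements.\<close>
  define code where "code p = (\<lambda>b\<in>B. floor ((f p \<bullet> b) * k))" for p
  define I where "I = {- (int R * int (Suc n)) .. int R * int (Suc n)}"
  define E where "E = PiE B (\<lambda>_. I)"
  have fE: "finite E" unfolding E_def I_def by (intro finite_PiE fB) auto
  have cardE: "card E = nat (2 * (int R * int (Suc n)) + 1) ^ d"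
    unfolding E_def I_def by (simp add: card_PiE fB B(5) d_def)
  have codeE: "code p \<in> E" if "p \<in> P" for p
    unfolding E_def code_def
  proof (rule restrict_PiE_iff[THEN iffD2], intro ballI)
    fix b assume "b \<in> B"
    have "\<bar>f p \<bullet> b\<bar> \<le> norm (f p) * norm b" by (rule Cauchy_Schwarz_ineq2)
    also have "\<dots> \<le> real R" using R[OF that] B(3)[OF \<open>b \<in> B\<close>] by simp
    finally have "\<bar>(f p \<bullet> b) * k\<bar> \<le> real R * k" using k by (simp add: abs_mult mult_right_mono)
    moreover have "real R * k = of_int (int R * int (Suc n))" by (simp add: k_def)
    ultimately show "\<lfloor>f p \<bullet> b * k\<rfloor> \<in> I" unfolding I_def by (auto simp: le_floor_iff floor_le_iff
      abs_le_iff)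
  qed
  have close: "dist p q \<le> D / k" if "p \<in> P" "q \<in> P" "code p = code q" for p q
  proof -
    have fpq: "f p - f q \<in> span B" using H that B(6) by (auto intro: subspace_diff)
    have "f p - f q = (\<Sum>b\<in>B. ((f p - f q) \<bullet> b) *\<^sub>R b)"
    proof -
      obtain u where u: "f p - f q = (\<Sum>b\<in>B. u b *\<^sub>R b)" using fpq fB span_finite by fastforce
      have "(f p - f q) \<bullet> b = u b" if "b \<in> B" for b
      proof -
        have "(f p - f q) \<bullet> b = (\<Sum>b'\<in>B. u b' * (b' \<bullet> b))" unfolding u by (simp add: inner_sum_left)
        also have "\<dots> = (\<Sum>b'\<in>B. if b' = b then u b else 0)"
          using B(2,3) that by (intro sum.cong) (auto simp: pairwise_def orthogonal_def norm_eq_1)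
        also have "\<dots> = u b" using fB that by simp
        finally show ?thesis .
      qed
      then show ?thesis using u by simp
    qed
    then have "norm (f p - f q) \<le> (\<Sum>b\<in>B. norm (((f p - f q) \<bullet> b) *\<^sub>R b))" by (metis norm_sum)
    also have "\<dots> \<le> (\<Sum>b\<in>B. 1 / k)"
    proof (rule sum_mono)
      fix b assume b: "b \<in> B"
      have "\<lfloor>f p \<bullet> b * k\<rfloor> = \<lfloor>f q \<bullet> b * k\<rfloor>"
        using fun_cong[OF that(3), of b] b by (simp add: code_def)
      from floor_mult_eq_imp_dist_le[OF this] k
      show "norm (((f p - f q) \<bullet> b) *\<^sub>R b) \<le> 1 / k" using B(3)[OF b] by (simp add: inner_diff_left)
    qed
    also have "\<dots> \<le> (real d + 1) / k" using k by (simp add: B(5) d_def divide_right_mono)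
    finally have "\<bar>C\<bar> * norm (f p - f q) \<le> \<bar>C\<bar> * ((real d + 1) / k)" by (rule mult_left_mono) simp
    moreover have "C * norm (f p - f q) \<le> \<bar>C\<bar> * norm (f p - f q)" by (simp add: mult_right_mono)
    ultimately show ?thesis using exp[OF that(1,2)] by (simp add: D_def)
  qed
  obtain h where h: "bij_betw h {..<card E} E" using ex_bij_betw_nat_finite[OF fE]
    by (metis atLeast0LessThan)
  \<comment> \<open>Beyond the number of cubes the cover continues with empty sets; they contribute
    nothing, since their diameter is 0 and \<open>0 powr s = 0\<close>.\<close>
  define U where "U i = (if i < card E then {p\<in>P. code p = h i} else {})" for i
  have Uk: "diameter (U i) \<le> D / k \<and> bounded (U i)" for i
  proof
    show "diameter (U i) \<le> D / k"
      using D0 k close unfolding diameter_def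
      by (auto simp: U_def divide_nonneg_nonneg intro!: cSUP_least split: if_splits)
    show "bounded (U i)"
    proof (cases "U i = {}")
      case False
      then obtain p where "p \<in> U i" by blast
      then have "U i \<subseteq> cball p (D / k)" using close by (auto simp: U_def split: if_splits)
      then show ?thesis using bounded_cball bounded_subset by blast
    qed simp
  qed
  show "\<exists>U :: nat \<Rightarrow> 'e set. P \<subseteq> (\<Union>i. U i) \<and> (\<forall>i. bounded (U i) \<and> diameter (U i) \<le> \<delta>) \<and>
        (\<Sum>i. ennreal (diameter (U i) powr s)) \<le> ennreal \<epsilon>"
  proof (intro exI[of _ U] conjI allI)
    show "P \<subseteq> (\<Union>i. U i)"
    proof
      fix p assume p: "p \<in> P"
      then obtain i where "i < card E" "h i = code p" using bij_betw_imp_surj_on[OF h] codeE[OF p]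
        by (metis imageE lessThan_iff)
      then have "p \<in> U i" using p by (simp add: U_def)
      then show "p \<in> (\<Union>i. U i)" by blast
    qed
    show "bounded (U i)" for i using Uk by blast
    show "diameter (U i) \<le> \<delta>" for i
      using Uk[of i] n(2) by (simp add: k_def divide_inverse)
    have diam: "diameter (U i) powr s \<le> (D / k) powr s" for i
      using Uk[of i] s0 diameter_ge_0[of "U i"] by (intro powr_mono2) auto
    have "(\<Sum>i. ennreal (diameter (U i) powr s)) = (\<Sum>i<card E. ennreal (diameter (U i) powr s))"
      by (intro suminf_finite) (auto simp: U_def diameter_def)
    also have "\<dots> \<le> (\<Sum>i<card E. ennreal ((D / k) powr s))"
      using diam by (intro sum_mono ennreal_leI)
    also have "\<dots> = ennreal (real (card E) * (D / k) powr s)"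
      by (simp add: ennreal_mult ennreal_of_nat_eq_real_of_nat)
    also have "\<dots> \<le> ennreal \<epsilon>"
    proof (rule ennreal_leI)
      \<comment> \<open>Because \<open>k \<ge> 1\<close>, the additional index is absorbed:
        \<open>2 * R * k + 1 \<le> (2 * R + 1) * k\<close>.\<close>
      have "real (nat (2 * (int R * int (Suc n)) + 1)) \<le> real (2 * R + 1) * k"
        using k by (simp add: k_def algebra_simps)
      then have "real (card E) \<le> (real (2 * R + 1) * k) ^ d"
        unfolding cardE of_nat_power by (intro power_mono) auto
      then have "real (card E) * (D / k) powr s \<le> (real (2 * R + 1) * k) ^ d * (D / k) powr s"
        by (intro mult_right_mono) auto
      also have "\<dots> = real (2 * R + 1) ^ d * D powr s * (k powr real d * k powr (- s))"
      proof -
        have "(D / k) powr s = D powr s * k powr (- s)"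
          using k D0 by (simp add: powr_divide powr_minus_divide)
        moreover have "k ^ d = k powr real d" using k by (simp add: powr_realpow)
        ultimately show ?thesis by (simp add: power_mult_distrib)
      qed
      also have "\<dots> = real (2 * R + 1) ^ d * (D powr s) * real (Suc n) powr (real d - s)"
        by (simp add: powr_add[symmetric] k_def)
      finally show "real (card E) * (D / k) powr s \<le> \<epsilon>" using n(1) by linarith
    qed
    finally show "(\<Sum>i. ennreal (diameter (U i) powr s)) \<le> ennreal \<epsilon>" .
  qed
qed

text \<open>The condition \<open>d \<ge> 0\<close> keeps every exponent above \<open>d\<close> in
  the positive range over which \<open>hausdorff_dim\<close> takes its infimum.\<close>

lemma hausdorff_dim_leI:
  assumes "d \<ge> 0" "\<And>s. s > d \<Longrightarrow> hausdorff_measure s P = 0"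
  shows "hausdorff_dim P \<le> ereal d"
proof (rule ereal_le_epsilon2)
  fix e :: real assume "e > 0"
  then show "hausdorff_dim P \<le> ereal d + ereal e"
    using assms unfolding hausdorff_dim_def by (intro INF_lower2[of "d + e"]) auto
qed


section \<open>Measurable selection and Borel measures in compact Hausdorff spaces\<close>

lemma compact_point_separation:
  fixes C :: "'b::t2_space set"
  assumes "compact C" "y \<notin> C"
  obtains U W where "open U" "open W" "y \<in> U" "C \<subseteq> W" "U \<inter> W = {}"
proof -
  have "\<forall>z\<in>C. \<exists>U W. open U \<and> open W \<and> y \<in> U \<and> z \<in> W \<and> U \<inter> W = {}"
    using assms(2) hausdorff by metis
  then obtain U W where UW: "\<And>z. z \<in> C \<Longrightarrow> open (U z) \<and> open (W z) \<and> y \<in> U z \<and> z \<in> W z \<and> U z \<inter> W z = {}"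
    by metis
  obtain D where D: "D \<subseteq> C" "finite D" "C \<subseteq> (\<Union>z\<in>D. W z)"
    using compactE_image[OF assms(1), of C W] UW by blast
  show ?thesis
  proof (rule that)
    show "open (\<Inter>z\<in>D. U z)" "open (\<Union>z\<in>D. W z)" using D UW by auto
    show "y \<in> (\<Inter>z\<in>D. U z)" "C \<subseteq> (\<Union>z\<in>D. W z)" "(\<Inter>z\<in>D. U z) \<inter> (\<Union>z\<in>D. W z) = {}"
      using D UW by blast+
  qed
qed

text \<open>A Hausdorff type need not be regular, but a point can be separated from a compact set by
  open sets. The basic neighbourhoods obtained here play the part of small closed balls.\<close>

lemma basis_closure_avoids_compact:
  fixes C :: "'b::t2_space set"
  assumes "topological_basis \<B>" "compact C" "y \<notin> C"
  obtains V where "V \<in> \<B>" "y \<in> V" "closure V \<inter> C = {}"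
proof -
  obtain U W where UW: "open U" "open W" "y \<in> U" "C \<subseteq> W" "U \<inter> W = {}"
    using compact_point_separation[OF assms(2,3)] by metis
  obtain V where V: "V \<in> \<B>" "y \<in> V" "V \<subseteq> U"
    using topological_basisE[OF assms(1) UW(1,3)] by metis
  have "closure V \<inter> W = {}" using UW V open_Int_closure_eq_empty[of W V] by blast
  then show ?thesis using V UW that by blast
qed

text \<open>A nonempty \<open>A z\<close> has two points exactly when it meets two basic closures
  that are disjoint within \<open>K\<close>. There are countably many such pairs, so the uniqueness
  set is built from countably many hit sets of closed sets.\<close>

lemma
  fixes A :: "'z \<Rightarrow> 'b::{t2_space, second_countable_topology} set"
  assumes K: "compact K" and AK: "\<And>z. z \<in> space N \<Longrightarrow> A z \<subseteq> K"
    and hit: "\<And>C. closed C \<Longrightarrow> {z\<in>space N. A z \<inter> C \<noteq> {}} \<in> sets N"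
  shows sets_unique_of_hit_sets: "{z\<in>space N. \<exists>!y. y \<in> A z} \<in> sets N"
    and measurable_selection_of_hit_sets:
      "(\<lambda>z. if \<exists>!y. y \<in> A z then THE y. y \<in> A z else y0) \<in> borel_measurable N"
proof -
  obtain \<B> :: "'b set set" where B: "countable \<B>" "topological_basis \<B>"
    using ex_countable_basis by blast
  define H where "H C = {z\<in>space N. A z \<inter> C \<noteq> {}}" for C
  define P where "P = {(V, W) \<in> \<B> \<times> \<B>. closure V \<inter> closure W \<inter> K = {}}"
  have "countable P" unfolding P_def by (rule countable_subset[of _ "\<B> \<times> \<B>"]) (use B in auto)
  have eq: "{z\<in>space N. \<exists>!y. y \<in> A z} = H UNIV - (\<Union>(V, W)\<in>P. H (closure V) \<inter> H (closure W))"
    (is "?L = ?R")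
  proof (intro set_eqI iffI)
    fix z assume z: "z \<in> ?L"
    then obtain y where y: "A z = {y}" by blast
    have "y \<in> K" using AK z y by blast
    with z y show "z \<in> ?R" unfolding H_def P_def by auto
  next
    fix z assume z: "z \<in> ?R"
    then obtain y where y: "y \<in> A z" "z \<in> space N" unfolding H_def by blast
    have "y' = y" if y': "y' \<in> A z" for y'
    proof (rule ccontr)
      assume "y' \<noteq> y"
      then obtain V where V: "V \<in> \<B>" "y' \<in> V" "closure V \<inter> {y} = {}"
        using basis_closure_avoids_compact[OF B(2) compact_sing, of y' y] by (metis singletonD)
      have "compact (closure V \<inter> K)" using K by (simp add: Int_commute compact_Int_closed)
      then obtain W where W: "W \<in> \<B>" "y \<in> W" "closure W \<inter> (closure V \<inter> K) = {}"
        using V basis_closure_avoids_compact[OF B(2), of "closure V \<inter> K" y]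
          by (metis IntD1 disjoint_insert(1) insertI1)
      have "y' \<in> closure V" "y \<in> closure W" using V W closure_subset by blast+
      then have "z \<in> H (closure V) \<inter> H (closure W)" "(V, W) \<in> P"
        using V W y y' unfolding H_def P_def by auto
      with z show False by blast
    qed
    with y show "z \<in> ?L" by blast
  qed
  have HN: "H C \<in> sets N" if "closed C" for C using hit[OF that] unfolding H_def .
  show S: "{z\<in>space N. \<exists>!y. y \<in> A z} \<in> sets N"
    unfolding eq case_prod_unfold using \<open>countable P\<close> HN
    by (intro sets.Diff sets.countable_UN' sets.Int) auto
  let ?T = "\<lambda>z. if \<exists>!y. y \<in> A z then THE y. y \<in> A z else y0"
  show "?T \<in> borel_measurable N"
  proof (rule borel_measurableI)
    fix U :: "'b set" assume "open U"
    \<comment> \<open>Where the point is unique, it lies in \<open>U\<close> iff \<open>A z\<close>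
      misses the closed complement of \<open>U\<close>; this reduces preimages of open sets to hit
      sets.\<close>
    have the: "(THE y. y \<in> A z) \<in> U \<longleftrightarrow> A z \<inter> - U = {}" if "\<exists>!y. y \<in> A z" for z
      using theI'[OF that] that by blast
    have "?T -` U \<inter> space N = ({z\<in>space N. \<exists>!y. y \<in> A z} - H (- U)) \<union>
        (if y0 \<in> U then space N - {z\<in>space N. \<exists>!y. y \<in> A z} else {})"
      unfolding H_def using the by (auto split: if_splits)
    also have "\<dots> \<in> sets N" using S HN[of "- U"] \<open>open U\<close> by (auto simp: closed_Compl)
    finally show "?T -` U \<inter> space N \<in> sets N" .
  qed
qed

text \<open>Complements reverse the inequality on open sets. Conversely, within \<open>K\<close> an
  open set is a countable union of closed sets, so continuity from below carries the inequality on
  closed sets over to it. Both measures then agree on the open sets, which generate.\<close>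

lemma measure_eq_of_closed_le:
  fixes P R :: "'b::{t2_space, second_countable_topology} measure"
  assumes "prob_space P" "prob_space R" and sP: "sets P = sets borel" and sR: "sets R = sets borel"
    and K: "compact K" "measure P K = 1" "measure R K = 1"
    and le: "\<And>C. closed C \<Longrightarrow> measure P C \<le> measure R C"
  shows "P = R"
proof -
  interpret P: prob_space P by fact
  interpret R: prob_space R by fact
  have spP: "space P = UNIV" using sets_eq_imp_space_eq[OF sP] by simp
  have spR: "space R = UNIV" using sets_eq_imp_space_eq[OF sR] by simp
  have open_ge: "measure R U \<le> measure P U" if "open U" for U
    using le[of "- U"] P.prob_compl[of U] R.prob_compl[of U] that sP sR spP spR
    by (simp add: Compl_eq_Diff_UNIV[symmetric] closed_Compl)
  have open_le: "measure P U \<le> measure R U" if "open U" for U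
  proof -
    obtain \<B> :: "'b set set" where B: "countable \<B>" "topological_basis \<B>"
      using ex_countable_basis by blast
    \<comment> \<open>Up to the complement of \<open>K\<close>, which is null for both measures,
      \<open>U\<close> is the union of the countable family \<open>D\<close>: a point of
      \<open>U \<inter> K\<close> has a basic neighbourhood whose closure avoids the compact set
      \<open>K - U\<close>. The empty set is added so that \<open>D\<close> can be
      enumerated.\<close>
    define D where "D = insert {} {closure V |V. V \<in> \<B> \<and> closure V \<inter> K \<subseteq> U}"
    have "D \<subseteq> insert {} (closure ` \<B>)" unfolding D_def by blast
    then have cD: "countable D" using B(1) by (meson countable_image countable_insert countable_subset)
    have neD: "D \<noteq> {}" unfolding D_def by blast
    define E where "E n = (\<Union>i\<le>n. from_nat_into D i)" for n :: nat
    have clD: "closed S \<and> S \<inter> K \<subseteq> U" if "S \<in> D" for S using that unfolding D_def by auto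
    have clE: "closed (E n)" for n unfolding E_def using clD from_nat_into[OF neD] by auto
    have incE: "incseq E" unfolding E_def incseq_def by force
    have UE: "(\<Union>n. E n) = \<Union>D"
    proof -
      have "(\<Union>n. E n) = \<Union>(range (from_nat_into D))" unfolding E_def by auto
      then show ?thesis using range_from_nat_into[OF neD cD] by simp
    qed
    have UD: "\<Union>D \<inter> K = U \<inter> K"
    proof
      show "\<Union>D \<inter> K \<subseteq> U \<inter> K" using clD by blast
      show "U \<inter> K \<subseteq> \<Union>D \<inter> K"
      proof
        fix y assume y: "y \<in> U \<inter> K"
        have "compact (K - U)" using K(1) that by (simp add: compact_diff)
        then obtain V where V: "V \<in> \<B>" "y \<in> V" "closure V \<inter> (K - U) = {}"
          using y basis_closure_avoids_compact[OF B(2), of "K - U" y] by (metis DiffD2 IntD1)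
        then have "closure V \<in> D" unfolding D_def by blast
        then show "y \<in> \<Union>D \<inter> K" using V y closure_subset by blast
      qed
    qed
    have Kb: "K \<in> sets borel" by (rule borel_closed[OF compact_imp_closed[OF K(1)]])
    have Db: "\<Union>D \<in> sets borel" unfolding UE[symmetric]
      by (rule sets.countable_UN) (auto intro: borel_closed clE)
    have cap: "measure Q (S \<inter> K) = measure Q S"
      if "prob_space Q" "sets Q = sets borel" "measure Q K = 1" "S \<in> sets borel" for Q S
    proof -
      interpret Q: prob_space Q by fact
      have "space Q = UNIV" using sets_eq_imp_space_eq[OF that(2)] by simp
      then have "measure Q (- K) = 0" using Q.prob_compl[of K] that Kb by (simp add: Compl_eq_Diff_UNIV)
      moreover have "measure Q (S - K) \<le> measure Q (- K)"
        using that Kb by (intro Q.finite_measure_mono) auto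
      ultimately have "measure Q (S - K) = 0" using measure_nonneg[of Q "S - K"] by linarith
      then show ?thesis using Q.finite_measure_Diff'[of S K] that Kb by simp
    qed
    have lim: "(\<lambda>n. measure Q (E n)) \<longlonglongrightarrow> measure Q (\<Union>D)" if "prob_space Q" "sets Q = sets borel" for Q
    proof -
      interpret Q: prob_space Q by fact
      have "range E \<subseteq> sets Q" using clE borel_closed that(2) by auto
      then show ?thesis using Q.finite_Lim_measure_incseq[of E] incE UE by simp
    qed
    have "P.prob (\<Union>D) \<le> R.prob (\<Union>D)"
      using lim[OF assms(1) sP] lim[OF assms(2) sR] le clE by (intro LIMSEQ_le) auto
    then show ?thesis using cap[OF assms(1) sP K(2) Db] cap[OF assms(2) sR K(3) Db]
        cap[OF assms(1) sP K(2), of U] cap[OF assms(2) sR K(3), of U] UD that by simp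
  qed
  show ?thesis
  proof (rule measure_eqI_generator_eq[where E = "{U. open U}" and \<Omega> = UNIV and A = "\<lambda>_. UNIV"])
    show "sets P = sigma_sets UNIV {U. open U}" "sets R = sigma_sets UNIV {U. open U}"
      using sP sR by (simp_all add: borel_def)
    show "emeasure P S = emeasure R S" if "S \<in> {U. open U}" for S
      using open_le[of S] open_ge[of S] that by (simp add: P.emeasure_eq_measure R.emeasure_eq_measure)
  qed (auto simp: Int_stable_def)
qed


section \<open>Dual potentials on a compact target\<close>

lemma topological_continuous_onI:
  fixes f :: "'a::topological_space \<Rightarrow> real"
  assumes "\<And>x e. x \<in> S \<Longrightarrow> e > 0 \<Longrightarrow> \<exists>U. open U \<and> x \<in> U \<and> (\<forall>x'\<in>U \<inter> S. \<bar>f x' - f x\<bar> \<le> e)"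
  shows "continuous_on S f"
  unfolding continuous_on_def tendsto_iff eventually_at_topological
proof (intro ballI allI impI)
  fix x and e :: real assume "x \<in> S" "e > 0"
  then obtain U where "open U" "x \<in> U" "\<forall>x'\<in>U \<inter> S. \<bar>f x' - f x\<bar> \<le> e / 2"
    using assms[of x "e / 2"] by auto
  with \<open>e > 0\<close> show "\<exists>U. open U \<and> x \<in> U \<and> (\<forall>y\<in>U. y \<noteq> x \<longrightarrow> y \<in> S \<longrightarrow> dist (f y) (f x) < e)"
    by (intro exI[of _ U]) (force simp: dist_real_def)
qed

text \<open>The contact set of \<open>v\<close> at \<open>x\<close>: the points where the dual
  constraint, with the c-transform of \<open>v\<close> as the other potential, is an equality. The
  form by comparisons makes it evident that adding to \<open>c\<close> a function of
  \<open>x\<close> alone changes nothing.\<close>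

definition minimizers :: "('a \<Rightarrow> 'b \<Rightarrow> real) \<Rightarrow> 'b set \<Rightarrow> ('b \<Rightarrow> real) \<Rightarrow> 'a \<Rightarrow> 'b set" where
  "minimizers c K v x = {y\<in>K. \<forall>y'\<in>K. c x y - v y \<le> c x y' - v y'}"

locale compact_target =
  fixes X CX :: "'a::second_countable_topology set"
    and K :: "'b::{t2_space, second_countable_topology} set"
    and c :: "'a \<Rightarrow> 'b \<Rightarrow> real"
  assumes compact_CX: "compact CX" and X_CX: "X \<subseteq> CX" and X_ne: "X \<noteq> {}"
    and compact_K: "compact K" and K_ne: "K \<noteq> {}"
    and cont_c: "continuous_on (CX \<times> K) (\<lambda>(x, y). c x y)"
begin

text \<open>The tube lemma along the compact factor stands in for uniform continuity, there being no
  metric.\<close>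

lemma equicontinuous_X:
  assumes "x \<in> X" "e > 0"
  shows "\<exists>U. open U \<and> x \<in> U \<and> (\<forall>x'\<in>U \<inter> X. \<forall>y\<in>K. \<bar>c x' y - c x y\<bar> \<le> e)"
proof -
  obtain U where U: "x \<in> U" "open U" "\<forall>x'\<in>U \<inter> CX. \<forall>y\<in>K. dist (case (x', y) of (x, y) \<Rightarrow> c x y) (case
    (x, y) of (x, y) \<Rightarrow> c x y) \<le> e"
    using continuous_on_prod_compactE[OF cont_c compact_K _ assms(2)] assms(1) X_CX
      by (metis (no_types, lifting) subsetD)
  then show ?thesis using X_CX by (intro exI[of _ U]) (auto simp: dist_real_def)
qed

lemma equicontinuous_K:
  assumes "y \<in> K" "e > 0"
  shows "\<exists>V. open V \<and> y \<in> V \<and> (\<forall>y'\<in>V \<inter> K. \<forall>x\<in>X. \<bar>c x y' - c x y\<bar> \<le> e)"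
proof -
  have cont: "continuous_on (K \<times> CX) (\<lambda>z. c (snd z) (fst z))"
  proof -
    have "continuous_on (K \<times> CX) ((\<lambda>(x, y). c x y) \<circ> prod.swap)"
      by (intro continuous_on_compose continuous_on_swap continuous_on_subset[OF cont_c]) auto
    then show ?thesis by (simp add: o_def prod.swap_def case_prod_unfold)
  qed
  obtain U where U: "y \<in> U" "open U"
    "\<forall>y'\<in>U \<inter> K. \<forall>x\<in>CX. dist (c (snd (y', x)) (fst (y', x))) (c (snd (y, x)) (fst (y, x))) \<le> e"
    by (rule continuous_on_prod_compactE[OF cont compact_CX assms])
  then show ?thesis using X_CX by (intro exI[of _ U]) (auto simp: dist_real_def)
qed

lemma cost_bounded: "\<exists>M\<ge>0. \<forall>x\<in>X. \<forall>y\<in>K. \<bar>c x y\<bar> \<le> M"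
proof -
  have "bounded ((\<lambda>(x, y). c x y) ` (CX \<times> K))"
    by (intro compact_imp_bounded compact_continuous_image cont_c compact_Times compact_CX compact_K)
  then obtain M where "\<forall>z\<in>CX \<times> K. \<bar>case z of (x, y) \<Rightarrow> c x y\<bar> \<le> M" unfolding bounded_iff by auto
  then show ?thesis using X_CX by (intro exI[of _ "\<bar>M\<bar>"]) force
qed

text \<open>\<open>env K v\<close> is the c-transform of \<open>v\<close>. The variant with a
  smaller set \<open>C\<close> detects minimisers in \<open>C\<close>: it agrees with
  \<open>env K v\<close> at \<open>x\<close> exactly when some minimiser lies in
  \<open>C\<close>.\<close>

definition env :: "'b set \<Rightarrow> ('b \<Rightarrow> real) \<Rightarrow> 'a \<Rightarrow> real" where
  "env C v x = (INF y\<in>C. c x y - v y)"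

lemma cont_c_right: "x \<in> X \<Longrightarrow> continuous_on K (c x)"
proof (rule topological_continuous_onI)
  fix y and e :: real assume "x \<in> X" "y \<in> K" "e > 0"
  from equicontinuous_K[OF this(2,3)] this(1)
  show "\<exists>U. open U \<and> y \<in> U \<and> (\<forall>y'\<in>U \<inter> K. \<bar>c x y' - c x y\<bar> \<le> e)" by blast
qed

lemma bounded_on_K:
  assumes "continuous_on K (v :: 'b \<Rightarrow> real)"
  shows "\<exists>R. \<forall>y\<in>K. \<bar>v y\<bar> \<le> R"
proof -
  have "bounded (v ` K)" by (rule compact_imp_bounded[OF compact_continuous_image[OF assms compact_K]])
  then show ?thesis unfolding bounded_iff by auto
qed

lemma env_bdd_below:
  assumes "x \<in> X" "C \<subseteq> K" "\<forall>y\<in>K. \<bar>v y\<bar> \<le> R"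
  shows "bdd_below ((\<lambda>y. c x y - v y) ` C)"
proof -
  obtain M where M: "\<forall>x\<in>X. \<forall>y\<in>K. \<bar>c x y\<bar> \<le> M" using cost_bounded by blast
  have "- M - R \<le> c x y - v y" if "y \<in> C" for y
  proof -
    have "\<bar>c x y\<bar> \<le> M" "\<bar>v y\<bar> \<le> R" using M assms that by auto
    then show ?thesis by linarith
  qed
  then show ?thesis by (intro bdd_belowI[of _ "- M - R"]) auto
qed

lemma env_lower:
  assumes "x \<in> X" "C \<subseteq> K" "\<forall>y\<in>K. \<bar>v y\<bar> \<le> R" "y \<in> C"
  shows "env C v x \<le> c x y - v y"
  unfolding env_def by (intro cINF_lower env_bdd_below[OF assms(1-3)] assms(4))

lemma env_greatest:
  assumes "C \<noteq> {}" "\<And>y. y \<in> C \<Longrightarrow> a \<le> c x y - v y"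
  shows "a \<le> env C v x"
  unfolding env_def using assms by (intro cINF_greatest) auto

text \<open>An infimum moves by no more than the uniform change of the function. Point and potential
  vary together, so that one estimate yields continuity in \<open>x\<close> as well as continuity of
  the dual functional in \<open>v\<close>.\<close>

lemma env_dist_le:
  assumes "x \<in> X" "x' \<in> X" "C \<subseteq> K" "C \<noteq> {}" "\<forall>y\<in>K. \<bar>v y\<bar> \<le> R" "\<forall>y\<in>K. \<bar>v' y\<bar> \<le> R"
    "\<And>y. y \<in> K \<Longrightarrow> \<bar>(c x y - v y) - (c x' y - v' y)\<bar> \<le> e"
  shows "\<bar>env C v x - env C v' x'\<bar> \<le> e"
proof -
  have "env C v x - e \<le> env C v' x'"
  proof (rule env_greatest[OF assms(4)])
    fix y assume "y \<in> C"
    then show "env C v x - e \<le> c x' y - v' y"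
      using env_lower[OF assms(1,3,5)] assms(7)[of y] assms(3) by fastforce
  qed
  moreover have "env C v' x' - e \<le> env C v x"
  proof (rule env_greatest[OF assms(4)])
    fix y assume "y \<in> C"
    then show "env C v' x' - e \<le> c x y - v y"
      using env_lower[OF assms(2,3,6)] assms(7)[of y] assms(3) by fastforce
  qed
  ultimately show ?thesis by linarith
qed

lemma env_continuous:
  assumes "C \<subseteq> K" "C \<noteq> {}" "\<forall>y\<in>K. \<bar>v y\<bar> \<le> R"
  shows "continuous_on X (env C v)"
proof (rule topological_continuous_onI)
  fix x and e :: real assume "x \<in> X" "e > 0"
  then obtain U where U: "open U" "x \<in> U" "\<forall>x'\<in>U \<inter> X. \<forall>y\<in>K. \<bar>c x' y - c x y\<bar> \<le> e"
    using equicontinuous_X by blast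
  have "\<bar>env C v x' - env C v x\<bar> \<le> e" if "x' \<in> U \<inter> X" for x'
    using env_dist_le[of x' x C v R v e] U that \<open>x \<in> X\<close> assms by auto
  with U show "\<exists>U. open U \<and> x \<in> U \<and> (\<forall>x'\<in>U \<inter> X. \<bar>env C v x' - env C v x\<bar> \<le> e)" by blast
qed

lemma env_attained:
  assumes "x \<in> X" "C \<subseteq> K" "C \<noteq> {}" "compact C" "continuous_on K v"
  obtains y where "y \<in> C" "env C v x = c x y - v y"
proof -
  have "continuous_on C (\<lambda>y. c x y - v y)"
    using cont_c_right assms by (intro continuous_on_diff) (auto intro: continuous_on_subset)
  from continuous_attains_inf[OF assms(4,3) this] obtain y where
    y: "y \<in> C" "\<And>y'. y' \<in> C \<Longrightarrow> c x y - v y \<le> c x y' - v y'" by blast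
  obtain R where R: "\<forall>y\<in>K. \<bar>v y\<bar> \<le> R" using bounded_on_K[OF assms(5)] by blast
  have "env C v x = c x y - v y"
    by (intro antisym env_lower[OF assms(1,2) R y(1)] env_greatest[OF assms(3)] y(2))
  with y that show ?thesis by blast
qed

lemma minimizers_eq_env:
  assumes "x \<in> X" "continuous_on K v"
  shows "minimizers c K v x = {y\<in>K. c x y - v y = env K v x}"
proof -
  obtain R where R: "\<forall>y\<in>K. \<bar>v y\<bar> \<le> R" using bounded_on_K[OF assms(2)] by blast
  show ?thesis
    unfolding minimizers_def using env_lower[OF assms(1) subset_refl R] env_greatest[OF K_ne, of _ x v]
    by (auto intro: antisym)
qed

text \<open>The infimum over the compact set \<open>C \<inter> K\<close> is attained, so equality of
  the two infima produces a minimiser in \<open>C\<close>. Hit sets thus become zero sets of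
  continuous functions of \<open>x\<close>.\<close>

lemma minimizers_hit_iff:
  assumes "x \<in> X" "continuous_on K v" "closed C" "C \<inter> K \<noteq> {}"
  shows "minimizers c K v x \<inter> C \<noteq> {} \<longleftrightarrow> env (C \<inter> K) v x = env K v x"
proof -
  obtain R where R: "\<forall>y\<in>K. \<bar>v y\<bar> \<le> R" using bounded_on_K[OF assms(2)] by blast
  have cpt: "compact (C \<inter> K)" using compact_K assms(3) using compact_Int_closed[of K C]
    by (simp add: Int_commute)
  show ?thesis
  proof
    assume "minimizers c K v x \<inter> C \<noteq> {}"
    then obtain y where y: "y \<in> C" "y \<in> K" "c x y - v y = env K v x"
      using minimizers_eq_env[OF assms(1,2)] by blast
    have "env (C \<inter> K) v x \<le> env K v x"
      using env_lower[OF assms(1) _ R, of "C \<inter> K" y] y by auto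
    moreover have "env K v x \<le> env (C \<inter> K) v x"
      using env_lower[OF assms(1) subset_refl R] by (intro env_greatest[OF assms(4)]) auto
    ultimately show "env (C \<inter> K) v x = env K v x" by simp
  next
    assume eq: "env (C \<inter> K) v x = env K v x"
    obtain y where "y \<in> C \<inter> K" "env (C \<inter> K) v x = c x y - v y"
      using env_attained[OF assms(1) _ assms(4) cpt assms(2)] by blast
    with eq show "minimizers c K v x \<inter> C \<noteq> {}" using minimizers_eq_env[OF assms(1,2)] by auto
  qed
qed

lemma minimizers_nonempty:
  assumes "x \<in> X" "continuous_on K v"
  shows "minimizers c K v x \<noteq> {}"
proof -
  have "minimizers c K v x \<inter> UNIV \<noteq> {}"
    by (subst minimizers_hit_iff[OF assms closed_UNIV]) (use K_ne in simp_all)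
  then show ?thesis by blast
qed

lemma closedin_minimizers_hit:
  assumes "continuous_on K v" "closed C"
  shows "closedin (top_of_set X) {x\<in>X. minimizers c K v x \<inter> C \<noteq> {}}"
proof (cases "C \<inter> K = {}")
  case True
  then have "{x\<in>X. minimizers c K v x \<inter> C \<noteq> {}} = {}" unfolding minimizers_def by auto
  then show ?thesis using closedin_empty by metis
next
  case False
  obtain R where R: "\<forall>y\<in>K. \<bar>v y\<bar> \<le> R" using bounded_on_K[OF assms(1)] by blast
  have "{x\<in>X. minimizers c K v x \<inter> C \<noteq> {}} = {x\<in>X. env (C \<inter> K) v x - env K v x = 0}"
    using minimizers_hit_iff[OF _ assms False] by auto
  moreover have "continuous_on X (\<lambda>x. env (C \<inter> K) v x - env K v x)"
    using env_continuous[OF _ _ R] False K_ne by (intro continuous_on_diff) auto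
  ultimately show ?thesis using continuous_closedin_preimage_constant by metis
qed

end

section \<open>Kantorovich duality for the marginals \<open>\<mu>\<close> and
  \<open>\<nu>\<close>\<close>

locale compact_transport = compact_target X CX K c + mu: prob_space \<mu> + nu: prob_space \<nu>
  for X CX :: "'a::second_countable_topology set"
    and K :: "'b::{t2_space, second_countable_topology} set" and c and \<mu> :: "'a measure"
      and \<nu> :: "'b measure" +
  fixes Y :: "'b set"
  assumes sets_mu: "sets \<mu> = sets (restrict_space borel X)"
    and sets_nu: "sets \<nu> = sets (restrict_space borel Y)"
    and Y_K: "Y \<subseteq> K" and Y_borel: "Y \<in> sets borel"
begin

lemma space_mu: "space \<mu> = X"
  using sets_eq_imp_space_eq[OF sets_mu] by (simp add: space_restrict_space)

lemma space_nu: "space \<nu> = Y"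
  using sets_eq_imp_space_eq[OF sets_nu] by (simp add: space_restrict_space)

lemma Y_ne: "Y \<noteq> {}" using nu.not_empty space_nu by simp

lemma continuous_measurable_mu: "continuous_on X f \<Longrightarrow> f \<in> borel_measurable \<mu>"
  unfolding measurable_cong_sets[OF sets_mu refl] by (rule borel_measurable_continuous_on_restrict)

lemma continuous_measurable_nu: "continuous_on K f \<Longrightarrow> f \<in> borel_measurable \<nu>"
  unfolding measurable_cong_sets[OF sets_nu refl]
  by (rule borel_measurable_continuous_on_restrict[OF continuous_on_subset[OF _ Y_K]])

lemma closed_sets_nu:
  assumes "closed C"
  shows "C \<inter> Y \<in> sets \<nu>"
proof -
  have "C \<inter> Y = Y \<inter> C" by blast
  moreover have "C \<in> sets borel" using assms by (rule borel_closed)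
  ultimately show ?thesis unfolding sets_nu sets_restrict_space by (rule image_eqI)
qed

lemma closedin_sets_mu:
  assumes "closedin (top_of_set X) S"
  shows "S \<in> sets \<mu>"
proof -
  obtain C where "closed C" "S = C \<inter> X" using assms unfolding closedin_closed by blast
  then have "S = X \<inter> C" "C \<in> sets borel" using borel_closed by auto
  then show ?thesis unfolding sets_mu sets_restrict_space by (rule image_eqI)
qed

lemma transport_measurable:
  assumes "F \<in> measurable \<mu> \<nu>"
  shows "F \<in> borel_measurable \<mu>" "x \<in> X \<Longrightarrow> F x \<in> Y"
proof -
  have "F \<in> measurable \<mu> (restrict_space borel Y)"
    using assms unfolding measurable_cong_sets[OF refl sets_nu] .
  then show "F \<in> borel_measurable \<mu>" by (simp add: measurable_restrict_space2_iff)
  show "F x \<in> Y" if "x \<in> X" using measurable_space[OF assms] that by (simp add: space_mu space_nu)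
qed

lemma cost_continuous_prod: "continuous_on (X \<times> K) (\<lambda>(x, y). c x y)"
  by (rule continuous_on_subset[OF cont_c]) (use X_CX in auto)

lemma cost_measurable:
  assumes "F \<in> borel_measurable \<mu>" "\<And>x. x \<in> X \<Longrightarrow> F x \<in> K"
  shows "(\<lambda>x. c x (F x)) \<in> borel_measurable \<mu>"
proof -
  have "(\<lambda>x. x) \<in> measurable \<mu> borel"
    unfolding measurable_cong_sets[OF sets_mu refl] by (intro measurable_restrict_space1) simp
  then have "(\<lambda>x. (x, F x)) \<in> borel_measurable \<mu>" using assms(1) by (rule borel_measurable_Pair)
  then have 1: "(\<lambda>x. (x, F x)) \<in> measurable \<mu> (restrict_space borel (X \<times> K))"
    using assms(2) by (intro measurable_restrict_space2) (auto simp: space_mu)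
  have 2: "(\<lambda>(x, y). c x y) \<in> borel_measurable (restrict_space borel (X \<times> K))"
    by (rule borel_measurable_continuous_on_restrict[OF cost_continuous_prod])
  from measurable_compose[OF 1 2] show ?thesis by simp
qed

lemma cost_integrable:
  assumes "F \<in> borel_measurable \<mu>" "\<And>x. x \<in> X \<Longrightarrow> F x \<in> K"
  shows "integrable \<mu> (\<lambda>x. c x (F x))"
proof -
  obtain M where M: "\<forall>x\<in>X. \<forall>y\<in>K. \<bar>c x y\<bar> \<le> M" using cost_bounded by blast
  show ?thesis
  proof (rule mu.integrable_const_bound[where B = M])
    show "AE x in \<mu>. norm (c x (F x)) \<le> M" using M assms(2) by (intro AE_I2) (simp add: space_mu)
  qed (rule cost_measurable[OF assms])
qed

lemma continuous_integrable_nu: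
  assumes "continuous_on K (f :: 'b \<Rightarrow> real)"
  shows "integrable \<nu> f"
proof -
  obtain R where R: "\<forall>y\<in>K. \<bar>f y\<bar> \<le> R" using bounded_on_K[OF assms] by blast
  show ?thesis
  proof (rule nu.integrable_const_bound[where B = R])
    show "AE x in \<nu>. norm (f x) \<le> R" using R Y_K by (intro AE_I2) (auto simp: space_nu)
  qed (rule continuous_measurable_nu[OF assms])
qed

lemma env_integrable:
  assumes "C \<subseteq> K" "C \<noteq> {}" "continuous_on K v"
  shows "integrable \<mu> (env C v)"
proof -
  obtain R where R: "\<forall>y\<in>K. \<bar>v y\<bar> \<le> R" using bounded_on_K[OF assms(3)] by blast
  obtain M where M: "\<forall>x\<in>X. \<forall>y\<in>K. \<bar>c x y\<bar> \<le> M" using cost_bounded by blast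
  have "\<bar>env C v x\<bar> \<le> M + R" if "x \<in> X" for x
  proof -
    have b: "- (M + R) \<le> c x y - v y \<and> c x y - v y \<le> M + R" if "y \<in> C" for y
    proof -
      have "\<bar>c x y\<bar> \<le> M" "\<bar>v y\<bar> \<le> R" using M R \<open>x \<in> X\<close> that assms(1) by auto
      then show ?thesis by linarith
    qed
    obtain y where y: "y \<in> C" using assms(2) by blast
    have "env C v x \<le> M + R" using env_lower[OF \<open>x \<in> X\<close> assms(1) R y] b[OF y] by linarith
    moreover have "- (M + R) \<le> env C v x" using b by (intro env_greatest[OF assms(2)]) blast
    ultimately show ?thesis by linarith
  qed
  then show ?thesis
    by (intro mu.integrable_const_bound[where B = "M + R"] AE_I2
        continuous_measurable_mu env_continuous[OF assms(1,2) R]) (simp add: space_mu)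
qed

definition dual_value :: "('b \<Rightarrow> real) \<Rightarrow> real" where
  "dual_value v = (LINT x|\<mu>. env K v x) + (LINT y|\<nu>. v y)"

text \<open>
  The maximum is taken over the potentials sharing the modulus of continuity of \<open>c\<close>, which form a
  compact set for pointwise convergence; replacing \<open>(\<phi>, \<psi>)\<close> by the transform of \<open>\<phi>\<close> leads there.
\<close>

lemma dual_attained:
  obtains v where "continuous_on K v"
    "\<And>\<phi> \<psi>. integrable \<mu> \<phi> \<Longrightarrow> integrable \<nu> \<psi> \<Longrightarrow> (\<And>x y. x \<in> X \<Longrightarrow> y \<in> K \<Longrightarrow> \<phi> x + \<psi> y \<le> c x y) \<Longrightarrow>
      (LINT x|\<mu>. \<phi> x) + (LINT y|\<nu>. \<psi> y) \<le> dual_value v"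
proof -
  obtain M where M0: "M \<ge> 0" and M: "\<forall>x\<in>X. \<forall>y\<in>K. \<bar>c x y\<bar> \<le> M" using cost_bounded by blast
  \<comment> \<open>Potentials are functions on the whole type, so that Tychonoff's theorem applies
    to the topology of pointwise convergence. The bound \<open>2 * M\<close> is the largest
    oscillation of \<open>c\<close> in its second argument, hence of a potential that vanishes at
    one point of \<open>K\<close>.\<close>
  define box :: "('b \<Rightarrow> real) set" where "box = PiE UNIV (\<lambda>_. {- (2 * M)..2 * M})"
  \<comment> \<open>The modulus of continuity is the supremum over \<open>X\<close> of
    \<open>\<bar>c x y - c x y'\<bar>\<close>. Written without the supremum, it is a family of
    closed conditions on evaluations at two points.\<close>
  define Eq :: "('b \<Rightarrow> real) set" where
    "Eq = {w. \<forall>y\<in>K. \<forall>y'\<in>K. \<forall>e. (\<forall>x\<in>X. \<bar>c x y - c x y'\<bar> \<le> e) \<longrightarrow> w y - w y' \<le> e}"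
  have Eq_abs: "\<bar>w y - w y'\<bar> \<le> e" if "w \<in> Eq" "y \<in> K" "y' \<in> K" "\<forall>x\<in>X. \<bar>c x y - c x y'\<bar> \<le> e" for w y y' e
  proof -
    have "w y - w y' \<le> e" using that unfolding Eq_def by blast
    moreover have "\<forall>x\<in>X. \<bar>c x y' - c x y\<bar> \<le> e" using that(4) by (simp add: abs_minus_commute)
    then have "w y' - w y \<le> e" using that(1-3) unfolding Eq_def by blast
    ultimately show ?thesis by linarith
  qed
  have Eq_cont: "continuous_on K w" if "w \<in> Eq" for w
  proof (rule topological_continuous_onI)
    fix y and e :: real assume ye: "y \<in> K" "e > 0"
    from equicontinuous_K[OF this] obtain V where
      V: "open V" "y \<in> V" "\<forall>y'\<in>V \<inter> K. \<forall>x\<in>X. \<bar>c x y' - c x y\<bar> \<le> e" by blast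
    have "\<forall>y'\<in>V \<inter> K. \<bar>w y' - w y\<bar> \<le> e" using V(3) Eq_abs[OF that _ ye(1)] by blast
    with V show "\<exists>U. open U \<and> y \<in> U \<and> (\<forall>y'\<in>U \<inter> K. \<bar>w y' - w y\<bar> \<le> e)" by blast
  qed
  have box_bound: "\<forall>y\<in>K. \<bar>w y\<bar> \<le> 2 * M" if "w \<in> box" for w
    using that unfolding box_def by (auto simp: PiE_def Pi_def abs_le_iff minus_le_iff)
  have "compactin (product_topology (\<lambda>_. euclidean) UNIV) box"
    unfolding box_def compactin_PiE by simp
  then have "compact box" unfolding euclidean_product_topology by simp
  moreover have "closed Eq"
    unfolding Eq_def Ball_def
    by (intro closed_Collect_all closed_Collect_imp open_Collect_const closed_Collect_le
        continuous_on_diff continuous_on_product_coordinates continuous_on_const)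
  ultimately have cW: "compact (box \<inter> Eq)" by (rule compact_Int_closed)
  have "(\<lambda>_. 0) \<in> box \<inter> Eq"
  proof
    show "(\<lambda>_. 0) \<in> box" using M0 by (simp add: box_def PiE_UNIV_domain)
    have "0 - 0 \<le> e" if "\<forall>x\<in>X. \<bar>c x y - c x y'\<bar> \<le> e" for y y' and e :: real
    proof -
      obtain x where "x \<in> X" using X_ne by blast
      with that show ?thesis using abs_ge_zero[of "c x y - c x y'"] by fastforce
    qed
    then show "(\<lambda>_. 0) \<in> Eq" unfolding Eq_def by blast
  qed
  then have neW: "box \<inter> Eq \<noteq> {}" by blast
  have contJ: "continuous_on (box \<inter> Eq) dual_value"
  proof (rule topological_continuous_onI)
    fix w and e :: real assume w: "w \<in> box \<inter> Eq" and e: "e > 0"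
    \<comment> \<open>Equicontinuity upgrades closeness at the finitely many points of
      \<open>F\<close> to uniform closeness on \<open>K\<close>: three errors of
      \<open>e / 6\<close> give \<open>e / 2\<close>, and this bound enters each of the two
      integrals.\<close>
    have "\<forall>y\<in>K. \<exists>V. open V \<and> y \<in> V \<and> (\<forall>y'\<in>V \<inter> K. \<forall>x\<in>X. \<bar>c x y' - c x y\<bar> \<le> e / 6)"
      by (intro ballI equicontinuous_K) (use e in simp_all)
    then obtain V where V: "\<And>y. y \<in> K \<Longrightarrow> open (V y) \<and> y \<in> V y \<and>
      (\<forall>y'\<in>V y \<inter> K. \<forall>x\<in>X. \<bar>c x y' - c x y\<bar> \<le> e / 6)"
      by metis
    obtain F where F: "F \<subseteq> K" "finite F" "K \<subseteq> (\<Union>y\<in>F. V y)"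
      using compactE_image[OF compact_K, of K V] V by blast
    define G where "G = (\<Inter>y\<in>F. {w' :: 'b \<Rightarrow> real. \<bar>w' y - w y\<bar> < e / 6})"
    have "open G" unfolding G_def
      by (intro open_INT F(2) ballI open_Collect_less continuous_on_rabs continuous_on_diff
          continuous_on_product_coordinates continuous_on_const)
    moreover have "w \<in> G" using e by (simp add: G_def)
    moreover have "\<bar>dual_value w' - dual_value w\<bar> \<le> e" if w': "w' \<in> G \<inter> (box \<inter> Eq)" for w'
    proof -
      have close: "\<bar>w' z - w z\<bar> \<le> e / 2" if z: "z \<in> K" for z
      proof -
        obtain y where y: "y \<in> F" "z \<in> V y" using F z by blast
        then have yK: "y \<in> K" using F by blast
        have "\<forall>x\<in>X. \<bar>c x z - c x y\<bar> \<le> e / 6" using V[OF yK] y z by blast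
        then have "\<bar>w' z - w' y\<bar> \<le> e / 6" "\<bar>w z - w y\<bar> \<le> e / 6"
          using Eq_abs z yK w w' by blast+
        moreover have "\<bar>w' y - w y\<bar> < e / 6" using w' y unfolding G_def by blast
        ultimately show ?thesis by linarith
      qed
      have cw: "continuous_on K w" "continuous_on K w'" using w w' Eq_cont by blast+
      have env_close: "\<bar>env K w' x - env K w x\<bar> \<le> e / 2" if "x \<in> X" for x
        using close w w' box_bound that K_ne
        by (intro env_dist_le[where R = "2 * M"]) (auto simp: abs_minus_commute)
      have "\<bar>(LINT x|\<mu>. env K w' x) - (LINT x|\<mu>. env K w x)\<bar> = \<bar>LINT x|\<mu>. env K w' x - env K w x\<bar>"
        using env_integrable[OF subset_refl K_ne] cw by simp
      also have "\<dots> \<le> (LINT x|\<mu>. \<bar>env K w' x - env K w x\<bar>)" by (rule integral_abs_bound)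
      also have "\<dots> \<le> (LINT x|\<mu>. e / 2)"
        using env_integrable[OF subset_refl K_ne] cw env_close
        by (intro integral_mono) (auto simp: space_mu)
      finally have 1: "\<bar>(LINT x|\<mu>. env K w' x) - (LINT x|\<mu>. env K w x)\<bar> \<le> e / 2"
        by (simp add: mu.prob_space)
      have "\<bar>(LINT x|\<nu>. w' x) - (LINT x|\<nu>. w x)\<bar> = \<bar>LINT x|\<nu>. w' x - w x\<bar>"
        using continuous_integrable_nu cw by simp
      also have "\<dots> \<le> (LINT x|\<nu>. \<bar>w' x - w x\<bar>)" by (rule integral_abs_bound)
      also have "\<dots> \<le> (LINT x|\<nu>. e / 2)"
        using continuous_integrable_nu cw close Y_K
        by (intro integral_mono) (auto simp: space_nu)
      finally have 2: "\<bar>(LINT x|\<nu>. w' x) - (LINT x|\<nu>. w x)\<bar> \<le> e / 2"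
        by (simp add: nu.prob_space)
      from 1 2 show ?thesis unfolding dual_value_def by linarith
    qed
    ultimately show "\<exists>U. open U \<and> w \<in> U \<and> (\<forall>w'\<in>U \<inter> (box \<inter> Eq). \<bar>dual_value w' - dual_value w\<bar> \<le> e)"
      by blast
  qed
  obtain v where v: "v \<in> box \<inter> Eq" "\<And>w. w \<in> box \<inter> Eq \<Longrightarrow> dual_value w \<le> dual_value v"
    using continuous_attains_sup[OF cW neW contJ] by blast
  show ?thesis
  proof (rule that[of v])
    show "continuous_on K v" using v(1) Eq_cont by blast
    fix \<phi> \<psi>
    assume int: "integrable \<mu> \<phi>" "integrable \<nu> \<psi>"
      and adm: "\<And>x y. x \<in> X \<Longrightarrow> y \<in> K \<Longrightarrow> \<phi> x + \<psi> y \<le> c x y"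
    \<comment> \<open>The transform of \<open>\<phi>\<close> in the second variable is the largest
      partner admissible with \<open>\<phi>\<close>, so it dominates \<open>\<psi>\<close>; as an
      infimum of functions \<open>c x y - \<phi> x\<close> it has the modulus of
      \<open>c\<close>.\<close>
    define v' where "v' y = (INF x\<in>X. c x y - \<phi> x)" for y
    have low: "v' y \<le> c x y - \<phi> x" if "x \<in> X" "y \<in> K" for x y
      unfolding v'_def using adm that by (intro cINF_lower bdd_belowI[of _ "\<psi> y"]) (auto simp:
        le_diff_eq add.commute)
    have great: "a \<le> v' y" if "\<And>x. x \<in> X \<Longrightarrow> a \<le> c x y - \<phi> x" for a y
      unfolding v'_def using X_ne that by (intro cINF_greatest) auto
    have mod: "v' y - v' y' \<le> e" if "y \<in> K" "y' \<in> K" "\<forall>x\<in>X. \<bar>c x y - c x y'\<bar> \<le> e" for y y' e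
    proof -
      have "v' y - e \<le> v' y'"
      proof (rule great)
        fix x assume x: "x \<in> X"
        then have "\<bar>c x y - c x y'\<bar> \<le> e" using that by blast
        with low[OF x that(1)] show "v' y - e \<le> c x y' - \<phi> x" by linarith
      qed
      then show ?thesis by simp
    qed
    obtain y1 where y1: "y1 \<in> K" using K_ne by blast
    \<comment> \<open>Subtracting \<open>v' y1\<close> puts the potential into \<open>box\<close>.
      The same constant is added to \<open>\<phi>\<close>, and as both marginals have mass 1 the two
      shifts cancel in the dual value.\<close>
    define w where "w y = (if y \<in> K then v' y - v' y1 else 0)" for y
    have osc: "\<bar>c x y - c x y'\<bar> \<le> 2 * M" if "x \<in> X" "y \<in> K" "y' \<in> K" for x y y'
    proof -
      have "\<bar>c x y\<bar> \<le> M" "\<bar>c x y'\<bar> \<le> M" using M that by auto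
      then show ?thesis by linarith
    qed
    have "- (2 * M) \<le> w y \<and> w y \<le> 2 * M" for y
    proof (cases "y \<in> K")
      case True
      then have "v' y - v' y1 \<le> 2 * M" "v' y1 - v' y \<le> 2 * M" using mod y1 osc by auto
      then show ?thesis using True by (simp add: w_def)
    qed (use M0 in \<open>simp add: w_def\<close>)
    then have "w \<in> box" by (simp add: box_def PiE_UNIV_domain)
    moreover have "w \<in> Eq" unfolding Eq_def using mod by (auto simp: w_def)
    ultimately have wW: "w \<in> box \<inter> Eq" by blast
    have cw: "continuous_on K w" using wW Eq_cont by blast
    have "\<phi> x + v' y1 \<le> env K w x" if x: "x \<in> X" for x
    proof (rule env_greatest[OF K_ne])
      fix y assume "y \<in> K"
      with low[OF x this] show "\<phi> x + v' y1 \<le> c x y - w y" by (simp add: w_def)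
    qed
    then have "(LINT x|\<mu>. \<phi> x + v' y1) \<le> (LINT x|\<mu>. env K w x)"
      using int(1) env_integrable[OF subset_refl K_ne cw] by (intro integral_mono) (auto simp: space_mu)
    then have 1: "(LINT x|\<mu>. \<phi> x) + v' y1 \<le> (LINT x|\<mu>. env K w x)"
      using int(1) by (simp add: mu.prob_space)
    have "\<psi> y - v' y1 \<le> w y" if y: "y \<in> K" for y
    proof -
      have "\<psi> y \<le> v' y" using adm y by (intro great) (simp add: le_diff_eq add.commute)
      then show ?thesis using y by (simp add: w_def)
    qed
    then have "(LINT y|\<nu>. \<psi> y - v' y1) \<le> (LINT y|\<nu>. w y)"
      using int(2) continuous_integrable_nu[OF cw] Y_K by (intro integral_mono) (auto simp: space_nu)
    then have 2: "(LINT y|\<nu>. \<psi> y) - v' y1 \<le> (LINT y|\<nu>. w y)"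
      using int(2) by (simp add: nu.prob_space)
    from 1 2 v(2)[OF wW] show "(LINT x|\<mu>. \<phi> x) + (LINT y|\<nu>. \<psi> y) \<le> dual_value v"
      unfolding dual_value_def by linarith
  qed
qed

text \<open>
  First variation of the dual functional: \<open>v + t 1\<^sub>C\<close> and \<open>min u (u\<^sub>C - t)\<close> are admissible, where
  \<open>u\<close> and \<open>u\<^sub>C\<close> are the infima over \<open>K\<close> and over \<open>C\<close>; divide by \<open>t\<close> and let \<open>t\<close> tend to 0.
\<close>

lemma closed_le_minimizers_hit:
  assumes v: "continuous_on K v"
    and opt: "\<And>\<phi> \<psi>. integrable \<mu> \<phi> \<Longrightarrow> integrable \<nu> \<psi> \<Longrightarrow>
      (\<And>x y. x \<in> X \<Longrightarrow> y \<in> K \<Longrightarrow> \<phi> x + \<psi> y \<le> c x y) \<Longrightarrow>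
      (LINT x|\<mu>. \<phi> x) + (LINT y|\<nu>. \<psi> y) \<le> dual_value v"
    and C: "closed C"
  shows "measure \<nu> (C \<inter> Y) \<le> measure \<mu> {x\<in>X. minimizers c K v x \<inter> C \<noteq> {}}"
proof (cases "C \<inter> K = {}")
  case True
  then have "C \<inter> Y = {}" using Y_K by blast
  then show ?thesis by simp
next
  case False
  obtain R where R: "\<forall>y\<in>K. \<bar>v y\<bar> \<le> R" using bounded_on_K[OF v] by blast
  define u where "u = env K v"
  define uC where "uC = env (C \<inter> K) v"
  have iu: "integrable \<mu> u" unfolding u_def by (rule env_integrable[OF subset_refl K_ne v])
  have iuC: "integrable \<mu> uC" unfolding uC_def using env_integrable[OF _ False v] by simp
  have iv: "integrable \<nu> v" by (rule continuous_integrable_nu[OF v])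
  have u_le: "u x \<le> uC x" if "x \<in> X" for x
    unfolding u_def uC_def using env_lower[OF that subset_refl R] by (intro env_greatest[OF False]) auto
  \<comment> \<open>With \<open>t = 1 / Suc n\<close>, \<open>u x - t * f n x\<close> is the minimum
    of \<open>u x\<close> and \<open>uC x - t\<close>, the perturbed potential. The functions
    \<open>f n\<close> lie between 0 and 1 and converge to the indicator of \<open>uC = u\<close>,
    the set of points with a minimiser in \<open>C\<close>.\<close>
  define f where "f n x = max 0 (1 - real (Suc n) * (uC x - u x))" for n x
  have mf: "f n \<in> borel_measurable \<mu>" for n
    unfolding f_def using iu iuC by (intro borel_measurable_max borel_measurable_diff
      borel_measurable_times) auto
  have f01: "0 \<le> f n x \<and> f n x \<le> 1" if "x \<in> X" for n x
    using u_le[OF that] unfolding f_def by auto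
  have if_: "integrable \<mu> (f n)" for n
    using mf f01 by (intro mu.integrable_const_bound[where B = 1] AE_I2) (auto simp: space_mu)
  have CY: "C \<inter> Y \<in> sets \<nu>" by (rule closed_sets_nu[OF C])
  have iC: "integrable \<nu> (indicat_real (C \<inter> Y))"
    using CY by (simp add: nu.emeasure_eq_measure)
  have bound: "measure \<nu> (C \<inter> Y) \<le> (LINT x|\<mu>. f n x)" for n
  proof -
    define t where "t = 1 / real (Suc n)"
    have t: "t > 0" by (simp add: t_def)
    have "(LINT x|\<mu>. u x - t * f n x) + (LINT y|\<nu>. v y + t * indicat_real (C \<inter> Y) y) \<le> dual_value v"
    proof (rule opt)
      show "integrable \<mu> (\<lambda>x. u x - t * f n x)" using iu if_ by simp
      show "integrable \<nu> (\<lambda>y. v y + t * indicat_real (C \<inter> Y) y)"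
        using iv iC by (intro Bochner_Integration.integrable_add integrable_mult_right)
      fix x y assume x: "x \<in> X" and y: "y \<in> K"
      have tf: "t * f n x = max 0 (t - (uC x - u x))"
        using t unfolding f_def t_def max_mult_distrib_left by (simp add: field_simps)
      have 1: "u x \<le> c x y - v y" unfolding u_def by (rule env_lower[OF x subset_refl R y])
      show "u x - t * f n x + (v y + t * indicat_real (C \<inter> Y) y) \<le> c x y"
      proof (cases "y \<in> C")
        case True
        have "uC x \<le> c x y - v y" unfolding uC_def by (rule env_lower[OF x _ R]) (use True y in auto)
        moreover have "u x - t * f n x \<le> uC x - t" unfolding tf by (simp add: max_def)
        moreover have "t * indicat_real (C \<inter> Y) y \<le> t" using t by (simp add: indicator_def)
        ultimately show ?thesis by linarith
      next
        case False
        have "u x - t * f n x \<le> u x" unfolding tf by simp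
        with 1 False show ?thesis by simp
      qed
    qed
    moreover have "(LINT x|\<mu>. u x - t * f n x) = (LINT x|\<mu>. u x) - t * (LINT x|\<mu>. f n x)"
      using iu if_ by simp
    moreover have "(LINT y|\<nu>. v y + t * indicat_real (C \<inter> Y) y) = (LINT y|\<nu>. v y) + t * measure \<nu> (C
      \<inter> Y)"
      using iv iC CY by (subst Bochner_Integration.integral_add) auto
    ultimately have "t * measure \<nu> (C \<inter> Y) \<le> t * (LINT x|\<mu>. f n x)"
      unfolding dual_value_def u_def[symmetric] by linarith
    then show ?thesis using t by simp
  qed
  define E where "E = {x\<in>X. minimizers c K v x \<inter> C \<noteq> {}}"
  have EM: "E \<in> sets \<mu>"
    unfolding E_def by (rule closedin_sets_mu[OF closedin_minimizers_hit[OF v C]])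
  have E_iff: "x \<in> E \<longleftrightarrow> uC x = u x" if "x \<in> X" for x
    unfolding E_def uC_def u_def using minimizers_hit_iff[OF that v C False] that by blast
  have "(\<lambda>n. LINT x|\<mu>. f n x) \<longlonglongrightarrow> (LINT x|\<mu>. indicat_real E x)"
  proof (rule integral_dominated_convergence[where w = "\<lambda>_. 1"])
    show "AE x in \<mu>. (\<lambda>n. f n x) \<longlonglongrightarrow> indicat_real E x"
    proof (rule AE_I2)
      fix x assume "x \<in> space \<mu>"
      then have x: "x \<in> X" by (simp add: space_mu)
      show "(\<lambda>n. f n x) \<longlonglongrightarrow> indicat_real E x"
      proof (cases "x \<in> E")
        case True
        then show ?thesis using E_iff[OF x] by (simp add: f_def)
      next
        case False
        then have pos: "uC x - u x > 0" using E_iff[OF x] u_le[OF x] by simp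
        then obtain N where N: "inverse (uC x - u x) < real N" using reals_Archimedean2 by blast
        have "f n x = 0" if "n \<ge> N" for n
        proof -
          have "inverse (uC x - u x) \<le> real (Suc n)" using N that by linarith
          then have "1 \<le> real (Suc n) * (uC x - u x)" using pos by (simp add: field_simps)
          then show ?thesis by (simp add: f_def)
        qed
        then have "eventually (\<lambda>n. f n x = 0) sequentially" using eventually_sequentially by blast
        then show ?thesis using False by (simp add: tendsto_eventually)
      qed
    qed
    show "AE x in \<mu>. norm (f n x) \<le> 1" for n using f01 by (intro AE_I2) (simp add: space_mu)
    show "f n \<in> borel_measurable \<mu>" for n by (rule mf)
  qed (use EM in auto)
  then have "(\<lambda>n. LINT x|\<mu>. f n x) \<longlonglongrightarrow> measure \<mu> E" using EM by simp
  from LIMSEQ_le_const[OF this] bound show ?thesis unfolding E_def by blast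
qed

text \<open>Where minimisers are unique, the hit set of a closed set is its preimage under the
  minimiser map. The first variation therefore bounds \<open>\<nu>\<close> by the push-forward of
  \<open>\<mu>\<close> on closed sets, and for these probability measures such a one-sided bound
  forces equality.\<close>

theorem optimal_map_in_minimizers:
  assumes uniq: "\<And>v. continuous_on K v \<Longrightarrow> AE x in \<mu>. \<exists>!y. y \<in> minimizers c K v x"
  obtains v where "continuous_on K v"
    "\<And>F. optimal_map c \<mu> \<nu> F \<Longrightarrow> AE x in \<mu>. F x \<in> minimizers c K v x"
proof -
  obtain v where v: "continuous_on K v"
    and opt: "\<And>\<phi> \<psi>. integrable \<mu> \<phi> \<Longrightarrow> integrable \<nu> \<psi> \<Longrightarrow>
      (\<And>x y. x \<in> X \<Longrightarrow> y \<in> K \<Longrightarrow> \<phi> x + \<psi> y \<le> c x y) \<Longrightarrow>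
      (LINT x|\<mu>. \<phi> x) + (LINT y|\<nu>. \<psi> y) \<le> dual_value v"
    using dual_attained by blast
  obtain R where R: "\<forall>y\<in>K. \<bar>v y\<bar> \<le> R" using bounded_on_K[OF v] by blast
  obtain y0 where y0: "y0 \<in> Y" using Y_ne by blast
  define T where "T x = (if \<exists>!y. y \<in> minimizers c K v x then THE y. y \<in> minimizers c K v x else y0)"
    for x
  have T_in: "T x \<in> minimizers c K v x" if "\<exists>!y. y \<in> minimizers c K v x" for x
    using theI'[OF that] that by (simp add: T_def)
  have argK: "minimizers c K v x \<subseteq> K" for x unfolding minimizers_def by blast
  have TK: "T x \<in> K" for x
  proof (cases "\<exists>!y. y \<in> minimizers c K v x")
    case True
    from T_in[OF this] argK show ?thesis by blast
  next
    case False
    then have "T x = y0" unfolding T_def by (rule if_not_P)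
    then show ?thesis using y0 Y_K by blast
  qed
  have AET: "AE x in \<mu>. \<exists>!y. y \<in> minimizers c K v x" by (rule uniq[OF v])
  have T: "T \<in> borel_measurable \<mu>"
    unfolding T_def
  proof (rule measurable_selection_of_hit_sets[OF compact_K argK])
    fix C :: "'b set" assume "closed C"
    then show "{x\<in>space \<mu>. minimizers c K v x \<inter> C \<noteq> {}} \<in> sets \<mu>"
      unfolding space_mu by (rule closedin_sets_mu[OF closedin_minimizers_hit[OF v]])
  qed
  have idn: "(\<lambda>y. y) \<in> measurable \<nu> borel"
    unfolding measurable_cong_sets[OF sets_nu refl] by (intro measurable_restrict_space1) simp
  \<comment> \<open>The comparison takes place on the whole type, because values of \<open>T\<close>
    may lie in \<open>K\<close> outside \<open>Y\<close>, where \<open>\<nu>\<close> is not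
    defined.\<close>
  have distr_eq: "distr \<nu> borel (\<lambda>y. y) = distr \<mu> borel T"
  proof (rule measure_eq_of_closed_le)
    show "prob_space (distr \<nu> borel (\<lambda>y. y))" by (rule nu.prob_space_distr[OF idn])
    show "prob_space (distr \<mu> borel T)" by (rule mu.prob_space_distr[OF T])
    show "compact K" by (rule compact_K)
    have Kb: "K \<in> sets borel" by (rule borel_closed[OF compact_imp_closed[OF compact_K]])
    have "(\<lambda>y. y) -` K \<inter> space \<nu> = space \<nu>" using Y_K by (auto simp: space_nu)
    then show "measure (distr \<nu> borel (\<lambda>y. y)) K = 1"
      by (simp add: measure_distr[OF idn Kb] nu.prob_space)
    have "T -` K \<inter> space \<mu> = space \<mu>" using TK by auto
    then show "measure (distr \<mu> borel T) K = 1"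
      by (simp add: measure_distr[OF T Kb] mu.prob_space)
    fix C :: "'b set" assume C: "closed C"
    then have Cb: "C \<in> sets borel" by (rule borel_closed)
    have "measure (distr \<nu> borel (\<lambda>y. y)) C = measure \<nu> (C \<inter> Y)"
      by (simp add: measure_distr[OF idn Cb] space_nu)
    also have "\<dots> \<le> measure \<mu> {x\<in>X. minimizers c K v x \<inter> C \<noteq> {}}"
      by (rule closed_le_minimizers_hit[OF v opt C])
    also have "\<dots> = measure \<mu> (T -` C \<inter> space \<mu>)"
    proof (rule mu.finite_measure_eq_AE)
      show "AE x in \<mu>. x \<in> {x\<in>X. minimizers c K v x \<inter> C \<noteq> {}} \<longleftrightarrow> x \<in> T -` C \<inter> space \<mu>"
        using AET
      proof (rule AE_mp, intro AE_I2 impI)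
        fix x assume x: "x \<in> space \<mu>" and u: "\<exists>!y. y \<in> minimizers c K v x"
        have "minimizers c K v x = {T x}" using T_in[OF u] u by blast
        with x show "x \<in> {x\<in>X. minimizers c K v x \<inter> C \<noteq> {}} \<longleftrightarrow> x \<in> T -` C \<inter> space \<mu>"
          by (auto simp: space_mu)
      qed
      show "{x\<in>X. minimizers c K v x \<inter> C \<noteq> {}} \<in> sets \<mu>"
        by (rule closedin_sets_mu[OF closedin_minimizers_hit[OF v C]])
      show "T -` C \<inter> space \<mu> \<in> sets \<mu>" using T Cb by (rule measurable_sets)
    qed
    also have "\<dots> = measure (distr \<mu> borel T) C" by (simp add: measure_distr[OF T Cb])
    finally show "measure (distr \<nu> borel (\<lambda>y. y)) C \<le> measure (distr \<mu> borel T) C" .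
  qed simp_all
  have AEY: "AE x in \<mu>. T x \<in> Y"
  proof -
    have "AE y in distr \<nu> borel (\<lambda>y. y). y \<in> Y"
      using Y_borel by (subst AE_distr_iff[OF idn]) (auto simp: space_nu intro: AE_I2)
    then show ?thesis unfolding distr_eq using Y_borel by (subst (asm) AE_distr_iff[OF T]) auto
  qed
  \<comment> \<open>A transport map must send all of \<open>X\<close> into \<open>Y\<close>, the
    space of \<open>\<nu>\<close>. By \<open>AEY\<close> the values outside \<open>Y\<close> occur
    on a null set only and may be replaced by \<open>y0\<close>.\<close>
  define T' where "T' x = (if T x \<in> Y then T x else y0)" for x
  have T'Y: "T' x \<in> Y" for x using y0 by (simp add: T'_def)
  have T'b: "T' \<in> borel_measurable \<mu>"
    unfolding T'_def using T Y_borel by (intro measurable_If) auto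
  have T'm: "T' \<in> measurable \<mu> \<nu>"
    unfolding measurable_cong_sets[OF refl sets_nu] using T'b T'Y
      by (intro measurable_restrict_space2) auto
  have AET': "AE x in \<mu>. T' x = T x" using AEY by eventually_elim (simp add: T'_def)
  have transport: "transport_map \<mu> \<nu> T'"
    unfolding transport_map_def
  proof
    show "distr \<mu> \<nu> T' = \<nu>"
    proof (rule measure_eqI)
      fix B assume "B \<in> sets (distr \<mu> \<nu> T')"
      then have B: "B \<in> sets \<nu>" by simp
      then obtain B' where B': "B' \<in> sets borel" "B = Y \<inter> B'"
        unfolding sets_nu sets_restrict_space by blast
      have "emeasure (distr \<mu> \<nu> T') B = emeasure \<mu> (T' -` B \<inter> space \<mu>)"
        by (rule emeasure_distr[OF T'm B])
      also have "T' -` B \<inter> space \<mu> = T' -` B' \<inter> space \<mu>" using T'Y B' by auto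
      also have "emeasure \<mu> (T' -` B' \<inter> space \<mu>) = emeasure \<mu> (T -` B' \<inter> space \<mu>)"
        by (rule emeasure_eq_AE) (use AET' measurable_sets[OF T B'(1)] measurable_sets[OF T'b B'(1)]
          in auto)
      also have "\<dots> = emeasure (distr \<nu> borel (\<lambda>y. y)) B'"
        unfolding distr_eq by (rule emeasure_distr[OF T B'(1), symmetric])
      also have "\<dots> = emeasure \<nu> B"
        using B' by (simp add: emeasure_distr[OF idn B'(1)] space_nu Int_commute)
      finally show "emeasure (distr \<mu> \<nu> T') B = emeasure \<nu> B" .
    qed simp
  qed (rule T'm)
  have int_v: "(LINT x|\<mu>. v (G x)) = (LINT y|\<nu>. v y)" "integrable \<mu> (\<lambda>x. v (G x))"
    if "transport_map \<mu> \<nu> G" for G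
  proof -
    have G: "G \<in> measurable \<mu> \<nu>" "distr \<mu> \<nu> G = \<nu>" using that by (auto simp: transport_map_def)
    show "(LINT x|\<mu>. v (G x)) = (LINT y|\<nu>. v y)"
      using integral_distr[OF G(1) continuous_measurable_nu[OF v]] G(2) by simp
    show "integrable \<mu> (\<lambda>x. v (G x))"
      using integrable_distr[OF G(1), of v] continuous_integrable_nu[OF v] G(2) by simp
  qed
  have iu: "integrable \<mu> (env K v)" by (rule env_integrable[OF subset_refl K_ne v])
  have cost_T': "(LINT x|\<mu>. c x (T' x)) = dual_value v"
  proof -
    have "(LINT x|\<mu>. c x (T' x)) = (LINT x|\<mu>. env K v x + v (T' x))"
    proof (rule integral_cong_AE)
      show "(\<lambda>x. c x (T' x)) \<in> borel_measurable \<mu>" using cost_measurable[OF T'b] T'Y Y_K by blast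
      show "(\<lambda>x. env K v x + v (T' x)) \<in> borel_measurable \<mu>"
        using iu int_v(2)[OF transport] by (intro borel_measurable_add) auto
      show "AE x in \<mu>. c x (T' x) = env K v x + v (T' x)"
        using AET' AET AE_space
      proof eventually_elim
        case (elim x)
        then have "T' x \<in> minimizers c K v x" "x \<in> X" using T_in by (auto simp: space_mu)
        then show ?case using minimizers_eq_env[OF _ v] by auto
      qed
    qed
    also have "\<dots> = (LINT x|\<mu>. env K v x) + (LINT x|\<mu>. v (T' x))"
      using iu int_v(2)[OF transport] by simp
    finally show ?thesis unfolding dual_value_def int_v(1)[OF transport] .
  qed
  show ?thesis
  proof (rule that[OF v])
    fix F assume F: "optimal_map c \<mu> \<nu> F"
    then have tF: "transport_map \<mu> \<nu> F" by (simp add: optimal_map_def)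
    then have Fm: "F \<in> measurable \<mu> \<nu>" by (simp add: transport_map_def)
    have FK: "F x \<in> K" if "x \<in> X" for x using transport_measurable(2)[OF Fm that] Y_K by blast
    have ic: "integrable \<mu> (\<lambda>x. c x (F x))" by (rule cost_integrable[OF transport_measurable(1)[OF
      Fm] FK])
    \<comment> \<open>The slack in the dual constraint is nonnegative. Its integral is the cost of
      \<open>F\<close> minus the dual value, which is the cost of \<open>T'\<close>; optimality of
      \<open>F\<close> makes it nonpositive, so the slack vanishes almost everywhere.\<close>
    define g where "g x = c x (F x) - env K v x - v (F x)" for x
    have ig: "integrable \<mu> g"
      unfolding g_def using ic iu int_v(2)[OF tF] by simp
    have "(LINT x|\<mu>. g x) = (LINT x|\<mu>. c x (F x)) - dual_value v"
      unfolding g_def dual_value_def int_v(1)[OF tF, symmetric] using ic iu int_v(2)[OF tF] by simp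
    also have "\<dots> \<le> 0" using F transport cost_T' unfolding optimal_map_def by fastforce
    finally have le0: "(LINT x|\<mu>. g x) \<le> 0" .
    have g0: "AE x in \<mu>. 0 \<le> g x"
      using env_lower[OF _ subset_refl R FK] by (intro AE_I2) (fastforce simp: g_def space_mu)
    have "AE x in \<mu>. g x = 0"
      using integral_nonneg_eq_0_iff_AE[OF ig g0] le0 integral_nonneg_AE[OF g0] by simp
    then show "AE x in \<mu>. F x \<in> minimizers c K v x"
      using AE_space
    proof eventually_elim
      case (elim x)
      then show ?case using minimizers_eq_env[OF _ v, of x] FK by (auto simp: g_def space_mu)
    qed
  qed
qed

end


section \<open>Charts, curves and differentials\<close>

lemma is_chartD:
  assumes "is_chart (U, \<phi>)"
  shows "open U" "open (\<phi> ` U)" "inj_on \<phi> U" "continuous_on U \<phi>" "continuous_on (\<phi> ` U) (inv_into U \<phi>)"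
proof -
  have h: "homeomorphism U (\<phi> ` U) \<phi> (inv_into U \<phi>)" and "open U" "open (\<phi> ` U)"
    using assms unfolding is_chart_def by auto
  then show "open U" "open (\<phi> ` U)" by auto
  show "continuous_on U \<phi>" "continuous_on (\<phi> ` U) (inv_into U \<phi>)" using h
    unfolding homeomorphism_def by auto
  show "inj_on \<phi> U" using h unfolding homeomorphism_def by (metis inj_on_inverseI)
qed

lemma is_chart_open_image:
  assumes "is_chart (U, \<phi>)" "open S"
  shows "open (\<phi> ` (U \<inter> S))"
proof -
  note c = is_chartD[OF assms(1)]
  have "\<phi> ` (U \<inter> S) = \<phi> ` U \<inter> inv_into U \<phi> -` S"
    using c(3) by (auto simp: inv_into_f_f)
  then show ?thesis using continuous_open_preimage[OF c(5,2) assms(2)] by simp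
qed

lemma is_chart_open_preimage:
  assumes "is_chart (U, \<phi>)" "open W"
  shows "open (U \<inter> \<phi> -` W)"
  using continuous_open_preimage[OF is_chartD(4,1)[OF assms(1)] assms(2)] .

lemma charts_is_chart: "(U, \<phi>) \<in> charts A \<Longrightarrow> is_chart (U, \<phi>)"
  unfolding charts_def by blast

lemma atlas_subset_charts: "smooth_atlas A \<Longrightarrow> A \<subseteq> charts A"
  unfolding smooth_atlas_def charts_def by blast

lemma atlas_chart_at:
  assumes "smooth_atlas A"
  obtains U \<phi> where "(U, \<phi>) \<in> A" "p \<in> U"
proof -
  have "p \<in> (\<Union>\<kappa>\<in>A. fst \<kappa>)" using assms unfolding smooth_atlas_def by simp
  then show ?thesis using that by fastforce
qed

lemma compatible_chartsD:
  assumes "compatible_charts (U, \<phi>) (V, \<psi>)"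
  shows "smooth_on (\<phi> ` (U \<inter> V)) (\<psi> \<circ> inv_into U \<phi>)" "smooth_on (\<psi> ` (U \<inter> V)) (\<phi> \<circ> inv_into V \<psi>)"
  using assms unfolding compatible_charts_def by auto

text \<open>Two charts of the maximal atlas are known to be compatible with members of
  \<open>A\<close> only. Near each point the transition factors through a chart of \<open>A\<close>,
  and smoothness is local.\<close>

lemma charts_transition_smooth:
  assumes A: "smooth_atlas A" and U: "(U, \<phi>) \<in> charts A" and V: "(V, \<psi>) \<in> charts A"
  shows "Ck_on k (\<phi> ` (U \<inter> V)) (\<psi> \<circ> inv_into U \<phi>)"
proof (rule Ck_on_local)
  fix z assume "z \<in> \<phi> ` (U \<inter> V)"
  then obtain p where p: "p \<in> U" "p \<in> V" "z = \<phi> p" by blast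
  obtain W \<xi> where W: "(W, \<xi>) \<in> A" "p \<in> W" using atlas_chart_at[OF A] by metis
  have cU: "is_chart (U, \<phi>)" and cV: "is_chart (V, \<psi>)" using U V charts_is_chart by auto
  have cW: "is_chart (W, \<xi>)" using A W(1) unfolding smooth_atlas_def by blast
  have UW: "compatible_charts (U, \<phi>) (W, \<xi>)" and VW: "compatible_charts (V, \<psi>) (W, \<xi>)"
    using U V W(1) unfolding charts_def by blast+
  note inj = is_chartD(3)[OF cU] is_chartD(3)[OF cW]
  define S where "S = \<phi> ` (U \<inter> (V \<inter> W))"
  have oS: "open S" unfolding S_def
    by (intro is_chart_open_image[OF cU] open_Int is_chartD(1)[OF cV] is_chartD(1)[OF cW])
  have oT: "open (\<xi> ` (W \<inter> V))" by (rule is_chart_open_image[OF cW is_chartD(1)[OF cV]])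
  have "Ck_on k S ((\<psi> \<circ> inv_into W \<xi>) \<circ> (\<xi> \<circ> inv_into U \<phi>))"
  proof (rule Ck_on_compose[OF oS oT])
    show "(\<xi> \<circ> inv_into U \<phi>) ` S \<subseteq> \<xi> ` (W \<inter> V)"
      unfolding S_def using inj by (auto simp: inv_into_f_f)
    show "Ck_on k S (\<xi> \<circ> inv_into U \<phi>)"
      using compatible_chartsD(1)[OF UW] Ck_on_subset[of k "\<phi> ` (U \<inter> W)" _ S]
      unfolding smooth_on_def S_def by blast
    show "Ck_on k (\<xi> ` (W \<inter> V)) (\<psi> \<circ> inv_into W \<xi>)"
      using compatible_chartsD(2)[OF VW] unfolding smooth_on_def by (simp add: Int_commute)
  qed
  then have "Ck_on k S (\<psi> \<circ> inv_into U \<phi>)"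
    by (rule Ck_on_cong[OF oS, rotated]) (use inj in \<open>auto simp: S_def inv_into_f_f\<close>)
  moreover have "z \<in> S" "S \<subseteq> \<phi> ` (U \<inter> V)" using p W(2) unfolding S_def by auto
  ultimately show "\<exists>T. open T \<and> z \<in> T \<and> T \<subseteq> \<phi> ` (U \<inter> V) \<and> Ck_on k T (\<psi> \<circ> inv_into U \<phi>)"
    using oS by blast
qed

section \<open>Product charts and local representatives\<close>

lemma inv_into_map_prod:
  assumes "inj_on \<phi> U" "inj_on \<psi> V" "x \<in> U" "y \<in> V"
  shows "inv_into (U \<times> V) (map_prod \<phi> \<psi>) (\<phi> x, \<psi> y) = (x, y)"
proof -
  have "inj_on (map_prod \<phi> \<psi>) (U \<times> V)" using assms(1,2) by (rule map_prod_inj_on)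
  from inv_into_f_f[OF this, of "(x, y)"] assms(3,4) show ?thesis by simp
qed

lemma map_prod_image_Times: "map_prod f g ` (S \<times> T) = f ` S \<times> g ` T"
  by (rule map_prod_surj_on[OF refl refl])

lemma is_chart_prod:
  assumes "is_chart (U, \<phi>)" "is_chart (V, \<psi>)"
  shows "is_chart (U \<times> V, map_prod \<phi> \<psi>)"
proof -
  note u = is_chartD[OF assms(1)] and v = is_chartD[OF assms(2)]
  have inj: "inj_on (map_prod \<phi> \<psi>) (U \<times> V)" using u(3) v(3) by (rule map_prod_inj_on)
  have "continuous_on (U \<times> V) (\<lambda>z. (\<phi> (fst z), \<psi> (snd z)))"
    by (intro continuous_on_Pair continuous_on_compose2[OF u(4)] continuous_on_compose2[OF v(4)]
        continuous_on_fst continuous_on_snd continuous_on_id) auto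
  then have 1: "continuous_on (U \<times> V) (map_prod \<phi> \<psi>)" by (simp add: map_prod_def case_prod_unfold)
  have "continuous_on (\<phi> ` U \<times> \<psi> ` V) (\<lambda>z. (inv_into U \<phi> (fst z), inv_into V \<psi> (snd z)))"
    by (intro continuous_on_Pair continuous_on_compose2[OF u(5)] continuous_on_compose2[OF v(5)]
        continuous_on_fst continuous_on_snd continuous_on_id) auto
  then have 2: "continuous_on (map_prod \<phi> \<psi> ` (U \<times> V)) (inv_into (U \<times> V) (map_prod \<phi> \<psi>))"
    unfolding map_prod_image_Times
    by (rule continuous_on_eq) (auto simp: inv_into_map_prod u(3) v(3) inv_into_f_f)
  have "homeomorphism (U \<times> V) (map_prod \<phi> \<psi> ` (U \<times> V)) (map_prod \<phi> \<psi>) (inv_into (U \<times> V) (map_prod \<phi> \<psi>))"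
    unfolding homeomorphism_def using 1 2 inj inv_into_image_cancel[OF inj subset_refl]
    by (auto simp: inv_into_f_f f_inv_into_f simp del: map_prod_simp)
  then show ?thesis
    unfolding is_chart_def using u(1,2) v(1,2) by (auto simp: map_prod_image_Times open_Times)
qed

lemma Ck_on_transition_prod:
  fixes \<phi> :: "'a::topological_space \<Rightarrow> 'e::euclidean_space" and \<phi>' :: "'a \<Rightarrow> 'e2::euclidean_space"
    and \<psi> :: "'b::topological_space \<Rightarrow> 'f::euclidean_space" and \<psi>' :: "'b \<Rightarrow> 'f2::euclidean_space"
  assumes "is_chart (U, \<phi>)" "is_chart (V, \<psi>)" "open U'" "open V'"
    "Ck_on k (\<phi> ` (U \<inter> U')) (\<phi>' \<circ> inv_into U \<phi>)" "Ck_on k (\<psi> ` (V \<inter> V')) (\<psi>' \<circ> inv_into V \<psi>)"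
  shows "Ck_on k (map_prod \<phi> \<psi> ` ((U \<times> V) \<inter> (U' \<times> V')))
    (map_prod \<phi>' \<psi>' \<circ> inv_into (U \<times> V) (map_prod \<phi> \<psi>))"
proof -
  have o: "open (\<phi> ` (U \<inter> U'))" "open (\<psi> ` (V \<inter> V'))" using assms is_chart_open_image by blast+
  have eq: "map_prod \<phi> \<psi> ` ((U \<times> V) \<inter> (U' \<times> V')) = \<phi> ` (U \<inter> U') \<times> \<psi> ` (V \<inter> V')"
    unfolding Times_Int_Times map_prod_image_Times ..
  show ?thesis
    unfolding eq
  proof (rule Ck_on_cong[OF open_Times[OF o] _ Ck_on_map_prod[OF o assms(5,6)]])
    fix z assume "z \<in> \<phi> ` (U \<inter> U') \<times> \<psi> ` (V \<inter> V')"
    then obtain x y where "x \<in> U" "y \<in> V" "z = (\<phi> x, \<psi> y)" by auto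
    then show "map_prod (\<phi>' \<circ> inv_into U \<phi>) (\<psi>' \<circ> inv_into V \<psi>) z =
        (map_prod \<phi>' \<psi>' \<circ> inv_into (U \<times> V) (map_prod \<phi> \<psi>)) z"
      using is_chartD(3)[OF assms(1)] is_chartD(3)[OF assms(2)]
        by (simp add: inv_into_map_prod inv_into_f_f)
  qed
qed

text \<open>Regularity of \<open>c\<close> is stated for the maximal atlas generated by
  \<open>prod_atlas A B\<close>, while slice charts of either factor need not belong to
  \<open>A\<close> or \<open>B\<close>. This makes products of such charts available.\<close>

lemma prod_chart_in_charts:
  assumes A: "smooth_atlas A" and B: "smooth_atlas B" and U: "(U, \<phi>) \<in> charts A"
    and V: "(V, \<psi>) \<in> charts B"
  shows "(U \<times> V, map_prod \<phi> \<psi>) \<in> charts (prod_atlas A B)"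
  unfolding charts_def
proof (intro CollectI conjI ballI)
  have cU: "is_chart (U, \<phi>)" and cV: "is_chart (V, \<psi>)" using U V charts_is_chart by auto
  then show "is_chart (U \<times> V, map_prod \<phi> \<psi>)" by (rule is_chart_prod)
  fix \<kappa>' assume "\<kappa>' \<in> prod_atlas A B"
  then obtain U' \<phi>' V' \<psi>' where k: "\<kappa>' = (U' \<times> V', map_prod \<phi>' \<psi>')" "(U', \<phi>') \<in> A" "(V', \<psi>') \<in> B"
    unfolding prod_atlas_def by blast
  have UV': "(U', \<phi>') \<in> charts A" "(V', \<psi>') \<in> charts B"
    using k atlas_subset_charts A B by blast+
  then have cU': "is_chart (U', \<phi>')" and cV': "is_chart (V', \<psi>')" using charts_is_chart by auto
  have 1: "Ck_on k (map_prod \<phi> \<psi> ` ((U \<times> V) \<inter> (U' \<times> V')))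
    (map_prod \<phi>' \<psi>' \<circ> inv_into (U \<times> V) (map_prod \<phi> \<psi>))" for k
    by (intro Ck_on_transition_prod cU cV is_chartD(1)[OF cU'] is_chartD(1)[OF cV']
        charts_transition_smooth[OF A U UV'(1)] charts_transition_smooth[OF B V UV'(2)])
  have 2: "Ck_on k (map_prod \<phi>' \<psi>' ` ((U' \<times> V') \<inter> (U \<times> V)))
    (map_prod \<phi> \<psi> \<circ> inv_into (U' \<times> V') (map_prod \<phi>' \<psi>'))" for k
    by (intro Ck_on_transition_prod cU' cV' is_chartD(1)[OF cU] is_chartD(1)[OF cV]
        charts_transition_smooth[OF A UV'(1) U] charts_transition_smooth[OF B UV'(2) V])
  show "compatible_charts (U \<times> V, map_prod \<phi> \<psi>) \<kappa>'"
    unfolding k(1) compatible_charts_def smooth_on_def using 1 2 by (simp add: Int_commute)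
qed

lemma Ck_local_representative:
  assumes "Ck k A S f" "p \<in> S" "(U, \<phi>) \<in> charts A" "p \<in> U"
  obtains N h where "open N" "p \<in> N" "N \<subseteq> U" "Ck_on k (\<phi> ` N) h" "\<And>q. q \<in> S \<inter> N \<Longrightarrow> f q = h (\<phi> q)"
proof -
  obtain W g where W: "p \<in> W" "Ck_open k A W g" "\<forall>q\<in>S \<inter> W. g q = f q"
    using assms(1,2) unfolding Ck_def by blast
  note U = is_chartD[OF charts_is_chart[OF assms(3)]]
  show ?thesis
  proof (rule that[of "U \<inter> W" "g \<circ> inv_into U \<phi>"])
    show "open (U \<inter> W)" using U W unfolding Ck_open_def by blast
    show "Ck_on k (\<phi> ` (U \<inter> W)) (g \<circ> inv_into U \<phi>)" using W(2) assms(3) unfolding Ck_open_def by blast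
    show "f q = (g \<circ> inv_into U \<phi>) (\<phi> q)" if "q \<in> S \<inter> (U \<inter> W)" for q
      using that W(3) U(3) by (simp add: inv_into_f_f)
  qed (use W assms in auto)
qed

text \<open>The domain is shrunk to a box so that the two variables can be moved independently. Off
  \<open>S \<times> T\<close>, \<open>h\<close> is just some extension of \<open>c\<close>.\<close>

lemma Ck_prod_local_representative:
  assumes "smooth_atlas A" "smooth_atlas B" "Ck k (prod_atlas A B) (S \<times> T) (\<lambda>(x, y). c x y)"
    "x \<in> S" "y \<in> T" "(U, \<phi>) \<in> charts A" "(V, \<psi>) \<in> charts B" "x \<in> U" "y \<in> V"
  obtains N M h where "open N" "x \<in> N" "N \<subseteq> U" "open M" "y \<in> M" "M \<subseteq> V"
    "Ck_on k (\<phi> ` N \<times> \<psi> ` M) h" "\<And>x' y'. x' \<in> S \<inter> N \<Longrightarrow> y' \<in> T \<inter> M \<Longrightarrow> c x' y' = h (\<phi> x', \<psi> y')"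
proof -
  obtain W h where W: "open W" "(x, y) \<in> W" "W \<subseteq> U \<times> V" "Ck_on k (map_prod \<phi> \<psi> ` W) h"
    "\<And>q. q \<in> S \<times> T \<inter> W \<Longrightarrow> (case q of (x, y) \<Rightarrow> c x y) = h (map_prod \<phi> \<psi> q)"
    using Ck_local_representative[OF assms(3) _ prod_chart_in_charts[OF assms(1,2,6,7)],
      of "(x, y)"] assms(4,5,8,9)
    by (metis SigmaI)
  obtain N M where NM: "open N" "open M" "x \<in> N" "y \<in> M" "N \<times> M \<subseteq> W"
    using W(1,2) by (metis open_prod_elim SigmaD1 SigmaD2)
  have "N \<subseteq> U" "M \<subseteq> V" using NM W(3) by auto
  moreover have "Ck_on k (\<phi> ` N \<times> \<psi> ` M) h"
    unfolding map_prod_image_Times[symmetric] by (rule Ck_on_subset[OF W(4) image_mono[OF NM(5)]])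
  moreover have "c x' y' = h (\<phi> x', \<psi> y')" if "x' \<in> S \<inter> N" "y' \<in> T \<inter> M" for x' y'
    using W(5)[of "(x', y')"] that NM(5) by auto
  ultimately show ?thesis using that NM by blast
qed

section \<open>Curves, differentials and slices of submanifolds\<close>

lemma curves_eventually_in:
  assumes "\<gamma> \<in> curves A S p" "open N" "p \<in> N"
  shows "eventually (\<lambda>t. \<gamma> t \<in> S \<inter> N) (nhds 0)"
proof -
  obtain e where e: "e > 0" "\<gamma> ` {-e<..<e} \<subseteq> S" "continuous_on {-e<..<e} \<gamma>" "\<gamma> 0 = p"
    using assms(1) unfolding curves_def by blast
  have "open ({-e<..<e} \<inter> \<gamma> -` N)" by (rule continuous_open_preimage[OF e(3) _ assms(2)]) simp
  moreover have "0 \<in> {-e<..<e} \<inter> \<gamma> -` N" using e assms(3) by auto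
  ultimately show ?thesis unfolding eventually_nhds using e(2) by blast
qed

lemma curve_has_velocity:
  assumes "\<gamma> \<in> curves A S p" "(U, \<phi>) \<in> charts A" "p \<in> U"
  shows "(\<phi> \<circ> \<gamma> has_vector_derivative vector_derivative (\<phi> \<circ> \<gamma>) (at 0)) (at 0)"
proof -
  obtain e where e: "e > 0" "\<gamma> 0 = p" "smooth_on ({-e<..<e} \<inter> \<gamma> -` U) (\<phi> \<circ> \<gamma>)"
    using assms(1,2) unfolding curves_def by blast
  have "Ck_on (Suc 0) ({-e<..<e} \<inter> \<gamma> -` U) (\<phi> \<circ> \<gamma>)" using e(3) unfolding smooth_on_def by blast
  then have "(\<phi> \<circ> \<gamma>) differentiable (at 0)" using e(1,2) assms(3) by simp
  then show ?thesis by (simp add: vector_derivative_works)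
qed

text \<open>By the chain rule all curves of the class give the same derivative, so the description
  by \<open>THE\<close> in \<open>differential\<close> has this value. Agreement of \<open>f\<close>
  with its representative on \<open>S\<close> suffices, since the curves stay in \<open>S\<close>
  near time 0.\<close>

lemma differential_eq_chart_derivative:
  assumes \<gamma>: "\<gamma> \<in> curves A S p" and U: "(U, \<phi>) \<in> charts A" "p \<in> U"
    and N: "open N" "p \<in> N" "\<And>q. q \<in> S \<inter> N \<Longrightarrow> f q = h (\<phi> q)"
    and h: "(h has_derivative h') (at (\<phi> p))"
  shows "differential A S p f (same_velocity A S p `` {\<gamma>}) = h' (vector_derivative (\<phi> \<circ> \<gamma>) (at 0))"
proof -
  define v where "v = same_velocity A S p `` {\<gamma>}"
  have "\<gamma> \<in> v" unfolding v_def same_velocity_def using \<gamma> by auto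
  have vt: "v \<in> tangent_space A S p" unfolding tangent_space_def v_def using \<gamma> by (rule quotientI)
  have D: "((\<lambda>t. f (\<eta> t)) has_real_derivative h' (vector_derivative (\<phi> \<circ> \<gamma>) (at 0))) (at 0)"
    if "\<eta> \<in> v" for \<eta>
  proof -
    have \<eta>: "\<eta> \<in> curves A S p" "vector_derivative (\<phi> \<circ> \<gamma>) (at 0) = vector_derivative (\<phi> \<circ> \<eta>) (at 0)"
      using that U unfolding v_def same_velocity_def by auto
    have \<eta>0: "\<eta> 0 = p" using \<eta>(1) unfolding curves_def by blast
    interpret h': bounded_linear h' using h by (rule has_derivative_bounded_linear)
    have "(\<phi> \<circ> \<eta> has_derivative (\<lambda>t. t *\<^sub>R vector_derivative (\<phi> \<circ> \<eta>) (at 0))) (at 0)"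
      using curve_has_velocity[OF \<eta>(1) U] unfolding has_vector_derivative_def .
    from diff_chain_at[OF this, of h h'] h \<eta>0
    have "(h \<circ> (\<phi> \<circ> \<eta>) has_derivative (\<lambda>t. t *\<^sub>R h' (vector_derivative (\<phi> \<circ> \<eta>) (at 0)))) (at 0)"
      by (simp add: o_def h'.scaleR)
    then have d: "((\<lambda>t. h (\<phi> (\<eta> t))) has_real_derivative h' (vector_derivative (\<phi> \<circ> \<gamma>) (at 0))) (at 0)"
      unfolding \<eta>(2) has_field_derivative_def by (simp add: o_def mult.commute[of _ "h' _"])
    have "eventually (\<lambda>t. f (\<eta> t) = h (\<phi> (\<eta> t))) (nhds 0)"
      using curves_eventually_in[OF \<eta>(1) N(1,2)] by eventually_elim (rule N(3))
    from DERIV_cong_ev[OF refl this refl] d show ?thesis by blast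
  qed
  have "(THE d. \<forall>\<eta>\<in>v. ((\<lambda>t. f (\<eta> t)) has_real_derivative d) (at 0)) = h' (vector_derivative (\<phi> \<circ> \<gamma>)
    (at 0))"
    using D \<open>\<gamma> \<in> v\<close> by (intro the_equality) (auto intro: DERIV_unique)
  then show ?thesis unfolding differential_def v_def[symmetric] using vt by simp
qed

text \<open>Let \<open>z\<close> be the component of \<open>w\<close> orthogonal to
  \<open>V\<close>. The function \<open>z \<bullet> f t\<close> vanishes near \<open>a\<close>,
  hence \<open>z \<bullet> w = 0\<close> and \<open>z = 0\<close>.\<close>

lemma has_vector_derivative_in_subspace:
  fixes f :: "real \<Rightarrow> 'e::euclidean_space"
  assumes "subspace V" "(f has_vector_derivative w) (at a)" "eventually (\<lambda>t. f t \<in> V) (nhds a)"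
  shows "w \<in> V"
proof -
  obtain y z where yz: "y \<in> span V" "\<And>u. u \<in> span V \<Longrightarrow> orthogonal z u" "w = y + z"
    using orthogonal_subspace_decomp_exists[of V w] by metis
  have sV: "span V = V" using assms(1) by simp
  have "((\<lambda>t. z \<bullet> f t) has_derivative (\<lambda>t. z \<bullet> (t *\<^sub>R w))) (at a)"
    using assms(2) unfolding has_vector_derivative_def by (rule has_derivative_inner_right)
  then have "((\<lambda>t. z \<bullet> f t) has_real_derivative z \<bullet> w) (at a)"
    unfolding has_field_derivative_def by (simp add: mult.commute[of _ "z \<bullet> w"])
  moreover have "eventually (\<lambda>t. z \<bullet> f t = 0) (nhds a)"
    using assms(3) by eventually_elim (use yz(2) sV in \<open>auto simp: orthogonal_def\<close>)
  ultimately have "((\<lambda>t. 0) has_real_derivative z \<bullet> w) (at a)"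
    using DERIV_cong_ev[of a a "\<lambda>t. z \<bullet> f t" "\<lambda>t. 0" "z \<bullet> w" "z \<bullet> w"] by blast
  then have "z \<bullet> w = 0" using DERIV_const DERIV_unique by blast
  then have "z \<bullet> z = 0" using yz(1,2,3) by (simp add: inner_add_right orthogonal_def)
  then show ?thesis using yz(1,3) sV by simp
qed

text \<open>The curve is a straight line in the slice chart. Together with
  \<open>has_vector_derivative_in_subspace\<close> this identifies the velocities of curves in
  \<open>S\<close> with the vectors of \<open>V\<close>.\<close>

lemma slice_curve:
  assumes A: "smooth_atlas A" and U: "(U, \<phi>) \<in> charts A" and V: "subspace V" "\<phi> ` (U \<inter> S) = \<phi> ` U \<inter> V"
    and p: "p \<in> U \<inter> S" and w: "w \<in> V"
  obtains \<gamma> where "\<gamma> \<in> curves A S p" "vector_derivative (\<phi> \<circ> \<gamma>) (at 0) = w"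
proof -
  note cU = charts_is_chart[OF U]
  note u = is_chartD[OF cU]
  define L where "L t = \<phi> p + t *\<^sub>R w" for t
  have cL: "continuous_on UNIV L" unfolding L_def by (intro continuous_intros)
  have "open (L -` (\<phi> ` U))" using continuous_open_preimage[OF cL open_UNIV u(2)] by simp
  moreover have "0 \<in> L -` (\<phi> ` U)" using p by (simp add: L_def)
  ultimately obtain e where e: "e > 0" "ball 0 e \<subseteq> L -` (\<phi> ` U)" by (meson openE)
  have ball: "ball 0 e = {-e<..<e}" by (auto simp: dist_real_def)
  have LU: "L t \<in> \<phi> ` U" if "t \<in> {-e<..<e}" for t using e(2) that unfolding ball by blast
  define \<gamma> where "\<gamma> t = inv_into U \<phi> (L t)" for t
  have \<phi>\<gamma>: "\<phi> (\<gamma> t) = L t" "\<gamma> t \<in> U" if "t \<in> {-e<..<e}" for t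
    unfolding \<gamma>_def using LU[OF that] by (auto simp: f_inv_into_f inv_into_into)
  have \<gamma>0: "\<gamma> 0 = p" unfolding \<gamma>_def L_def using p u(3) by (simp add: inv_into_f_f)
  have LV: "L t \<in> V" for t
    unfolding L_def using V p w by (intro subspace_add subspace_scale) auto
  have \<gamma>S: "\<gamma> t \<in> S" if t: "t \<in> {-e<..<e}" for t
  proof -
    have "\<phi> (\<gamma> t) \<in> \<phi> ` (U \<inter> S)" unfolding V(2) using \<phi>\<gamma>[OF t] LU[OF t] LV by auto
    then obtain s where "s \<in> U" "s \<in> S" "\<phi> (\<gamma> t) = \<phi> s" by blast
    then show ?thesis using u(3) \<phi>\<gamma>(2)[OF t] by (metis inj_onD)
  qed
  have c\<gamma>: "continuous_on {-e<..<e} \<gamma>"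
    unfolding \<gamma>_def using LU by (intro continuous_on_compose2[OF u(5)] continuous_on_subset[OF cL]) auto
  have "Ck_on k ({-e<..<e} \<inter> \<gamma> -` U') (\<phi>' \<circ> \<gamma>)" if U': "(U', \<phi>') \<in> charts A" for U' \<phi>' k
  proof -
    note cU' = charts_is_chart[OF U']
    define I where "I = {-e<..<e} \<inter> \<gamma> -` U'"
    have oI: "open I" unfolding I_def
      by (rule continuous_open_preimage[OF c\<gamma> _ is_chartD(1)[OF cU']]) simp
    have sL: "Ck_on k I L" unfolding L_def
      by (intro Ck_on_add[OF oI] Ck_on_const Ck_on_linear[OF oI] bounded_linear_scaleR_left)
    have "Ck_on k I ((\<phi>' \<circ> inv_into U \<phi>) \<circ> L)"
    proof (rule Ck_on_compose[OF oI is_chart_open_image[OF cU is_chartD(1)[OF cU']] _ sL])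
      show "Ck_on k (\<phi> ` (U \<inter> U')) (\<phi>' \<circ> inv_into U \<phi>)" by (rule charts_transition_smooth[OF A U U'])
      show "L ` I \<subseteq> \<phi> ` (U \<inter> U')"
      proof
        fix z assume "z \<in> L ` I"
        then obtain t where t: "t \<in> {-e<..<e}" "\<gamma> t \<in> U'" "z = L t" unfolding I_def by blast
        then show "z \<in> \<phi> ` (U \<inter> U')" using \<phi>\<gamma>[OF t(1)] by (metis IntI imageI)
      qed
    qed
    then show ?thesis unfolding I_def[symmetric] by (simp add: o_def \<gamma>_def[abs_def])
  qed
  then have "\<gamma> \<in> curves A S p"
    unfolding curves_def smooth_on_def using \<gamma>0 e(1) \<gamma>S c\<gamma> by (intro CollectI conjI exI[of _ e]) auto
  moreover have "vector_derivative (\<phi> \<circ> \<gamma>) (at 0) = w"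
  proof (rule vector_derivative_at)
    have "(L has_vector_derivative w) (at 0)"
      unfolding L_def by (auto intro!: derivative_eq_intros)
    then show "(\<phi> \<circ> \<gamma> has_vector_derivative w) (at 0)"
      by (rule has_vector_derivative_transform_within_open[of _ _ _ "{-e<..<e}"]) (use e(1) \<phi>\<gamma> in auto)
  qed
  ultimately show ?thesis using that by blast
qed

lemma embedded_submanifold_slice:
  assumes "embedded_submanifold d A S" "p \<in> S"
  obtains U \<phi> V where "(U, \<phi>) \<in> charts A" "p \<in> U" "subspace V" "dim V = d" "\<phi> ` (U \<inter> S) = \<phi> ` U \<inter> V"
proof -
  obtain \<kappa> V where "\<kappa> \<in> charts A" "case \<kappa> of (U, \<phi>) \<Rightarrow> p \<in> U \<and> subspace V \<and> dim V = d \<and>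
    \<phi> ` (U \<inter> S) = \<phi> ` U \<inter> V"
    using assms unfolding embedded_submanifold_def case_prod_unfold by blast
  moreover obtain U \<phi> where "\<kappa> = (U, \<phi>)" by (cases \<kappa>)
  ultimately show ?thesis using that[of U \<phi> V] by simp
qed

text \<open>In a slice chart \<open>S\<close> is the preimage of a closed subspace, so it is
  relatively closed in the chart domain; by the Lindelof property countably many such domains cover
  \<open>S\<close>.\<close>

lemma embedded_submanifold_borel:
  fixes S :: "'a::second_countable_topology set"
  assumes "embedded_submanifold d A S"
  shows "S \<in> sets borel"
proof -
  define \<F> where "\<F> = {U. open U \<and> U \<inter> S \<in> sets borel}"
  have sub: "S \<subseteq> \<Union>\<F>"
  proof
    fix p assume "p \<in> S"
    then obtain U \<phi> V where U: "(U, \<phi>) \<in> charts A" "p \<in> U" "subspace V" "\<phi> ` (U \<inter> S) = \<phi> ` U \<inter> V"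
      using embedded_submanifold_slice[OF assms] by metis
    note cU = charts_is_chart[OF U(1)]
    have "x \<in> S" if x: "x \<in> U" "\<phi> x \<in> V" for x
    proof -
      have "\<phi> x \<in> \<phi> ` (U \<inter> S)" unfolding U(4) using x by blast
      then obtain s where "s \<in> U" "s \<in> S" "\<phi> x = \<phi> s" by blast
      with x is_chartD(3)[OF cU] show ?thesis by (metis inj_onD)
    qed
    then have "U \<inter> S = U - (U \<inter> \<phi> -` (- V))" using U(4) by blast
    moreover have "open (U \<inter> \<phi> -` (- V))"
      using closed_subspace[OF U(3)] by (intro is_chart_open_preimage[OF cU]) (simp add: open_Compl)
    ultimately have "U \<inter> S \<in> sets borel" using borel_open is_chartD(1)[OF cU] by (metis sets.Diff)
    then show "p \<in> \<Union>\<F>" using U(2) is_chartD(1)[OF cU] unfolding \<F>_def by blast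
  qed
  obtain \<G> where G: "\<G> \<subseteq> \<F>" "countable \<G>" "\<Union>\<G> = \<Union>\<F>"
    using Lindelof[of \<F>] unfolding \<F>_def by blast
  have "S = (\<Union>U\<in>\<G>. U \<inter> S)" using sub unfolding G(3)[symmetric] by auto
  also have "\<dots> \<in> sets borel" using G(1,2) unfolding \<F>_def by (intro sets.countable_UN') auto
  finally show ?thesis .
qed

text \<open>A regularity notion shared by \<open>c x\<close>, which is inherited from a function on
  a product, and by \<open>b z\<close>, which is only of class \<open>C^1\<close> on
  \<open>Y\<close>. It provides what the chart formula for differentials requires.\<close>

definition chart_differentiable ::
  "('a::topological_space, 'e::euclidean_space) chart set \<Rightarrow> 'a set \<Rightarrow> ('a \<Rightarrow> real) \<Rightarrow> bool" where
  "chart_differentiable A S f \<longleftrightarrow> (\<forall>p\<in>S. \<forall>(U, \<phi>)\<in>charts A. p \<in> U \<longrightarrow>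
     (\<exists>N h. open N \<and> p \<in> N \<and> N \<subseteq> U \<and> (\<forall>q\<in>N. h differentiable (at (\<phi> q))) \<and> (\<forall>q\<in>S \<inter> N. f q = h (\<phi> q))))"

lemma chart_differentiableE:
  assumes "chart_differentiable A S f" "p \<in> S" "(U, \<phi>) \<in> charts A" "p \<in> U"
  obtains N h where "open N" "p \<in> N" "N \<subseteq> U" "\<And>q. q \<in> N \<Longrightarrow> h differentiable (at (\<phi> q))"
    "\<And>q. q \<in> S \<inter> N \<Longrightarrow> f q = h (\<phi> q)"
proof -
  have "\<exists>N h. open N \<and> p \<in> N \<and> N \<subseteq> U \<and> (\<forall>q\<in>N. h differentiable (at (\<phi> q))) \<and> (\<forall>q\<in>S \<inter> N. f q = h (\<phi> q))"
    using assms unfolding chart_differentiable_def by fast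
  then show ?thesis using that by blast
qed

lemma Ck_imp_chart_differentiable:
  assumes "Ck (Suc k) A S f"
  shows "chart_differentiable A S f"
  unfolding chart_differentiable_def
proof (intro ballI, clarify)
  fix p U \<phi> assume "p \<in> S" "(U, \<phi>) \<in> charts A" "p \<in> U"
  then obtain N h where N: "open N" "p \<in> N" "N \<subseteq> U" "Ck_on (Suc k) (\<phi> ` N) h" "\<And>q. q \<in> S \<inter> N \<Longrightarrow>
    f q = h (\<phi> q)"
    using Ck_local_representative[OF assms] by metis
  have "\<forall>q\<in>N. h differentiable (at (\<phi> q))" using N(4) by simp
  with N show "\<exists>N h. open N \<and> p \<in> N \<and> N \<subseteq> U \<and> (\<forall>q\<in>N. h differentiable (at (\<phi> q))) \<and>
    (\<forall>q\<in>S \<inter> N. f q = h (\<phi> q))"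
    by (intro exI[of _ N] exI[of _ h]) simp
qed

lemma Ck_prod_imp_chart_differentiable_right:
  assumes A: "smooth_atlas A" and B: "smooth_atlas B"
    and c: "Ck (Suc k) (prod_atlas A B) (S \<times> T) (\<lambda>(x, y). c x y)" and x: "x \<in> S" and Y: "Y \<subseteq> T"
  shows "chart_differentiable B Y (c x)"
  unfolding chart_differentiable_def
proof (intro ballI, clarify)
  fix p V \<psi> assume p: "p \<in> Y" "(V, \<psi>) \<in> charts B" "p \<in> V"
  obtain U \<phi> where U0: "(U, \<phi>) \<in> A" "x \<in> U" using atlas_chart_at[OF A] by metis
  then have U: "(U, \<phi>) \<in> charts A" using atlas_subset_charts[OF A] by blast
  obtain N M h where N: "open N" "x \<in> N" "N \<subseteq> U" "open M" "p \<in> M" "M \<subseteq> V"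
    "Ck_on (Suc k) (\<phi> ` N \<times> \<psi> ` M) h" "\<And>x' y'. x' \<in> S \<inter> N \<Longrightarrow> y' \<in> T \<inter> M \<Longrightarrow> c x' y' = h (\<phi> x', \<psi> y')"
    by (rule Ck_prod_local_representative[OF A B c x _ U p(2) U0(2) p(3)]) (use p Y in auto)
  have "(\<lambda>z. h (\<phi> x, z)) differentiable (at (\<psi> q))" if q: "q \<in> M" for q
  proof -
    have "h differentiable (at (\<phi> x, \<psi> q))" using N(2,7) q by simp
    then obtain h' where "(h has_derivative h') (at (\<phi> x, \<psi> q))" unfolding differentiable_def by blast
    moreover have "((\<lambda>z. (\<phi> x, z)) has_derivative (\<lambda>z. (0, z))) (at (\<psi> q))"
      by (intro has_derivative_Pair has_derivative_const has_derivative_ident)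
    ultimately have "(h \<circ> (\<lambda>z. (\<phi> x, z)) has_derivative h' \<circ> (\<lambda>z. (0, z))) (at (\<psi> q))"
      by (intro diff_chain_at) auto
    then show ?thesis unfolding differentiable_def o_def by blast
  qed
  moreover have "\<forall>q\<in>Y \<inter> M. c x q = h (\<phi> x, \<psi> q)" using N(2,8) x Y by blast
  ultimately show "\<exists>N h. open N \<and> p \<in> N \<and> N \<subseteq> V \<and> (\<forall>q\<in>N. h differentiable (at (\<psi> q))) \<and>
    (\<forall>q\<in>Y \<inter> N. c x q = h (\<psi> q))"
    using N(4,5,6) by (intro exI[of _ M] exI[of _ "\<lambda>z. h (\<phi> x, z)"]) simp
qed

text \<open>A ball and a subspace are convex, so in a slice chart the segment from \<open>p\<close>
  to \<open>q\<close> remains in the image of \<open>S\<close>. Its direction is at each point the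
  velocity of a curve in \<open>S\<close>; equality of the differentials thus makes the derivative
  of the difference along the segment vanish.\<close>

lemma equal_differential_imp_locally_constant_diff:
  assumes A: "smooth_atlas A" and S: "embedded_submanifold d A S"
    and f: "chart_differentiable A S f" and g: "chart_differentiable A S g"
    and eq: "\<And>p. p \<in> S \<Longrightarrow> differential A S p f = differential A S p g" and p: "p \<in> S"
  shows "\<exists>W. open W \<and> p \<in> W \<and> (\<forall>q\<in>S \<inter> W. f q - g q = f p - g p)"
proof -
  obtain U \<phi> V where U: "(U, \<phi>) \<in> charts A" "p \<in> U" "subspace V" "\<phi> ` (U \<inter> S) = \<phi> ` U \<inter> V"
    using embedded_submanifold_slice[OF S p] by metis
  note cU = charts_is_chart[OF U(1)]
  note u = is_chartD[OF cU]
  obtain N hf where N: "open N" "p \<in> N" "N \<subseteq> U" "\<And>q. q \<in> N \<Longrightarrow> hf differentiable (at (\<phi> q))"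
    "\<And>q. q \<in> S \<inter> N \<Longrightarrow> f q = hf (\<phi> q)" by (rule chart_differentiableE[OF f p U(1,2)]) blast
  obtain M hg where M: "open M" "p \<in> M" "M \<subseteq> U" "\<And>q. q \<in> M \<Longrightarrow> hg differentiable (at (\<phi> q))"
    "\<And>q. q \<in> S \<inter> M \<Longrightarrow> g q = hg (\<phi> q)" by (rule chart_differentiableE[OF g p U(1,2)]) blast
  have "open (\<phi> ` (U \<inter> (N \<inter> M)))" by (intro is_chart_open_image[OF cU] open_Int N(1) M(1))
  then obtain e where e: "e > 0" "ball (\<phi> p) e \<subseteq> \<phi> ` (U \<inter> (N \<inter> M))"
    using U(2) N(2) M(2) by (metis IntI imageI openE)
  define W where "W = U \<inter> \<phi> -` ball (\<phi> p) e"
  have const: "f q - g q = f p - g p" if q: "q \<in> S \<inter> W" for q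
  proof -
    define w where "w = \<phi> q - \<phi> p"
    have pqV: "\<phi> p \<in> V" "\<phi> q \<in> V" using U(2,4) p q unfolding W_def by blast+
    have wV: "w \<in> V" unfolding w_def by (intro subspace_diff U(3) pqV)
    define L where "L s = \<phi> p + s *\<^sub>R w" for s
    have qb: "norm w < e" using q unfolding W_def w_def by (simp add: dist_norm norm_minus_commute)
    have L: "\<exists>r\<in>S \<inter> (N \<inter> M). \<phi> r = L s" if s: "s \<in> {0..1}" for s
    proof -
      have "norm (s *\<^sub>R w) \<le> norm w" using s by (simp add: mult_left_le_one_le)
      then have "L s \<in> ball (\<phi> p) e" using qb unfolding L_def by (simp add: dist_norm)
      then obtain r where r: "r \<in> U" "r \<in> N \<inter> M" "L s = \<phi> r" using e(2) by blast
      have "L s \<in> V" unfolding L_def by (intro subspace_add subspace_scale U(3) pqV wV)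
      then have "\<phi> r \<in> \<phi> ` (U \<inter> S)" unfolding U(4) using r by auto
      then have "r \<in> S" using u(3) r(1) by (metis IntD1 IntD2 imageE inj_onD)
      with r show ?thesis by auto
    qed
    have D: "((\<lambda>s. hf (L s) - hg (L s)) has_real_derivative 0) (at s)" if s: "s \<in> {0..1}" for s
    proof -
      obtain r where r: "r \<in> S" "r \<in> N" "r \<in> M" "\<phi> r = L s" using L[OF s] by blast
      obtain hf' where hf': "(hf has_derivative hf') (at (\<phi> r))" using N(4)[OF r(2)]
        unfolding differentiable_def by blast
      obtain hg' where hg': "(hg has_derivative hg') (at (\<phi> r))" using M(4)[OF r(3)]
        unfolding differentiable_def by blast
      have rU: "r \<in> U" using r N(3) by blast
      obtain \<gamma> where \<gamma>: "\<gamma> \<in> curves A S r" "vector_derivative (\<phi> \<circ> \<gamma>) (at 0) = w"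
        using slice_curve[OF A U(1,3,4) _ wV, of r] rU r(1) by blast
      have "hf' w = hg' w"
        using differential_eq_chart_derivative[OF \<gamma>(1) U(1) rU N(1) r(2) N(5) hf']
          differential_eq_chart_derivative[OF \<gamma>(1) U(1) rU M(1) r(3) M(5) hg'] eq[OF r(1)] \<gamma>(2) by simp
      interpret F: bounded_linear hf' using hf' by (rule has_derivative_bounded_linear)
      interpret G: bounded_linear hg' using hg' by (rule has_derivative_bounded_linear)
      have dL: "(L has_derivative (\<lambda>t. t *\<^sub>R w)) (at s)"
        unfolding L_def by (auto intro!: derivative_eq_intros)
      have "((\<lambda>s. hf (L s)) has_derivative (\<lambda>t. hf' (t *\<^sub>R w))) (at s)"
        using diff_chain_at[OF dL, of hf hf'] hf' r(4) by (simp add: o_def)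
      moreover have "((\<lambda>s. hg (L s)) has_derivative (\<lambda>t. hg' (t *\<^sub>R w))) (at s)"
        using diff_chain_at[OF dL, of hg hg'] hg' r(4) by (simp add: o_def)
      ultimately have "((\<lambda>s. hf (L s) - hg (L s)) has_derivative (\<lambda>t. hf' (t *\<^sub>R w) - hg' (t *\<^sub>R
        w))) (at s)"
        by (rule has_derivative_diff)
      moreover have "(\<lambda>t. hf' (t *\<^sub>R w) - hg' (t *\<^sub>R w)) = (*) 0"
        using \<open>hf' w = hg' w\<close> by (auto simp: F.scaleR G.scaleR)
      ultimately show ?thesis unfolding has_field_derivative_def by simp
    qed
    have "hf (L 1) - hg (L 1) = hf (L 0) - hg (L 0)"
    proof (rule DERIV_isconst_end[of 0 1 "\<lambda>s. hf (L s) - hg (L s)"])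
      show "continuous_on {0..1} (\<lambda>s. hf (L s) - hg (L s))"
        by (intro continuous_at_imp_continuous_on ballI DERIV_isCont[OF D])
      show "((\<lambda>s. hf (L s) - hg (L s)) has_real_derivative 0) (at s)" if "0 < s" "s < 1" for s
        using D that by simp
    qed simp
    moreover have "L 0 = \<phi> p" "L 1 = \<phi> q" unfolding L_def w_def by simp_all
    moreover have "q \<in> N \<inter> M"
    proof -
      have "\<phi> q \<in> \<phi> ` (U \<inter> (N \<inter> M))" "q \<in> U" using q e(2) unfolding W_def by auto
      then obtain r where r: "\<phi> q = \<phi> r" "r \<in> U" "r \<in> N \<inter> M" by blast
      from inj_onD[OF u(3) r(1) \<open>q \<in> U\<close> r(2)] r(3) show ?thesis by simp
    qed
    ultimately show ?thesis using N(2,5) M(2,5) p q by simp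
  qed
  have "open W" unfolding W_def by (rule is_chart_open_preimage[OF cU]) simp
  moreover have "p \<in> W" unfolding W_def using U(2) e(1) by simp
  ultimately show ?thesis using const by blast
qed

lemma equal_differential_imp_constant_diff:
  assumes A: "smooth_atlas A" and S: "embedded_submanifold d A S" "connected S"
    and f: "chart_differentiable A S f" and g: "chart_differentiable A S g"
    and eq: "\<And>p. p \<in> S \<Longrightarrow> differential A S p f = differential A S p g" and pq: "p \<in> S" "q \<in> S"
  shows "f q - g q = f p - g p"
proof (rule connected_local_const[OF S(2) pq(2,1)], intro ballI)
  fix r assume "r \<in> S"
  from equal_differential_imp_locally_constant_diff[OF A S(1) f g eq this]
  obtain W where "open W" "r \<in> W" "\<forall>q\<in>S \<inter> W. f q - g q = f r - g r" by blast
  then show "eventually (\<lambda>q. f r - g r = f q - g q) (at r within S)"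
    unfolding eventually_at_topological by (intro exI[of _ W]) simp
qed


section \<open>Points with several minimisers\<close>

text \<open>\<open>\<pi>\<close> is the projection along \<open>w\<close> onto the kernel of
  \<open>G\<close> in \<open>V\<close>. The strict drop in dimension is the source of the bound
  \<open>m - 1\<close>.\<close>

lemma kernel_slice:
  fixes V :: "'e::euclidean_space set"
  assumes V: "subspace V" and G: "bounded_linear (G :: 'e \<Rightarrow> real)" and w: "w \<in> V" "G w \<noteq> 0"
  defines "\<pi> \<equiv> \<lambda>d. d - (G d / G w) *\<^sub>R w"
  shows "subspace {d\<in>V. G d = 0}" "dim {d\<in>V. G d = 0} < dim V"
    "d \<in> V \<Longrightarrow> \<pi> d \<in> {d\<in>V. G d = 0}" "bounded_linear \<pi>"
proof -
  interpret G: bounded_linear G by fact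
  show sub: "subspace {d\<in>V. G d = 0}"
    using V unfolding subspace_def by (auto simp: G.add G.scaleR G.zero)
  have "{d\<in>V. G d = 0} \<subset> V" using w by blast
  then show "dim {d\<in>V. G d = 0} < dim V"
    using dim_psubset[of "{d\<in>V. G d = 0}" V] sub V by (simp add: span_eq_iff[THEN iffD2])
  show "\<pi> d \<in> {d\<in>V. G d = 0}" if "d \<in> V"
    unfolding \<pi>_def using V w that by (auto simp: G.diff G.scaleR intro: subspace_diff subspace_scale)
  show "bounded_linear \<pi>"
  proof -
    have "\<pi> = (\<lambda>d. d - G d *\<^sub>R ((1 / G w) *\<^sub>R w))" unfolding \<pi>_def by simp
    moreover have "bounded_linear (\<lambda>d. G d *\<^sub>R ((1 / G w) *\<^sub>R w))"
      by (rule bounded_linear_scaleR_const[OF G])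
    ultimately show ?thesis by (simp add: bounded_linear_sub bounded_linear_ident)
  qed
qed

text \<open>Strict differentiability in the pair is applied to two points with the same second
  component, so only the partial derivative at \<open>(p, q)\<close> remains, uniformly for
  \<open>y\<close> near \<open>q\<close>. Halving the radius puts the product of balls inside the
  ball of the product.\<close>

lemma C1_prod_strictly_differentiable:
  fixes h :: "'e::euclidean_space \<times> 'f::euclidean_space \<Rightarrow> real"
  assumes S: "open S" and T: "open T" and h: "Ck_on (Suc 0) (S \<times> T) h" and p: "p \<in> S" "q \<in> T"
  obtains D where "bounded_linear D" "((\<lambda>x. h (x, q)) has_derivative D) (at p)"
    "\<And>\<epsilon>. \<epsilon> > 0 \<Longrightarrow> \<exists>r>0. \<forall>x\<in>ball p r. \<forall>x'\<in>ball p r. \<forall>y\<in>ball q r. \<bar>h (x', y) - h (x, y) - D (x' - x)\<bar> \<le>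
      \<epsilon> * norm (x' - x)"
proof -
  obtain h' where h': "(h has_derivative h') (at (p, q))"
    "\<And>\<epsilon>. \<epsilon> > 0 \<Longrightarrow> \<exists>r>0. ball (p, q) r \<subseteq> S \<times> T \<and> (\<forall>y\<in>ball (p, q) r. \<forall>z\<in>ball (p, q) r. norm (h z - h y
      - h' (z - y)) \<le> \<epsilon> * norm (z - y))"
    by (rule C1_strictly_differentiable[OF open_Times[OF S T] h, of "(p, q)"]) (use p in auto)
  define D where "D d = h' (d, 0)" for d
  have inc: "((\<lambda>x. (x, q)) has_derivative (\<lambda>d. (d, 0))) (at p)"
    by (intro has_derivative_Pair has_derivative_const has_derivative_ident)
  have D: "((\<lambda>x. h (x, q)) has_derivative D) (at p)"
    using diff_chain_at[OF inc, of h h'] h'(1) by (simp add: o_def D_def[abs_def])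
  show ?thesis
  proof (rule that[OF has_derivative_bounded_linear[OF D] D])
    fix \<epsilon> :: real assume "\<epsilon> > 0"
    from h'(2)[OF this] obtain r where r: "r > 0"
      "\<forall>y\<in>ball (p, q) r. \<forall>z\<in>ball (p, q) r. norm (h z - h y - h' (z - y)) \<le> \<epsilon> * norm (z - y)" by blast
    have "\<bar>h (x', y) - h (x, y) - D (x' - x)\<bar> \<le> \<epsilon> * norm (x' - x)"
      if "x \<in> ball p (r / 2)" "x' \<in> ball p (r / 2)" "y \<in> ball q (r / 2)" for x x' y
    proof -
      have in_ball: "(z, y) \<in> ball (p, q) r" if "z \<in> ball p (r / 2)" for z
      proof -
        have "dist (p, q) (z, y) \<le> dist p z + dist q y"
          unfolding dist_prod_def by (simp add: sqrt_sum_squares_le_sum)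
        then show ?thesis using that \<open>y \<in> ball q (r / 2)\<close> by simp
      qed
      have "norm (h (x', y) - h (x, y) - h' ((x', y) - (x, y))) \<le> \<epsilon> * norm ((x', y) - (x, y))"
        using r(2) in_ball that(1,2) by blast
      then show ?thesis by (simp add: D_def norm_Pair)
    qed
    then show "\<exists>r>0. \<forall>x\<in>ball p r. \<forall>x'\<in>ball p r. \<forall>y\<in>ball q r. \<bar>h (x', y) - h (x, y) - D (x' - x)\<bar> \<le> \<epsilon>
      * norm (x' - x)"
      using r(1) by (intro exI[of _ "r / 2"]) simp
  qed
qed

text \<open>Strict differentiability with error constant 1. It serves to pass from a slice chart to
  an arbitrary chart.\<close>

lemma C1_locally_lipschitz:
  fixes f :: "'e::euclidean_space \<Rightarrow> 'g::real_normed_vector"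
  assumes "open S" "Ck_on (Suc 0) S f" "p \<in> S"
  obtains r L where "r > 0" "L \<ge> 0" "\<And>x y. x \<in> ball p r \<Longrightarrow> y \<in> ball p r \<Longrightarrow>
    norm (f x - f y) \<le> L * norm (x - y)"
proof -
  obtain f' where f': "(f has_derivative f') (at p)"
    "\<And>\<epsilon>. \<epsilon> > 0 \<Longrightarrow> \<exists>r>0. ball p r \<subseteq> S \<and> (\<forall>y\<in>ball p r. \<forall>z\<in>ball p r. norm (f z - f y - f' (z - y)) \<le> \<epsilon> *
      norm (z - y))"
    by (rule C1_strictly_differentiable[OF assms]) blast
  obtain r where r: "r > 0" "\<forall>y\<in>ball p r. \<forall>z\<in>ball p r. norm (f z - f y - f' (z - y)) \<le> 1 * norm (z - y)"
    using f'(2)[of 1] by auto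
  have bl: "bounded_linear f'" using f'(1) by (rule has_derivative_bounded_linear)
  show ?thesis
  proof (rule that[of r "onorm f' + 1"])
    show "onorm f' + 1 \<ge> 0" using onorm_pos_le[OF bl] by simp
    fix x y assume "x \<in> ball p r" "y \<in> ball p r"
    then have "norm (f x - f y - f' (x - y)) \<le> norm (x - y)" using r(2) by simp
    moreover have "norm (f' (x - y)) \<le> onorm f' * norm (x - y)" by (rule onorm[OF bl])
    moreover have "norm (f x - f y) \<le> norm (f x - f y - f' (x - y)) + norm (f' (x - y))"
      using norm_triangle_ineq[of "f x - f y - f' (x - y)" "f' (x - y)"] by simp
    ultimately show "norm (f x - f y) \<le> (onorm f' + 1) * norm (x - y)" by (simp add: algebra_simps)
  qed (rule r(1))
qed

text \<open>Both covectors are \<open>undefined\<close> off the tangent space, so the twist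
  condition yields a tangent vector on which they differ. The velocity of a representing curve, read
  in the slice chart, lies in \<open>V\<close>.\<close>

lemma twisted_derivatives_differ:
  assumes tw: "twisted A X K c" and x: "x \<in> X" and y: "y1 \<in> K" "y2 \<in> K" "y1 \<noteq> y2"
    and U: "(U, \<phi>) \<in> charts A" "x \<in> U" and V: "subspace V" "\<phi> ` (U \<inter> X) = \<phi> ` U \<inter> V"
    and N1: "open N1" "x \<in> N1" "\<And>q. q \<in> X \<inter> N1 \<Longrightarrow> c q y1 = h1 (\<phi> q)" "(h1 has_derivative D1) (at (\<phi> x))"
    and N2: "open N2" "x \<in> N2" "\<And>q. q \<in> X \<inter> N2 \<Longrightarrow> c q y2 = h2 (\<phi> q)" "(h2 has_derivative D2) (at (\<phi> x))"
  obtains w where "w \<in> V" "D1 w \<noteq> D2 w"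
proof -
  have "differential A X x (\<lambda>x'. c x' y1) \<noteq> differential A X x (\<lambda>x'. c x' y2)"
    using tw x y unfolding twisted_def inj_on_def by blast
  then obtain v where v: "differential A X x (\<lambda>x'. c x' y1) v \<noteq> differential A X x (\<lambda>x'. c x' y2) v"
    by blast
  have "v \<in> tangent_space A X x"
  proof (rule ccontr)
    assume "v \<notin> tangent_space A X x"
    then show False using v unfolding differential_def by simp
  qed
  then obtain \<gamma> where \<gamma>: "\<gamma> \<in> curves A X x" "v = same_velocity A X x `` {\<gamma>}"
    unfolding tangent_space_def by (rule quotientE)
  define w where "w = vector_derivative (\<phi> \<circ> \<gamma>) (at 0)"
  have "D1 w \<noteq> D2 w"
    using v differential_eq_chart_derivative[OF \<gamma>(1) U N1(1,2) _ N1(4), of "\<lambda>x'. c x' y1"] N1(3)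
      differential_eq_chart_derivative[OF \<gamma>(1) U N2(1,2) _ N2(4), of "\<lambda>x'. c x' y2"] N2(3)
    unfolding \<gamma>(2) w_def by auto
  moreover have "w \<in> V"
  proof (rule has_vector_derivative_in_subspace[OF V(1)])
    show "(\<phi> \<circ> \<gamma> has_vector_derivative w) (at 0)" unfolding w_def by (rule curve_has_velocity[OF \<gamma>(1) U])
    have "open U" using U(1) charts_is_chart is_chartD(1) by blast
    from curves_eventually_in[OF \<gamma>(1) this U(2)]
    show "eventually (\<lambda>t. (\<phi> \<circ> \<gamma>) t \<in> V) (nhds 0)"
    proof eventually_elim
      case (elim t)
      then have "\<phi> (\<gamma> t) \<in> \<phi> ` (U \<inter> X)" by blast
      then show ?case unfolding V(2) by simp
    qed
  qed
  ultimately show ?thesis using that by blast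
qed

text \<open>
  If \<open>a\<^sub>i\<close> and \<open>b\<^sub>i\<close> are minimisers at \<open>x\<close> and \<open>x'\<close>, both close to \<open>y\<^sub>i\<close>, the last two premises
  hold by minimality, and they force \<open>D\<^sub>xc(x\<^sub>0,y\<^sub>1) - D\<^sub>xc(x\<^sub>0,y\<^sub>2)\<close> to be small on the displacement from
  \<open>x\<close> to \<open>x'\<close>.
\<close>

lemma twisted_local_graph:
  fixes A :: "('a::{t2_space, second_countable_topology}, 'e::euclidean_space) chart set"
    and B :: "('b::{t2_space, second_countable_topology}, 'f::euclidean_space) chart set"
  assumes A: "smooth_atlas A" and B: "smooth_atlas B" and X: "embedded_submanifold m A X" and XS: "X \<subseteq> S"
    and c: "Ck (Suc k) (prod_atlas A B) (S \<times> K) (\<lambda>(x, y). c x y)"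
    and tw: "twisted A X K c" and x0: "x0 \<in> X" and y: "y1 \<in> K" "y2 \<in> K" "y1 \<noteq> y2"
    and U': "(U', \<phi>') \<in> charts A" "x0 \<in> U'"
  obtains N M1 M2 and f :: "'a \<Rightarrow> 'e" and H C where "open N" "open M1" "open M2"
    "x0 \<in> N" "y1 \<in> M1" "y2 \<in> M2"
    "N \<subseteq> U'" "subspace H" "dim H < m" "bounded (f ` (X \<inter> N))" "f ` (X \<inter> N) \<subseteq> H"
    "\<And>x x' a1 a2 b1 b2. x \<in> X \<inter> N \<Longrightarrow> x' \<in> X \<inter> N \<Longrightarrow>
       a1 \<in> K \<inter> M1 \<Longrightarrow> b1 \<in> K \<inter> M1 \<Longrightarrow> a2 \<in> K \<inter> M2 \<Longrightarrow> b2 \<in> K \<inter> M2 \<Longrightarrow>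
       c x' b1 - c x b1 \<le> c x' a2 - c x a2 \<Longrightarrow> c x a1 - c x' a1 \<le> c x b2 - c x' b2 \<Longrightarrow>
       norm (\<phi>' x - \<phi>' x') \<le> C * norm (f x - f x')"
proof -
  \<comment> \<open>The estimates are made in a slice chart, where \<open>X\<close> is a piece of a
    subspace. The conclusion concerns the given chart \<open>\<phi>'\<close>, since
    \<open>manifold_hausdorff_dim\<close> looks at all charts; the Lipschitz constant
    \<open>L\<close> of the transition connects the two.\<close>
  obtain U \<phi> V where U: "(U, \<phi>) \<in> charts A" "x0 \<in> U" "subspace V" "dim V = m" "\<phi> ` (U \<inter> X) = \<phi> ` U \<inter> V"
    using embedded_submanifold_slice[OF X x0] by metis
  note cU = charts_is_chart[OF U(1)]
  note cU' = charts_is_chart[OF U'(1)]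
  have x0S: "x0 \<in> S" using x0 XS by blast
  obtain W1 \<psi>1 where W1: "(W1, \<psi>1) \<in> charts B" "y1 \<in> W1"
    using atlas_chart_at[OF B, of y1] subsetD[OF atlas_subset_charts[OF B]] by metis
  obtain W2 \<psi>2 where W2: "(W2, \<psi>2) \<in> charts B" "y2 \<in> W2"
    using atlas_chart_at[OF B, of y2] subsetD[OF atlas_subset_charts[OF B]] by metis
  obtain N1 O1 h1 where N1: "open N1" "x0 \<in> N1" "N1 \<subseteq> U" "open O1" "y1 \<in> O1" "O1 \<subseteq> W1"
    "Ck_on (Suc k) (\<phi> ` N1 \<times> \<psi>1 ` O1) h1"
    "\<And>x' y'. x' \<in> S \<inter> N1 \<Longrightarrow> y' \<in> K \<inter> O1 \<Longrightarrow> c x' y' = h1 (\<phi> x', \<psi>1 y')"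
    by (rule Ck_prod_local_representative[OF A B c x0S y(1) U(1) W1(1) U(2) W1(2)]; rule that)
  obtain N2 O2 h2 where N2: "open N2" "x0 \<in> N2" "N2 \<subseteq> U" "open O2" "y2 \<in> O2" "O2 \<subseteq> W2"
    "Ck_on (Suc k) (\<phi> ` N2 \<times> \<psi>2 ` O2) h2"
    "\<And>x' y'. x' \<in> S \<inter> N2 \<Longrightarrow> y' \<in> K \<inter> O2 \<Longrightarrow> c x' y' = h2 (\<phi> x', \<psi>2 y')"
    by (rule Ck_prod_local_representative[OF A B c x0S y(2) U(1) W2(1) U(2) W2(2)]; rule that)
  note cW1 = charts_is_chart[OF W1(1)] and cW2 = charts_is_chart[OF W2(1)]
  have image_open: "open (\<phi> ` N)" if "open N" "N \<subseteq> U" for N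
    using is_chart_open_image[OF cU that(1)] that(2) by (simp add: Int_absorb1)
  have oO1: "open (\<psi>1 ` O1)" using is_chart_open_image[OF cW1 N1(4)] N1(6) by (simp add: Int_absorb1)
  have oO2: "open (\<psi>2 ` O2)" using is_chart_open_image[OF cW2 N2(4)] N2(6) by (simp add: Int_absorb1)
  have C1: "Ck_on (Suc 0) (\<phi> ` N1 \<times> \<psi>1 ` O1) h1" "Ck_on (Suc 0) (\<phi> ` N2 \<times> \<psi>2 ` O2) h2"
    by (rule Ck_on_mono[OF N1(7)] Ck_on_mono[OF N2(7)], simp)+
  obtain D1 where D1: "bounded_linear D1" "((\<lambda>x. h1 (x, \<psi>1 y1)) has_derivative D1) (at (\<phi> x0))"
    "\<And>\<epsilon>. \<epsilon> > 0 \<Longrightarrow> \<exists>r>0. \<forall>x\<in>ball (\<phi> x0) r. \<forall>x'\<in>ball (\<phi> x0) r. \<forall>y\<in>ball (\<psi>1 y1) r.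
      \<bar>h1 (x', y) - h1 (x, y) - D1 (x' - x)\<bar> \<le> \<epsilon> * norm (x' - x)"
    by (rule C1_prod_strictly_differentiable[OF image_open[OF N1(1,3)] oO1 C1(1), of "\<phi> x0" "\<psi>1 y1"])
      (use N1(2,5) in auto)
  obtain D2 where D2: "bounded_linear D2" "((\<lambda>x. h2 (x, \<psi>2 y2)) has_derivative D2) (at (\<phi> x0))"
    "\<And>\<epsilon>. \<epsilon> > 0 \<Longrightarrow> \<exists>r>0. \<forall>x\<in>ball (\<phi> x0) r. \<forall>x'\<in>ball (\<phi> x0) r. \<forall>y\<in>ball (\<psi>2 y2) r.
      \<bar>h2 (x', y) - h2 (x, y) - D2 (x' - x)\<bar> \<le> \<epsilon> * norm (x' - x)"
    by (rule C1_prod_strictly_differentiable[OF image_open[OF N2(1,3)] oO2 C1(2), of "\<phi> x0" "\<psi>2 y2"])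
      (use N2(2,5) in auto)
  have rep1: "c q y1 = h1 (\<phi> q, \<psi>1 y1)" if "q \<in> X \<inter> N1" for q using N1(5,8) XS y(1) that by blast
  have rep2: "c q y2 = h2 (\<phi> q, \<psi>2 y2)" if "q \<in> X \<inter> N2" for q using N2(5,8) XS y(2) that by blast
  obtain w where w: "w \<in> V" "D1 w \<noteq> D2 w"
    by (rule twisted_derivatives_differ[where ?h1.0 = "\<lambda>z. h1 (z, \<psi>1 y1)"
      and ?h2.0 = "\<lambda>z. h2 (z, \<psi>2 y2)",
        OF tw x0 y U(1,2,3,5) N1(1,2) _ D1(2) N2(1,2) _ D2(2)]; (rule rep1 rep2 that)?)
  define G where "G d = D1 d - D2 d" for d
  have G: "bounded_linear G" unfolding G_def using D1(1) D2(1) by (rule bounded_linear_sub)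
  interpret G: bounded_linear G by (rule G)
  have Gw: "G w \<noteq> 0" using w(2) by (simp add: G_def)
  define \<pi> where "\<pi> d = d - (G d / G w) *\<^sub>R w" for d
  define H where "H = {d\<in>V. G d = 0}"
  note ks = kernel_slice[OF U(3) G w(1) Gw, folded \<pi>_def H_def]
  interpret \<pi>: bounded_linear \<pi> by (rule ks(4))
  \<comment> \<open>Chosen so that \<open>\<bar>G d\<bar> \<le> 2 * \<eta> * norm d\<close> keeps
    the component of \<open>d\<close> along \<open>w\<close> below half of
    \<open>norm d\<close>.\<close>
  define \<eta> where "\<eta> = \<bar>G w\<bar> / (4 * (norm w + 1))"
  have nw: "norm w + 1 > 0" using norm_ge_zero[of w] by linarith
  have \<eta>0: "\<eta> > 0" using Gw nw by (simp add: \<eta>_def)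
  obtain r1 where r1: "r1 > 0" "\<forall>x\<in>ball (\<phi> x0) r1. \<forall>x'\<in>ball (\<phi> x0) r1. \<forall>y\<in>ball (\<psi>1 y1) r1.
      \<bar>h1 (x', y) - h1 (x, y) - D1 (x' - x)\<bar> \<le> \<eta> * norm (x' - x)"
    using D1(3)[OF \<eta>0] by blast
  obtain r2 where r2: "r2 > 0" "\<forall>x\<in>ball (\<phi> x0) r2. \<forall>x'\<in>ball (\<phi> x0) r2. \<forall>y\<in>ball (\<psi>2 y2) r2.
      \<bar>h2 (x', y) - h2 (x, y) - D2 (x' - x)\<bar> \<le> \<eta> * norm (x' - x)"
    using D2(3)[OF \<eta>0] by blast
  have tr: "Ck_on (Suc 0) (\<phi> ` (U \<inter> U')) (\<phi>' \<circ> inv_into U \<phi>)"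
    by (rule charts_transition_smooth[OF A U(1) U'(1)])
  obtain r3 L where r3: "r3 > 0" "L \<ge> 0" "\<And>p q. p \<in> ball (\<phi> x0) r3 \<Longrightarrow> q \<in> ball (\<phi> x0) r3 \<Longrightarrow>
      norm ((\<phi>' \<circ> inv_into U \<phi>) p - (\<phi>' \<circ> inv_into U \<phi>) q) \<le> L * norm (p - q)"
    by (rule C1_locally_lipschitz[OF is_chart_open_image[OF cU is_chartD(1)[OF cU']] tr, of "\<phi> x0"])
      (use U(2) U'(2) in auto)
  define r where "r = min r1 (min r2 r3)"
  have r: "r > 0" "r \<le> r1" "r \<le> r2" "r \<le> r3" using r1(1) r2(1) r3(1) by (auto simp: r_def)
  define N where "N = (U \<inter> \<phi> -` ball (\<phi> x0) r) \<inter> (U' \<inter> (N1 \<inter> N2))"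
  define M1 where "M1 = (W1 \<inter> \<psi>1 -` ball (\<psi>1 y1) r) \<inter> O1"
  define M2 where "M2 = (W2 \<inter> \<psi>2 -` ball (\<psi>2 y2) r) \<inter> O2"
  define f where "f x = \<pi> (\<phi> x)" for x
  show ?thesis
  proof (rule that[of N M1 M2 H f "L * 2"])
    show "open N" unfolding N_def
      by (intro open_Int is_chart_open_preimage[OF cU] is_chartD(1)[OF cU'] N1(1) N2(1)) simp
    show "open M1" unfolding M1_def by (intro open_Int is_chart_open_preimage[OF cW1] N1(4)) simp
    show "open M2" unfolding M2_def by (intro open_Int is_chart_open_preimage[OF cW2] N2(4)) simp
    show "x0 \<in> N" unfolding N_def using U(2) U'(2) N1(2) N2(2) r(1) by simp
    show "y1 \<in> M1" unfolding M1_def using W1(2) N1(5) r(1) by simp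
    show "y2 \<in> M2" unfolding M2_def using W2(2) N2(5) r(1) by simp
    show "N \<subseteq> U'" unfolding N_def by blast
    show "subspace H" by (rule ks(1))
    show "dim H < m" using ks(2) U(4) by simp
    have "f ` (X \<inter> N) \<subseteq> \<pi> ` ball (\<phi> x0) r" unfolding f_def N_def by auto
    then show "bounded (f ` (X \<inter> N))"
      using bounded_linear_image[OF bounded_ball ks(4)] bounded_subset by blast
    show "f ` (X \<inter> N) \<subseteq> H"
    proof
      fix z assume "z \<in> f ` (X \<inter> N)"
      then obtain x where x: "x \<in> X" "x \<in> U" "z = \<pi> (\<phi> x)" unfolding f_def N_def by blast
      then have "\<phi> x \<in> V" using U(5) by blast
      from ks(3)[OF this] show "z \<in> H" unfolding x(3) .
    qed
    fix x x' a1 a2 b1 b2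
    assume x: "x \<in> X \<inter> N" "x' \<in> X \<inter> N" and a1: "a1 \<in> K \<inter> M1" and b1: "b1 \<in> K \<inter> M1"
      and a2: "a2 \<in> K \<inter> M2" and b2: "b2 \<in> K \<inter> M2"
      and le1: "c x' b1 - c x b1 \<le> c x' a2 - c x a2" and le2: "c x a1 - c x' a1 \<le> c x b2 - c x' b2"
    define d where "d = \<phi> x' - \<phi> x"
    have ball: "\<phi> x \<in> ball (\<phi> x0) r" "\<phi> x' \<in> ball (\<phi> x0) r" using x unfolding N_def by blast+
    have est1: "\<bar>c x' y - c x y - D1 d\<bar> \<le> \<eta> * norm d" if "y \<in> K \<inter> M1" for y
    proof -
      have "c x' y = h1 (\<phi> x', \<psi>1 y)" "c x y = h1 (\<phi> x, \<psi>1 y)"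
        using N1(8) x that XS unfolding N_def M1_def by blast+
      moreover have "\<psi>1 y \<in> ball (\<psi>1 y1) r1" using that r(2) unfolding M1_def by auto
      moreover have "\<phi> x \<in> ball (\<phi> x0) r1" "\<phi> x' \<in> ball (\<phi> x0) r1" using ball r(2) by auto
      ultimately show ?thesis using r1(2) unfolding d_def by simp
    qed
    have est2: "\<bar>c x' y - c x y - D2 d\<bar> \<le> \<eta> * norm d" if "y \<in> K \<inter> M2" for y
    proof -
      have "c x' y = h2 (\<phi> x', \<psi>2 y)" "c x y = h2 (\<phi> x, \<psi>2 y)"
        using N2(8) x that XS unfolding N_def M2_def by blast+
      moreover have "\<psi>2 y \<in> ball (\<psi>2 y2) r2" using that r(3) unfolding M2_def by auto
      moreover have "\<phi> x \<in> ball (\<phi> x0) r2" "\<phi> x' \<in> ball (\<phi> x0) r2" using ball r(3) by auto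
      ultimately show ?thesis using r2(2) unfolding d_def by simp
    qed
    \<comment> \<open>The increment of \<open>c\<close> from \<open>x\<close> to \<open>x'\<close>
      is \<open>D1 d\<close> or \<open>D2 d\<close> up to \<open>\<eta> * norm d\<close>, according
      to whether the target point is near \<open>y1\<close> or \<open>y2\<close>. Premise
      \<open>le1\<close> then bounds \<open>G d\<close> from above and \<open>le2\<close> bounds it
      from below.\<close>
    have "\<bar>G d\<bar> \<le> 2 * (\<eta> * norm d)"
      using est1[OF a1] est1[OF b1] est2[OF a2] est2[OF b2] le1 le2 unfolding G_def by linarith
    also have "2 * \<eta> = \<bar>G w\<bar> / (2 * (norm w + 1))" unfolding \<eta>_def using nw by (simp add: divide_simps)
    then have "2 * (\<eta> * norm d) = \<bar>G w\<bar> / (2 * (norm w + 1)) * norm d"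
      by (simp add: mult.assoc[symmetric])
    finally have "\<bar>G d\<bar> \<le> \<bar>G w\<bar> * (norm d / (2 * (norm w + 1)))" by simp
    then have Gd: "\<bar>G d / G w\<bar> \<le> norm d / (2 * (norm w + 1))"
      using Gw by (simp add: divide_le_eq mult.commute)
    have "norm ((G d / G w) *\<^sub>R w) \<le> norm d / (2 * (norm w + 1)) * norm w"
      unfolding norm_scaleR by (rule mult_right_mono[OF Gd norm_ge_zero])
    also have "\<dots> \<le> norm d / (2 * (norm w + 1)) * (norm w + 1)"
      using nw by (intro mult_left_mono) auto
    also have "\<dots> = norm d / 2" using nw by (simp add: field_simps)
    finally have half: "norm ((G d / G w) *\<^sub>R w) \<le> norm d / 2" .
    have "norm d \<le> norm (\<pi> d) + norm ((G d / G w) *\<^sub>R w)"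
      using norm_triangle_ineq[of "\<pi> d" "(G d / G w) *\<^sub>R w"] by (simp add: \<pi>_def)
    with half have "norm d \<le> 2 * norm (\<pi> d)" by linarith
    moreover have "norm (\<pi> d) = norm (f x - f x')"
      unfolding f_def d_def \<pi>.diff by (rule norm_minus_commute)
    ultimately have nd: "norm d \<le> 2 * norm (f x - f x')" by simp
    have inv: "inv_into U \<phi> (\<phi> x) = x" "inv_into U \<phi> (\<phi> x') = x'"
      using x is_chartD(3)[OF cU] unfolding N_def by (simp_all add: inv_into_f_f)
    have "\<phi> x \<in> ball (\<phi> x0) r3" "\<phi> x' \<in> ball (\<phi> x0) r3" using ball r(4) by auto
    from r3(3)[OF this] have "norm (\<phi>' x - \<phi>' x') \<le> L * norm d"
      unfolding o_def inv d_def by (simp add: norm_minus_commute)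
    also have "\<dots> \<le> L * (2 * norm (f x - f x'))" using nd r3(2) by (rule mult_left_mono)
    finally show "norm (\<phi>' x - \<phi>' x') \<le> L * 2 * norm (f x - f x')" by simp
  qed
qed

text \<open>The graph around a point depends on the pair of minimisers, so the Lindelof property is
  applied to neighbourhoods of triples \<open>(x, y1, y2)\<close> and not of points
  \<open>x\<close>.\<close>

lemma multiple_minimizers_dim_le:
  fixes A :: "('a::{t2_space, second_countable_topology}, 'e::euclidean_space) chart set"
    and B :: "('b::{t2_space, second_countable_topology}, 'f::euclidean_space) chart set"
    and v :: "'b \<Rightarrow> real"
  assumes A: "smooth_atlas A" and B: "smooth_atlas B" and X: "embedded_submanifold m A X" and XS: "X \<subseteq> S"
    and c: "Ck (Suc k) (prod_atlas A B) (S \<times> K) (\<lambda>(x, y). c x y)"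
    and tw: "twisted A X K c"
  defines "E \<equiv> {x\<in>X. \<exists>y1\<in>minimizers c K v x. \<exists>y2\<in>minimizers c K v x. y1 \<noteq> y2}"
  assumes ne: "E \<noteq> {}"
  shows "manifold_hausdorff_dim A E \<le> ereal (real m - 1)"
  unfolding manifold_hausdorff_dim_def
proof (rule SUP_least, clarify)
  \<comment> \<open>For \<open>m = 0\<close> the bound would be -1, whereas Hausdorff dimensions are
    nonnegative. A point of \<open>E\<close> excludes this case: it yields a subspace of dimension
    less than \<open>m\<close>.\<close>
  have m: "m \<ge> 1"
  proof -
    obtain x y1 y2 where x: "x \<in> X" "y1 \<in> K" "y2 \<in> K" "y1 \<noteq> y2" using ne
      unfolding E_def minimizers_def by blast
    obtain U \<phi> where U0: "(U, \<phi>) \<in> A" "x \<in> U" using atlas_chart_at[OF A] by metis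
    have U: "(U, \<phi>) \<in> charts A" using U0(1) atlas_subset_charts[OF A] by blast
    show ?thesis by (rule twisted_local_graph[OF A B X XS c tw x U U0(2)]) simp
  qed
  fix U' :: "'a set" and \<phi>' :: "'a \<Rightarrow> 'e" assume U': "(U', \<phi>') \<in> charts A"
  note inj = is_chartD(3)[OF charts_is_chart[OF U']]
  show "hausdorff_dim (\<phi>' ` (U' \<inter> E)) \<le> ereal (real m - 1)"
  proof (rule hausdorff_dim_leI)
    show "0 \<le> real m - 1" using m by simp
    fix s assume s: "real m - 1 < s"
    \<comment> \<open>The points having two minimisers that, together with the point, form a triple
      in \<open>W\<close>. For \<open>W\<close> a small product neighbourhood this is contained in
      one Lipschitz graph.\<close>
    define piece where "piece W = {x\<in>X \<inter> U'. \<exists>y1\<in>minimizers c K v x. \<exists>y2\<in>minimizers c K v x.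
      (x, y1, y2) \<in> W}"
      for W :: "('a \<times> 'b \<times> 'b) set"
    define \<F> where "\<F> = {W. open W \<and> hausdorff_measure s (\<phi>' ` piece W) = 0}"
    have cover: "(x, y1, y2) \<in> \<Union>\<F>" if x: "x \<in> X" "x \<in> U'" and y: "y1 \<in> K" "y2 \<in> K" "y1 \<noteq> y2" for x y1 y2
    proof -
      obtain N M1 M2 and f :: "'a \<Rightarrow> 'e" and H C where
        o: "open N" "open M1" "open M2" "x \<in> N" "y1 \<in> M1" "y2 \<in> M2"
        and H: "N \<subseteq> U'" "subspace H" "dim H < m" "bounded (f ` (X \<inter> N))" "f ` (X \<inter> N) \<subseteq> H"
        and est: "\<And>x x' a1 a2 b1 b2. x \<in> X \<inter> N \<Longrightarrow> x' \<in> X \<inter> N \<Longrightarrow>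
          a1 \<in> K \<inter> M1 \<Longrightarrow> b1 \<in> K \<inter> M1 \<Longrightarrow> a2 \<in> K \<inter> M2 \<Longrightarrow> b2 \<in> K \<inter> M2 \<Longrightarrow>
          c x' b1 - c x b1 \<le> c x' a2 - c x a2 \<Longrightarrow> c x a1 - c x' a1 \<le> c x b2 - c x' b2 \<Longrightarrow>
          norm (\<phi>' x - \<phi>' x') \<le> C * norm (f x - f x')"
        by (rule twisted_local_graph[OF A B X XS c tw x(1) y U' x(2)]) blast
      define P where "P = piece (N \<times> M1 \<times> M2)"
      have PN: "P \<subseteq> X \<inter> N" unfolding P_def piece_def by blast
      have inv: "inv_into U' \<phi>' (\<phi>' p) = p" if "p \<in> P" for p
        using that PN H(1) inj by (intro inv_into_f_f) blast+
      have img: "(f \<circ> inv_into U' \<phi>') ` \<phi>' ` P \<subseteq> f ` (X \<inter> N)"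
        using inv PN by force
      have "hausdorff_measure s (\<phi>' ` P) = 0"
      proof (rule hausdorff_null_of_expanding_into_subspace[where f = "f \<circ> inv_into U' \<phi>'"
        and C = C, OF H(2)])
        show "(f \<circ> inv_into U' \<phi>') ` \<phi>' ` P \<subseteq> H" using img H(5) by blast
        show "bounded ((f \<circ> inv_into U' \<phi>') ` \<phi>' ` P)" using img H(4) bounded_subset by blast
        show "real (dim H) < s" using H(3) s by linarith
        fix p q assume "p \<in> \<phi>' ` P" "q \<in> \<phi>' ` P"
        then obtain u u' where u: "u \<in> P" "u' \<in> P" "p = \<phi>' u" "q = \<phi>' u'" by blast
        obtain a1 a2 where a: "a1 \<in> minimizers c K v u" "a2 \<in> minimizers c K v u" "a1 \<in> M1" "a2 \<in> M2"
          using u(1) unfolding P_def piece_def by blast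
        obtain b1 b2 where b: "b1 \<in> minimizers c K v u'" "b2 \<in> minimizers c K v u'" "b1 \<in> M1" "b2 \<in> M2"
          using u(2) unfolding P_def piece_def by blast
        have K: "a1 \<in> K" "a2 \<in> K" "b1 \<in> K" "b2 \<in> K" using a b unfolding minimizers_def by auto
        \<comment> \<open>Each minimiser is compared with the opposite one of the other point.
          Adding the comparisons in pairs eliminates \<open>v\<close>, and inequalities between
          increments of \<open>c\<close> remain.\<close>
        have "c u a1 - v a1 \<le> c u b2 - v b2" "c u a2 - v a2 \<le> c u b1 - v b1"
          "c u' b1 - v b1 \<le> c u' a2 - v a2" "c u' b2 - v b2 \<le> c u' a1 - v a1"
          using a b K unfolding minimizers_def by auto
        then have "c u' b1 - c u b1 \<le> c u' a2 - c u a2" "c u a1 - c u' a1 \<le> c u b2 - c u' b2"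
          by linarith+
        then have "norm (\<phi>' u - \<phi>' u') \<le> C * norm (f u - f u')"
          using u PN a b K by (intro est[of u u' a1 b1 a2 b2]) auto
        then show "dist p q \<le> C * norm ((f \<circ> inv_into U' \<phi>') p - (f \<circ> inv_into U' \<phi>') q)"
          unfolding u(3,4) by (simp add: dist_norm inv u(1,2))
      qed
      then have "N \<times> M1 \<times> M2 \<in> \<F>" unfolding \<F>_def P_def using o by (simp add: open_Times)
      then show ?thesis using o by blast
    qed
    obtain \<G> where G: "\<G> \<subseteq> \<F>" "countable \<G>" "\<Union>\<G> = \<Union>\<F>"
      using Lindelof[of \<F>] unfolding \<F>_def by blast
    \<comment> \<open>\<open>from_nat_into\<close> enumerates nonempty sets; the empty neighbourhood
      is added in case \<open>\<G>\<close> is empty.\<close>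
    define W where "W = from_nat_into (insert {} \<G>)"
    have rW: "range W = insert {} \<G>" unfolding W_def using G(2) by (intro range_from_nat_into) auto
    show "hausdorff_measure s (\<phi>' ` (U' \<inter> E)) = 0"
    proof (rule hausdorff_null_countable_UN)
      fix n :: nat
      have "W n \<in> insert {} \<G>" using rW by blast
      moreover have "hausdorff_measure s (\<phi>' ` piece {}) = 0"
        unfolding hausdorff_null_iff_covers piece_def
        by (auto intro!: exI[of _ "\<lambda>_. {}"] simp: diameter_def)
      moreover have "hausdorff_measure s (\<phi>' ` piece W') = 0" if "W' \<in> \<G>" for W'
        using subsetD[OF G(1) that] by (simp add: \<F>_def)
      ultimately show "hausdorff_measure s (\<phi>' ` piece (W n)) = 0" by (metis insertE)
    next
      show "\<phi>' ` (U' \<inter> E) \<subseteq> (\<Union>n. \<phi>' ` piece (W n))"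
      proof (rule image_subsetI)
        fix x assume x: "x \<in> U' \<inter> E"
        then obtain y1 y2 where y: "y1 \<in> minimizers c K v x" "y2 \<in> minimizers c K v x" "y1 \<noteq> y2" "x \<in> X"
          unfolding E_def by blast
        then have "(x, y1, y2) \<in> \<Union>\<G>" unfolding G(3) using x by (intro cover) (auto simp: minimizers_def)
        then obtain n where "(x, y1, y2) \<in> W n" using rW by (metis UnionE insertI2 rangeE)
        then have "x \<in> piece (W n)" unfolding piece_def using x y by blast
        then show "\<phi>' x \<in> (\<Union>n. \<phi>' ` piece (W n))" by blast
      qed
    qed
  qed
qed


section \<open>Reduction to the quotient\<close>

lemma Ck_prod_imp_continuous_on:
  assumes A: "smooth_atlas A" and B: "smooth_atlas B" and c: "Ck k (prod_atlas A B) (S \<times> T)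
      (\<lambda>(x, y). c x y)"
  shows "continuous_on (S \<times> T) (\<lambda>(x, y). c x y)"
proof (rule topological_continuous_onI)
  fix z and e :: real assume z: "z \<in> S \<times> T" and e: "e > 0"
  obtain x y where xy: "z = (x, y)" "x \<in> S" "y \<in> T" using z by blast
  obtain U \<phi> where U0: "(U, \<phi>) \<in> A" "x \<in> U" using atlas_chart_at[OF A] by metis
  obtain V \<psi> where V0: "(V, \<psi>) \<in> B" "y \<in> V" using atlas_chart_at[OF B] by metis
  have U: "(U, \<phi>) \<in> charts A" and V: "(V, \<psi>) \<in> charts B"
    using U0 V0 atlas_subset_charts A B by blast+
  obtain N M h where N: "open N" "x \<in> N" "N \<subseteq> U" "open M" "y \<in> M" "M \<subseteq> V"
    "Ck_on k (\<phi> ` N \<times> \<psi> ` M) h" "\<And>x' y'. x' \<in> S \<inter> N \<Longrightarrow> y' \<in> T \<inter> M \<Longrightarrow> c x' y' = h (\<phi> x', \<psi> y')"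
    by (rule Ck_prod_local_representative[OF A B c xy(2,3) U V U0(2) V0(2)]; rule that)
  have "continuous_on (\<phi> ` N \<times> \<psi> ` M) h" using N(7) Ck_on_mono[of k _ h 0] by simp
  moreover have "continuous_on (N \<times> M) (\<lambda>z. (\<phi> (fst z), \<psi> (snd z)))"
    by (intro continuous_on_Pair continuous_on_compose2[OF is_chartD(4)[OF charts_is_chart[OF U]]]
        continuous_on_compose2[OF is_chartD(4)[OF charts_is_chart[OF V]]] continuous_on_fst
          continuous_on_snd continuous_on_id)
      (use N(3,6) in auto)
  ultimately have cont: "continuous_on (N \<times> M) (\<lambda>z. h (\<phi> (fst z), \<psi> (snd z)))"
    by (rule continuous_on_compose2) auto
  define W where "W = (N \<times> M) \<inter> (\<lambda>z. h (\<phi> (fst z), \<psi> (snd z))) -` ball (h (\<phi> x, \<psi> y)) e"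
  have "open W" unfolding W_def by (rule continuous_open_preimage[OF cont open_Times[OF N(1,4)]
    open_ball])
  moreover have "z \<in> W" unfolding W_def using xy N(2,5) e by simp
  moreover have "\<bar>(case z' of (x, y) \<Rightarrow> c x y) - (case z of (x, y) \<Rightarrow> c x y)\<bar> \<le> e" if "z' \<in> W \<inter> S \<times> T"
    for z'
  proof -
    obtain x' y' where z': "z' = (x', y')" by (cases z')
    then have "x' \<in> S \<inter> N" "y' \<in> T \<inter> M" "dist (h (\<phi> x, \<psi> y)) (h (\<phi> x', \<psi> y')) < e"
      using that unfolding W_def by auto
    with z' show ?thesis using N(2,5,8) xy by (simp add: dist_real_def)
  qed
  ultimately show "\<exists>U. open U \<and> z \<in> U \<and> (\<forall>z'\<in>U \<inter> S \<times> T. \<bar>(case z' of (x, y) \<Rightarrow> c x y) - (case z of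
    (x, y) \<Rightarrow> c x y)\<bar> \<le> e)"
    by blast
qed

section \<open>Measurability on the quotient\<close>

lemma space_quotient_borel: "space (quotient_borel X r) = X // r"
  unfolding quotient_borel_def by (rule space_measure_of) blast

lemma quotient_borel_openI:
  assumes "W \<subseteq> X // r" "openin (top_of_set X) {x\<in>X. quotient_map_of r x \<in> W}"
  shows "W \<in> sets (quotient_borel X r)"
  unfolding quotient_borel_def using assms by (intro in_measure_of) auto

text \<open>The generators have relatively open preimages; complements give the version for closed
  preimages, the form in which hit sets and sublevel sets of \<open>b\<close> arise.\<close>

lemma quotient_borel_closedI:
  assumes "\<And>x. x \<in> X \<Longrightarrow> quotient_map_of r x \<in> X // r"
    and "closedin (top_of_set X) {x\<in>X. P (quotient_map_of r x)}"
  shows "{z\<in>X // r. P z} \<in> sets (quotient_borel X r)"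
proof -
  have "{x\<in>X. quotient_map_of r x \<in> X // r - {z\<in>X // r. P z}} = X - {x\<in>X. P (quotient_map_of r x)}"
    using assms(1) by auto
  moreover have "openin (top_of_set X) (X - {x\<in>X. P (quotient_map_of r x)})"
    using assms(2) by (metis openin_diff openin_subtopology_self)
  ultimately have "X // r - {z\<in>X // r. P z} \<in> sets (quotient_borel X r)"
    by (intro quotient_borel_openI) auto
  then have "space (quotient_borel X r) - (X // r - {z\<in>X // r. P z}) \<in> sets (quotient_borel X r)"
    by (rule sets.compl_sets)
  moreover have "space (quotient_borel X r) - (X // r - {z\<in>X // r. P z}) = {z\<in>X // r. P z}"
    unfolding space_quotient_borel by blast
  ultimately show ?thesis by simp
qed

lemma quotient_map_measurable:
  assumes "\<And>x. x \<in> X \<Longrightarrow> quotient_map_of r x \<in> X // r" "space M = X"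
    "\<And>S. openin (top_of_set X) S \<Longrightarrow> S \<in> sets M"
  shows "quotient_map_of r \<in> measurable M (quotient_borel X r)"
  unfolding quotient_borel_def
proof (rule measurable_measure_of)
  fix W assume W: "W \<in> {W. W \<subseteq> X // r \<and> openin (top_of_set X) {x\<in>X. quotient_map_of r x \<in> W}}"
  have "quotient_map_of r -` W \<inter> space M = {x\<in>X. quotient_map_of r x \<in> W}" using assms(2) by blast
  with W assms(3) show "quotient_map_of r -` W \<inter> space M \<in> sets M" by simp
qed (use assms in auto)

text \<open>By continuity of \<open>f z\<close>, \<open>f z (G z) < a\<close> holds iff for some
  rational \<open>q < a\<close> and some basic open \<open>V\<close> containing \<open>G z\<close>
  the function \<open>f z\<close> is at most \<open>q\<close> on \<open>V \<inter> Y\<close>. This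
  is a countable union and avoids joint measurability of \<open>f\<close>.\<close>

lemma borel_measurable_of_uniform_sublevels:
  fixes f :: "'z \<Rightarrow> 'b::second_countable_topology \<Rightarrow> real"
  assumes G: "G \<in> borel_measurable N" "\<And>z. z \<in> space N \<Longrightarrow> G z \<in> Y"
    and cont: "\<And>z. z \<in> space N \<Longrightarrow> continuous_on Y (f z)"
    and sub: "\<And>V q. open V \<Longrightarrow> {z\<in>space N. \<forall>y\<in>V \<inter> Y. f z y \<le> q} \<in> sets N"
  shows "(\<lambda>z. f z (G z)) \<in> borel_measurable N"
proof (rule borel_measurableI_less)
  fix a :: real
  obtain \<B> :: "'b set set" where B: "countable \<B>" "topological_basis \<B>" using ex_countable_basis by blast
  define I where "I = \<B> \<times> {q\<in>\<rat>. q < a}"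
  have cI: "countable I" unfolding I_def
    by (intro countable_SIGMA B(1) countable_subset[OF _ countable_rat]) auto
  define S where "S i = (G -` fst i \<inter> space N) \<inter> {z\<in>space N. \<forall>y\<in>fst i \<inter> Y. f z y \<le> snd i}" for i
  have "{z\<in>space N. f z (G z) < a} = (\<Union>i\<in>I. S i)"
  proof (intro set_eqI iffI)
    fix z assume z: "z \<in> {z\<in>space N. f z (G z) < a}"
    then obtain q where q: "q \<in> \<rat>" "f z (G z) < q" "q < a" using Rats_dense_in_real by blast
    obtain W where W: "open W" "W \<inter> Y = f z -` {..<q} \<inter> Y"
      using cont[of z, unfolded continuous_on_open_invariant, rule_format, of "{..<q}"] z by auto
    have "G z \<in> W" using W(2) q(2) G(2) z by blast
    then obtain V where V: "V \<in> \<B>" "G z \<in> V" "V \<subseteq> W" using topological_basisE[OF B(2) W(1)] by metis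
    have "f z y \<le> q" if "y \<in> V \<inter> Y" for y
    proof -
      have "y \<in> f z -` {..<q} \<inter> Y" unfolding W(2)[symmetric] using that V(3) by blast
      then show ?thesis by simp
    qed
    then have "z \<in> S (V, q)" "(V, q) \<in> I" using V q z unfolding S_def I_def by auto
    then show "z \<in> (\<Union>i\<in>I. S i)" by blast
  next
    fix z assume "z \<in> (\<Union>i\<in>I. S i)"
    then obtain V q where "q < a" "G z \<in> V" "z \<in> space N" "\<forall>y\<in>V \<inter> Y. f z y \<le> q"
      unfolding S_def I_def by auto
    moreover from this have "f z (G z) \<le> q" using G(2) by blast
    ultimately show "z \<in> {z\<in>space N. f z (G z) < a}" by simp
  qed
  moreover have "S i \<in> sets N" if "i \<in> I" for i
  proof -
    have "open (fst i)" using that B(2) topological_basis_open unfolding I_def by (cases i) auto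
    then show ?thesis unfolding S_def
      by (intro sets.Int measurable_sets[OF G(1)] sub borel_open)
  qed
  then have "(\<Union>i\<in>I. S i) \<in> sets N" by (intro sets.countable_UN' cI) auto
  ultimately show "{z\<in>space N. f z (G z) < a} \<in> sets N" by (simp only:)
qed

theorem proposition3p6:
  fixes A :: "('a::{t2_space, second_countable_topology}, 'e::euclidean_space) chart set"
    and B :: "('b::{t2_space, second_countable_topology}, 'f::euclidean_space) chart set"
    and X :: "'a set" and Y :: "'b set"
    and m n :: nat
    and c :: "'a \<Rightarrow> 'b \<Rightarrow> real"
    and y0 :: 'b
    and Z :: "'a set set" and Q :: "'a \<Rightarrow> 'a set" and b :: "'a set \<Rightarrow> 'b \<Rightarrow> real"
    and \<mu> :: "'a measure" and \<nu> :: "'b measure" and \<alpha> :: "'a set measure"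
    and F :: "'a \<Rightarrow> 'b"
  assumes "smooth_atlas A" and "smooth_atlas B"
    and "embedded_submanifold m A X" and "embedded_submanifold n B Y" and "n \<le> m"
    and "connected Y"
    and "compact (closure X)" and "compact (closure Y)"
    and "Ck 4 (prod_atlas A B) (closure X \<times> closure Y) (\<lambda>(x, y). c x y)"
    and "\<forall>x\<in>X. \<forall>y\<in>Y. inj_on (mixed_differential A B X Y c x y) (tangent_space B Y y)"
    and "\<forall>x\<in>X. \<forall>y\<in>Y. connected (level_set B X Y c x y)"
    and "\<forall>x\<in>X. \<forall>y\<in>Y. \<forall>y'\<in>Y. level_set B X Y c x y = level_set B X Y c x y'"
    and "y0 \<in> Y"
    and "Z = X // level_rel B X Y c y0"
    and "Q = quotient_map_of (level_rel B X Y c y0)"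
    and "reduced_cost B X Y c y0 b"
    and "prob_space \<mu>" and "sets \<mu> = sets (restrict_space borel X)"
    and "prob_space \<nu>" and "sets \<nu> = sets (restrict_space borel Y)"
    and "\<alpha> = distr \<mu> (quotient_borel X (level_rel B X Y c y0)) Q"
    and "twisted A X (closure Y) c"
    and "\<forall>S\<in>sets \<mu>. manifold_hausdorff_dim A S \<le> ereal (real m - 1) \<longrightarrow> emeasure \<mu> S = 0"
    and "optimal_map c \<mu> \<nu> F"
  shows "\<exists>T. T ` Z \<subseteq> Y \<and> (AE x in \<mu>. F x = T (Q x)) \<and> optimal_map b \<alpha> \<nu> T"
proof -
  note A = assms(1) and B = assms(2) and eX = assms(3) and eY = assms(4) and y0 = assms(13)
  define r where "r = level_rel B X Y c y0"
  have Z: "Z = X // r" and Q: "Q = quotient_map_of r" unfolding r_def by (fact assms)+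
  define qb where "qb = quotient_borel X r"
  have \<alpha>: "\<alpha> = distr \<mu> qb Q" unfolding qb_def r_def by (fact assms)
  have Ck: "Ck (Suc 3) (prod_atlas A B) (closure X \<times> closure Y) (\<lambda>(x, y). c x y)"
    using assms(9) by (simp add: eval_nat_numeral)
  have spX: "space \<mu> = X" using sets_eq_imp_space_eq[OF assms(18)] by (simp add: space_restrict_space)
  have X_ne: "X \<noteq> {}" using prob_space.not_empty[OF assms(17)] spX by simp
  have K_ne: "closure Y \<noteq> {}" using y0 closure_subset by blast
  interpret compact_transport X "closure X" "closure Y" c \<mu> \<nu> Y
    by (intro compact_transport.intro compact_target.intro compact_transport_axioms.intro
        assms(7,8,17,18,19,20) closure_subset X_ne K_ne embedded_submanifold_borel[OF eY]
        Ck_prod_imp_continuous_on[OF A B Ck])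
  have uniq: "AE x in \<mu>. \<exists>!y. y \<in> minimizers c (closure Y) v x" if v: "continuous_on (closure Y) v" for v
  proof -
    define E where "E = {x\<in>X. \<exists>y1\<in>minimizers c (closure Y) v x. \<exists>y2\<in>minimizers c (closure Y) v x. y1
      \<noteq> y2}"
    \<comment> \<open>Minimisers exist at every point, so failure of uniqueness means that there are
      two of them.\<close>
    have E: "E = space \<mu> - {x\<in>space \<mu>. \<exists>!y. y \<in> minimizers c (closure Y) v x}"
      unfolding E_def using minimizers_nonempty[OF _ v] by (auto simp: space_mu)
    have "{x\<in>space \<mu>. \<exists>!y. y \<in> minimizers c (closure Y) v x} \<in> sets \<mu>"
    proof (rule sets_unique_of_hit_sets[OF compact_K])
      show "minimizers c (closure Y) v x \<subseteq> closure Y" for x unfolding minimizers_def by blast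
      show "{x\<in>space \<mu>. minimizers c (closure Y) v x \<inter> C \<noteq> {}} \<in> sets \<mu>" if "closed C" for C
        unfolding space_mu by (rule closedin_sets_mu[OF closedin_minimizers_hit[OF v that]])
    qed
    then have Es: "E \<in> sets \<mu>" unfolding E by (rule sets.compl_sets)
    have "emeasure \<mu> E = 0"
    proof (cases "E = {}")
      case False
      have "manifold_hausdorff_dim A E \<le> ereal (real m - 1)"
        using multiple_minimizers_dim_le[OF A B eX closure_subset Ck assms(22)] False
          unfolding E_def by blast
      with assms(23) Es show ?thesis by blast
    qed simp
    then show ?thesis using Es by (intro AE_I[where N = E]) (auto simp: E)
  qed
  obtain v where v: "continuous_on (closure Y) v" and opt: "AE x in \<mu>. F x \<in> minimizers c (closure
    Y) v x"
    using optimal_map_in_minimizers[OF uniq] assms(24) by blast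

  have Q_in: "Q x \<in> Z" if "x \<in> X" for x unfolding Z Q quotient_map_of_def using that by (rule quotientI)
  have Z_Q: "\<exists>x\<in>X. Q x = z" if "z \<in> Z" for z
    using that unfolding Z Q quotient_map_of_def quotient_def by blast
  have cost: "c x y = b (Q x) y + c x y0" if x: "x \<in> X" and y: "y \<in> Y" for x y
  proof -
    have rc: "Ck 1 B Y (b (Q x))" "b (Q x) y0 = 0"
      "\<And>y. y \<in> Y \<Longrightarrow> differential B Y y (b (Q x)) = differential B Y y (c x)"
      using assms(16) Q_in[OF x] x unfolding reduced_cost_def r_def[symmetric] Z Q by blast+
    have "chart_differentiable B Y (c x)"
      by (rule Ck_prod_imp_chart_differentiable_right[OF A B Ck _ closure_subset]) (use x
        closure_subset in auto)
    moreover have "chart_differentiable B Y (b (Q x))"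
      using rc(1) by (intro Ck_imp_chart_differentiable[of 0]) simp
    ultimately have "c x y - b (Q x) y = c x y0 - b (Q x) y0"
      using rc(3) by (intro equal_differential_imp_constant_diff[OF B eY assms(6) _ _ _ y0 y]) auto
    then show ?thesis using rc(2) by simp
  qed
  \<comment> \<open>A minimiser may lie in the closure outside \<open>Y\<close>, where
    \<open>cost\<close> says nothing. Stated through \<open>c\<close> alone, the identity extends
    from \<open>Y\<close> to its closure by continuity.\<close>
  have Q_cost: "c x y - c x y0 = c x' y - c x' y0"
    if x: "x \<in> X" "x' \<in> X" "Q x = Q x'" and y: "y \<in> closure Y" for x x' y
  proof -
    have "continuous_on (closure Y) (\<lambda>y. (c x y - c x y0) - (c x' y - c x' y0))"
      using cont_c_right x by (intro continuous_on_diff continuous_on_const) auto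
    moreover have "(c x y - c x y0) - (c x' y - c x' y0) = 0" if "y \<in> Y" for y
      using cost[OF x(1) that] cost[OF x(2) that] x(3) by simp
    ultimately have "(c x y - c x y0) - (c x' y - c x' y0) = 0"
      using continuous_constant_on_closure y by blast
    then show ?thesis by simp
  qed
  have Q_minimizers: "minimizers c (closure Y) v x = minimizers c (closure Y) v x'"
    if x: "x \<in> X" "x' \<in> X" "Q x = Q x'" for x x'
  proof -
    have "c x y - v y \<le> c x y' - v y' \<longleftrightarrow> c x' y - v y \<le> c x' y' - v y'"
      if "y \<in> closure Y" "y' \<in> closure Y" for y y'
      using Q_cost[OF x that(1)] Q_cost[OF x that(2)] by linarith
    then show ?thesis unfolding minimizers_def by blast
  qed
  define s where "s z = (SOME x. x \<in> X \<and> Q x = z)" for z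
  have s: "s z \<in> X" "Q (s z) = z" if "z \<in> Z" for z
    using someI_ex[of "\<lambda>x. x \<in> X \<and> Q x = z"] Z_Q[OF that] unfolding s_def by blast+
  \<comment> \<open>By \<open>Q_minimizers\<close> the set does not depend on the representative
    \<open>s z\<close>, so it descends to the quotient. Its hit sets pull back under
    \<open>Q\<close> to closed subsets of \<open>X\<close>.\<close>
  define M where "M z = minimizers c (closure Y) v (s z)" for z
  have MQ: "M (Q x) = minimizers c (closure Y) v x" if "x \<in> X" for x
    unfolding M_def using Q_minimizers s[OF Q_in[OF that]] that by blast

  have sp_qb: "space qb = Z" unfolding qb_def space_quotient_borel Z ..
  have qb_closedI: "{z\<in>Z. P z} \<in> sets qb" if "closedin (top_of_set X) {x\<in>X. P (Q x)}" for P
    unfolding qb_def Z using that Q_in unfolding Z Q by (intro quotient_borel_closedI) auto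
  have Qm: "Q \<in> measurable \<mu> qb"
    unfolding Q qb_def
  proof (rule quotient_map_measurable[OF _ space_mu])
    show "quotient_map_of r x \<in> X // r" if "x \<in> X" for x using Q_in[OF that] unfolding Q Z .
    fix S assume "openin (top_of_set X) S"
    then obtain C where "open C" "S = X \<inter> C" unfolding openin_open by blast
    then show "S \<in> sets \<mu>" unfolding sets_mu sets_restrict_space using borel_open by blast
  qed

  define T1 where "T1 z = (if \<exists>!y. y \<in> M z then THE y. y \<in> M z else y0)" for z
  \<comment> \<open>\<open>T1\<close> takes values in the closure of \<open>Y\<close>. Along
    \<open>Q\<close> it agrees almost everywhere with \<open>F\<close>, so redirecting the values
    outside \<open>Y\<close> to \<open>y0\<close> alters it on an \<open>\<alpha>\<close>-null set
    only.\<close>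
  define T where "T z = (if T1 z \<in> Y then T1 z else y0)" for z
  have T1m: "T1 \<in> borel_measurable qb"
    unfolding T1_def
  proof (rule measurable_selection_of_hit_sets[OF compact_K])
    show "M z \<subseteq> closure Y" for z unfolding M_def minimizers_def by blast
    fix C :: "'b set" assume C: "closed C"
    have "{x\<in>X. M (Q x) \<inter> C \<noteq> {}} = {x\<in>X. minimizers c (closure Y) v x \<inter> C \<noteq> {}}" using MQ by auto
    then show "{z\<in>space qb. M z \<inter> C \<noteq> {}} \<in> sets qb"
      unfolding sp_qb using closedin_minimizers_hit[OF v C] by (intro qb_closedI) simp
  qed
  have TY: "T z \<in> Y" for z using y0 by (simp add: T_def)
  have "T \<in> borel_measurable qb" unfolding T_def using T1m Y_borel by (intro measurable_If) auto
  then have Tm: "T \<in> measurable qb \<nu>"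
    unfolding measurable_cong_sets[OF refl sets_nu] using TY by (intro measurable_restrict_space2) auto
  have tF: "transport_map \<mu> \<nu> F" using assms(24) unfolding optimal_map_def by blast
  then have Fm: "F \<in> measurable \<mu> \<nu>" by (simp add: transport_map_def)
  have AEF: "AE x in \<mu>. F x = T (Q x)"
    using opt uniq[OF v] AE_space
  proof eventually_elim
    case (elim x)
    then have x: "x \<in> X" by (simp add: space_mu)
    have "T1 (Q x) = F x"
      unfolding T1_def MQ[OF x] using elim(1,2) by (simp add: the1_equality)
    then show ?case using transport_measurable(2)[OF Fm x] by (simp add: T_def)
  qed

  \<comment> \<open>Passing from \<open>G\<close> to \<open>G \<circ> Q\<close> changes the cost by
    a constant independent of \<open>G\<close> and preserves admissibility.\<close>
  have pull: "(LINT z|\<alpha>. b z (G z)) = (LINT x|\<mu>. c x (G (Q x))) - (LINT x|\<mu>. c x y0)"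
    "transport_map \<mu> \<nu> (G \<circ> Q) \<longleftrightarrow> transport_map \<alpha> \<nu> G" if G: "G \<in> measurable qb \<nu>" for G
  proof -
    have GY: "G z \<in> Y" if "z \<in> Z" for z using measurable_space[OF G] that by (simp add: sp_qb space_nu)
    have Gb: "G \<in> borel_measurable qb"
      using G unfolding measurable_cong_sets[OF refl sets_nu]
        by (simp add: measurable_restrict_space2_iff)
    have GQ: "G \<circ> Q \<in> measurable \<mu> \<nu>" using Qm G by (rule measurable_comp)
    have bm: "(\<lambda>z. b z (G z)) \<in> borel_measurable qb"
    proof (rule borel_measurable_of_uniform_sublevels[OF Gb])
      show "G z \<in> Y" if "z \<in> space qb" for z using GY that sp_qb by simp
      show "continuous_on Y (b z)" if "z \<in> space qb" for z
      proof -
        have z: "z \<in> Z" using that sp_qb by simp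
        have "continuous_on Y (\<lambda>y. c (s z) y - c (s z) y0)"
          using continuous_on_subset[OF cont_c_right[OF s(1)[OF z]] closure_subset]
          by (intro continuous_on_diff continuous_on_const)
        then show ?thesis
          by (rule continuous_on_eq) (use cost[OF s(1)[OF z]] s(2)[OF z] in simp)
      qed
      fix V :: "'b set" and q :: real
      \<comment> \<open>On \<open>X\<close> the function \<open>b (Q x) y\<close> is the continuous
        function \<open>c x y - c x y0\<close>. The set is an intersection of closed sublevel sets,
        so uncountably many \<open>y\<close> do no harm.\<close>
      have "closedin (top_of_set X) {x\<in>X. \<forall>y\<in>V \<inter> Y. b (Q x) y \<le> q}"
      proof (cases "V \<inter> Y = {}")
        case False
        have "closedin (top_of_set X) {x\<in>X. b (Q x) y \<le> q}" if y: "y \<in> V \<inter> Y" for y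
        proof -
          have cy: "continuous_on X (\<lambda>x. c x y)" if "y \<in> Y" for y
          proof -
            have "continuous_on X (\<lambda>x. case (x, y) of (x, y) \<Rightarrow> c x y)"
              by (rule continuous_on_compose2[OF cost_continuous_prod])
                (use that closure_subset in \<open>auto intro!: continuous_intros\<close>)
            then show ?thesis by simp
          qed
          have "continuous_on X (\<lambda>x. c x y - c x y0)"
            using cy y y0 by (intro continuous_on_diff) auto
          from continuous_closedin_preimage[OF this closed_atMost, of q]
          have "closedin (top_of_set X) (X \<inter> (\<lambda>x. c x y - c x y0) -` {..q})" .
          moreover have "X \<inter> (\<lambda>x. c x y - c x y0) -` {..q} = {x\<in>X. b (Q x) y \<le> q}"
            using cost y by auto
          ultimately show ?thesis by simp
        qed
        then have "closedin (top_of_set X) (\<Inter>y\<in>V \<inter> Y. {x\<in>X. b (Q x) y \<le> q})"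
          using False by (intro closedin_Inter) auto
        moreover have "(\<Inter>y\<in>V \<inter> Y. {x\<in>X. b (Q x) y \<le> q}) = {x\<in>X. \<forall>y\<in>V \<inter> Y. b (Q x) y \<le> q}"
          using False by blast
        ultimately show ?thesis by simp
      qed simp
      then show "{z\<in>space qb. \<forall>y\<in>V \<inter> Y. b z y \<le> q} \<in> sets qb" unfolding sp_qb by (rule qb_closedI)
    qed
    have "(LINT z|\<alpha>. b z (G z)) = (LINT x|\<mu>. b (Q x) (G (Q x)))"
      unfolding \<alpha> by (rule integral_distr[OF Qm bm])
    also have "\<dots> = (LINT x|\<mu>. c x (G (Q x)) - c x y0)"
      using cost GY[OF Q_in] by (intro Bochner_Integration.integral_cong) (simp_all add: space_mu)
    also have "\<dots> = (LINT x|\<mu>. c x (G (Q x))) - (LINT x|\<mu>. c x y0)"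
    proof (rule Bochner_Integration.integral_diff)
      have "integrable \<mu> (\<lambda>x. c x ((G \<circ> Q) x))"
        by (rule cost_integrable[OF transport_measurable(1)[OF GQ]])
          (use transport_measurable(2)[OF GQ] Y_K in blast)
      then show "integrable \<mu> (\<lambda>x. c x (G (Q x)))" by simp
      show "integrable \<mu> (\<lambda>x. c x y0)"
        using y0 Y_K by (intro cost_integrable) auto
    qed
    finally show "(LINT z|\<alpha>. b z (G z)) = (LINT x|\<mu>. c x (G (Q x))) - (LINT x|\<mu>. c x y0)" .
    show "transport_map \<mu> \<nu> (G \<circ> Q) \<longleftrightarrow> transport_map \<alpha> \<nu> G"
      unfolding transport_map_def \<alpha> distr_distr[OF G Qm] using GQ G by simp
  qed
  have TQ: "T \<circ> Q \<in> measurable \<mu> \<nu>" using Qm Tm by (rule measurable_comp)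
  \<comment> \<open>\<open>T \<circ> Q\<close> is a transport map because it agrees with
    \<open>F\<close> almost everywhere; by \<open>pull\<close> this makes \<open>T\<close> one for
    \<open>\<alpha>\<close>.\<close>
  have tTQ: "transport_map \<mu> \<nu> (T \<circ> Q)"
  proof -
    have "distr \<mu> \<nu> (T \<circ> Q) = distr \<mu> \<nu> F"
      using TQ Fm AEF by (intro distr_cong_AE) (auto elim: AE_mp)
    then show ?thesis using tF TQ unfolding transport_map_def by simp
  qed
  have costT: "(LINT x|\<mu>. c x (T (Q x))) = (LINT x|\<mu>. c x (F x))"
  proof (rule integral_cong_AE)
    show "(\<lambda>x. c x (T (Q x))) \<in> borel_measurable \<mu>"
      using cost_measurable[of "T \<circ> Q"] transport_measurable[OF TQ] Y_K by auto
    show "(\<lambda>x. c x (F x)) \<in> borel_measurable \<mu>"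
      using cost_measurable[of F] transport_measurable[OF Fm] Y_K by auto
    show "AE x in \<mu>. c x (T (Q x)) = c x (F x)" using AEF by eventually_elim simp
  qed
  have "optimal_map b \<alpha> \<nu> T"
    unfolding optimal_map_def
  proof (intro conjI allI impI)
    show "transport_map \<alpha> \<nu> T" using pull(2)[OF Tm] tTQ by simp
    fix G assume tG: "transport_map \<alpha> \<nu> G"
    then have G: "G \<in> measurable qb \<nu>" unfolding transport_map_def \<alpha> by simp
    \<comment> \<open>Every competitor \<open>G\<close> on \<open>Z\<close> lifts to the competitor
      \<open>G \<circ> Q\<close> on \<open>X\<close>, against which \<open>F\<close> is
      optimal.\<close>
    have "(LINT x|\<mu>. c x (F x)) \<le> (LINT x|\<mu>. c x ((G \<circ> Q) x))"
      using assms(24) pull(2)[OF G] tG unfolding optimal_map_def by blast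
    then show "(LINT z|\<alpha>. b z (T z)) \<le> (LINT z|\<alpha>. b z (G z))"
      unfolding pull(1)[OF Tm] pull(1)[OF G] costT by simp
  qed
  with TY AEF show ?thesis by blast
qed

end
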